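(* Let $(M,\nabla,\langle\cdot,\cdot\rangle)$ be an affine-Riemann manifold with canonical Hermitian structure $(TM,J_1,g_1)$, and let $R^B$ be the curvature of its Bismut connection $\nabla^B$. For all vector fields $X,Y,Z$ on $M$, $$R^B(X^h,Y^h)Z^h=(K(X,Y)Z)^h,\qquad R^B(X^h,Y^h)Z^v=(K(X,Y)Z)^v,$$ $$R^B(X^v,Y^v)Z^v=(\gamma^*_{\gamma_Z^*Y}X)^v-(\gamma^*_{\gamma_Z^*X}Y)^v,\qquad R^B(X^v,Y^v)Z^h=(\gamma^*_{\gamma_Z^*Y}X)^h-(\gamma^*_{\gamma_Z^*X}Y)^h,$$ $$R^B(X^h,Y^v)Z^v=(\gamma_Z^*\circ\gamma_XY)^h+(D_X(\gamma^* )(Z,Y))^h,$$ $$R^B(X^h,Y^v)Z^h=-(\gamma_Z^*\circ\gamma_XY)^v-(D_X(\gamma^* )(Z,Y))^v,$$ where $K$ is the curvature of $D$. Moreover, the Ricci form $\rho^B$ of $\nabla^B$ is given by $$\rho^B(X^h,Y^h)=\rho^B(X^v,Y^v)=0,\qquad \rho^B(X^h,Y^v)=-\langle\gamma_XY,\mathrm{tr}_{\langle,\rangle}(\gamma)\rangle\circ\pi_1-\langle\mathrm{tr}_{\langle,\rangle}(D_X(\gamma)),Y\rangle\circ\pi_1.$$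
   Context: An affine-Riemann manifold $(M,\nabla,\langle\cdot,\cdot\rangle)$ is a manifold with a flat torsionless connection $\nabla$ and a Riemannian metric. $D$ is the Levi-Civita connection of the metric, with curvature $K(X,Y)=D_{[X,Y]}-D_XD_Y+D_YD_X$ (note the sign); the difference tensor is $\gamma_XY=D_XY-\nabla_XY$, and $\gamma^*$ is defined by $\langle\gamma^*_XY,Z\rangle=\langle Y,\gamma_XZ\rangle$. The covariant derivatives are $D_X(\gamma)(Y,Z)=D_X(\gamma_YZ)-\gamma_{D_XY}Z-\gamma_YD_XZ$ and similarly for $\gamma^*$. For a local orthonormal frame $(E_i)$, $\mathrm{tr}_{\langle,\rangle}(\gamma)=\sum_i\gamma_{E_i}E_i$ and $\mathrm{tr}_{\langle,\rangle}(D_X(\gamma))=\sum_iD_X(\gamma)(E_i,E_i)$. Canonical Hermitian structure: $\pi_1:TM\to M$ is the projection; for a vector field $X$ on $M$, $X^h$ is the horizontal lift with respect to $\nabla$ and $X^v$ the vertical lift; $J_1X^h=X^v$, $J_1X^v=-X^h$; $g_1(X^h,Y^h)=g_1(X^v,Y^v)=\langle X,Y\rangle\circ\pi_1$, $g_1(X^h,Y^v)=0$. For a Hermitian manifold $(N,J,g)$ of real dimension $2n$ with $\omega=g(J\cdot,\cdot)$ and Levi-Civita connection $\nabla^{LC}$, the Bismut connection is $g(\nabla^B_XY,Z)=g(\nabla^{LC}_XY,Z)+\frac12d\omega(JX,JY,JZ)$ (the unique connection preserving $J$ and $g$ with totally skew-symmetric torsion; $d\omega(X,Y,Z)=X.\omega(Y,Z)+Y.\omega(Z,X)+Z.\omega(X,Y)-\omega([X,Y],Z)-\omega([Y,Z],X)-\omega([Z,X],Y)$).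 Its curvature is $R^B(X,Y)=\nabla^B_{[X,Y]}-\nabla^B_X\nabla^B_Y+\nabla^B_Y\nabla^B_X$ and its Ricci form is $\rho^B(X,Y)=\frac12\sum_{i=1}^{2n}g(R^B(X,Y)E_i,JE_i)$ for a local $g$-orthonormal frame $(E_i)$. *)

theory Defs
  imports "HOL-Analysis.Analysis"
begin

section \<open>Smooth maps between Euclidean spaces\<close>

fun Ck_on :: "nat \<Rightarrow> 'e::real_normed_vector set \<Rightarrow> ('e \<Rightarrow> 'f::real_normed_vector) \<Rightarrow> bool" where
  "Ck_on 0 S f \<longleftrightarrow> continuous_on S f"
| "Ck_on (Suc k) S f \<longleftrightarrow>
     (\<forall>x\<in>S. f differentiable (at x)) \<and>
     (\<forall>v. Ck_on k S (\<lambda>x. frechet_derivative f (at x) v))"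

text \<open>Only used for open \<open>S\<close>.\<close>

definition smooth_on :: "'e::real_normed_vector set \<Rightarrow> ('e \<Rightarrow> 'f::real_normed_vector) \<Rightarrow> bool" where
  "smooth_on S f \<longleftrightarrow> (\<forall>k. Ck_on k S f)"


section \<open>Smooth manifolds\<close>

type_synonym ('a, 'e) chart = "'a set \<times> ('a \<Rightarrow> 'e)"

text \<open>
  A manifold modelled on \<open>'e\<close> is given by a smooth atlas on a carrier set. The field \<open>chart_at\<close>
  selects one chart of the atlas around each point. It is auxiliary: the tangent space at \<open>p\<close>
  is represented by the type \<open>'e\<close>, a tangent vector being identified with its components in the
  chart \<open>chart_at M p\<close>.
\<close>

record ('a, 'e) mfd =
  points :: "'a set"
  atlas :: "('a, 'e) chart set"
  chart_at :: "'a \<Rightarrow> ('a, 'e) chart"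

definition chart_inv :: "('a, 'e) chart \<Rightarrow> 'e \<Rightarrow> 'a" where
  "chart_inv c = inv_into (fst c) (snd c)"

definition mfd_open :: "('a, 'e::euclidean_space) mfd \<Rightarrow> 'a set \<Rightarrow> bool" where
  "mfd_open M S \<longleftrightarrow> S \<subseteq> points M \<and> (\<forall>c\<in>atlas M. open (snd c ` (fst c \<inter> S)))"

definition mfd_topology :: "('a, 'e::euclidean_space) mfd \<Rightarrow> 'a topology" where
  "mfd_topology M = topology (mfd_open M)"

definition smooth_atlas :: "('a, 'e::euclidean_space) mfd \<Rightarrow> bool" where
  "smooth_atlas M \<longleftrightarrow>
     (\<forall>c\<in>atlas M. fst c \<subseteq> points M \<and> inj_on (snd c) (fst c) \<and> open (snd c ` fst c)) \<and>
     (\<forall>c\<in>atlas M. \<forall>d\<in>atlas M.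
        open (snd c ` (fst c \<inter> fst d)) \<and>
        smooth_on (snd c ` (fst c \<inter> fst d)) (snd d \<circ> chart_inv c)) \<and>
     (\<forall>p\<in>points M. chart_at M p \<in> atlas M \<and> p \<in> fst (chart_at M p))"

definition smooth_manifold :: "('a, 'e::euclidean_space) mfd \<Rightarrow> bool" where
  "smooth_manifold M \<longleftrightarrow>
     smooth_atlas M \<and>
     Hausdorff_space (mfd_topology M) \<and>
     (\<exists>\<B>. countable \<B> \<and> (\<forall>V\<in>\<B>. openin (mfd_topology M) V) \<and>
        (\<forall>U p. openin (mfd_topology M) U \<and> p \<in> U \<longrightarrow> (\<exists>V\<in>\<B>. p \<in> V \<and> V \<subseteq> U)))"

lemma istopology_mfd_open:
  assumes "smooth_atlas M"
  shows "istopology (mfd_open M)"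
  unfolding istopology_def
proof (intro conjI allI impI)
  fix S T assume S: "mfd_open M S" and T: "mfd_open M T"
  have "open (snd c ` (fst c \<inter> (S \<inter> T)))" if c: "c \<in> atlas M" for c
  proof -
    have "inj_on (snd c) (fst c)"
      using assms c by (auto simp: smooth_atlas_def)
    then have "snd c ` (fst c \<inter> (S \<inter> T)) = snd c ` (fst c \<inter> S) \<inter> snd c ` (fst c \<inter> T)"
      by (auto simp: inj_on_def)
    then show ?thesis
      using S T c by (auto simp: mfd_open_def)
  qed
  then show "mfd_open M (S \<inter> T)"
    using S by (auto simp: mfd_open_def)
next
  fix \<K> assume K: "\<forall>S\<in>\<K>. mfd_open M S"
  have "open (snd c ` (fst c \<inter> \<Union>\<K>))" if "c \<in> atlas M" for c
  proof -
    have "snd c ` (fst c \<inter> \<Union>\<K>) = (\<Union>S\<in>\<K>. snd c ` (fst c \<inter> S))"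
      by auto
    then show ?thesis
      using K that by (auto simp: mfd_open_def)
  qed
  then show "mfd_open M (\<Union>\<K>)"
    using K by (auto simp: mfd_open_def)
qed

lemma openin_mfd_topology:
  "smooth_atlas M \<Longrightarrow> openin (mfd_topology M) S \<longleftrightarrow> mfd_open M S"
  by (simp add: mfd_topology_def istopology_mfd_open topology_inverse')


section \<open>Functions, tangent vectors and vector fields\<close>

text \<open>
  Functions and vector fields on an open set \<open>S\<close> are total functions, whose values outside \<open>S\<close>
  are irrelevant.
\<close>

definition smooth_fun :: "('a, 'e::euclidean_space) mfd \<Rightarrow> 'a set \<Rightarrow> ('a \<Rightarrow> real) \<Rightarrow> bool" where
  "smooth_fun M S f \<longleftrightarrow> openin (mfd_topology M) S \<and>
     (\<forall>c\<in>atlas M. smooth_on (snd c ` (fst c \<inter> S)) (f \<circ> chart_inv c))"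

text \<open>The components in the chart \<open>c\<close> of the tangent vector \<open>v\<close> at \<open>p\<close>.\<close>

definition tcoord :: "('a, 'e::euclidean_space) mfd \<Rightarrow> ('a, 'e) chart \<Rightarrow> 'a \<Rightarrow> 'e \<Rightarrow> 'e" where
  "tcoord M c p v =
     frechet_derivative (snd c \<circ> chart_inv (chart_at M p)) (at (snd (chart_at M p) p)) v"

definition vf_coord :: "('a, 'e::euclidean_space) mfd \<Rightarrow> ('a, 'e) chart \<Rightarrow> ('a \<Rightarrow> 'e) \<Rightarrow> 'e \<Rightarrow> 'e" where
  "vf_coord M c X x = tcoord M c (chart_inv c x) (X (chart_inv c x))"

definition smooth_vf :: "('a, 'e::euclidean_space) mfd \<Rightarrow> 'a set \<Rightarrow> ('a \<Rightarrow> 'e) \<Rightarrow> bool" where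
  "smooth_vf M S X \<longleftrightarrow> openin (mfd_topology M) S \<and>
     (\<forall>c\<in>atlas M. smooth_on (snd c ` (fst c \<inter> S)) (vf_coord M c X))"

definition dir_deriv ::
    "('a, 'e::euclidean_space) mfd \<Rightarrow> ('a \<Rightarrow> 'e) \<Rightarrow> ('a \<Rightarrow> real) \<Rightarrow> 'a \<Rightarrow> real" where
  "dir_deriv M X f p =
     frechet_derivative (f \<circ> chart_inv (chart_at M p)) (at (snd (chart_at M p) p)) (X p)"

definition differential ::
    "('a, 'e::euclidean_space) mfd \<Rightarrow> ('b, 'f::euclidean_space) mfd \<Rightarrow> ('a \<Rightarrow> 'b) \<Rightarrow> 'a \<Rightarrow> 'e \<Rightarrow> 'f" where
  "differential M N f p v =
     frechet_derivative (snd (chart_at N (f p)) \<circ> f \<circ> chart_inv (chart_at M p))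
       (at (snd (chart_at M p) p)) v"

definition lie_bracket ::
    "('a, 'e::euclidean_space) mfd \<Rightarrow> ('a \<Rightarrow> 'e) \<Rightarrow> ('a \<Rightarrow> 'e) \<Rightarrow> 'a \<Rightarrow> 'e" where
  "lie_bracket M X Y p =
     (let c = chart_at M p; x = snd c p in
        frechet_derivative (vf_coord M c Y) (at x) (vf_coord M c X x) -
        frechet_derivative (vf_coord M c X) (at x) (vf_coord M c Y x))"


section \<open>Connections and metrics\<close>

text \<open>
  A connection acts on the vector fields over every open set. Compatibility with restrictions is
  built in, since the same operator is used for all \<open>S\<close>: multiplying by the indicator function of
  \<open>S\<close>, which is smooth on \<open>S\<close>, shows that on \<open>S\<close> the value only depends on the restrictions of the
  arguments to \<open>S\<close>.
\<close>

definition connection ::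
    "('a, 'e::euclidean_space) mfd \<Rightarrow> (('a \<Rightarrow> 'e) \<Rightarrow> ('a \<Rightarrow> 'e) \<Rightarrow> 'a \<Rightarrow> 'e) \<Rightarrow> bool" where
  "connection M nabla \<longleftrightarrow>
     (\<forall>S X Y. smooth_vf M S X \<longrightarrow> smooth_vf M S Y \<longrightarrow> smooth_vf M S (nabla X Y)) \<and>
     (\<forall>S X X' Y. smooth_vf M S X \<longrightarrow> smooth_vf M S X' \<longrightarrow> smooth_vf M S Y \<longrightarrow>
        (\<forall>p\<in>S. nabla (\<lambda>q. X q + X' q) Y p = nabla X Y p + nabla X' Y p)) \<and>
     (\<forall>S f X Y. smooth_fun M S f \<longrightarrow> smooth_vf M S X \<longrightarrow> smooth_vf M S Y \<longrightarrow>
        (\<forall>p\<in>S. nabla (\<lambda>q. f q *\<^sub>R X q) Y p = f p *\<^sub>R nabla X Y p)) \<and>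
     (\<forall>S X Y Y'. smooth_vf M S X \<longrightarrow> smooth_vf M S Y \<longrightarrow> smooth_vf M S Y' \<longrightarrow>
        (\<forall>p\<in>S. nabla X (\<lambda>q. Y q + Y' q) p = nabla X Y p + nabla X Y' p)) \<and>
     (\<forall>S f X Y. smooth_fun M S f \<longrightarrow> smooth_vf M S X \<longrightarrow> smooth_vf M S Y \<longrightarrow>
        (\<forall>p\<in>S. nabla X (\<lambda>q. f q *\<^sub>R Y q) p = dir_deriv M X f p *\<^sub>R Y p + f p *\<^sub>R nabla X Y p))"

definition torsion_free ::
    "('a, 'e::euclidean_space) mfd \<Rightarrow> (('a \<Rightarrow> 'e) \<Rightarrow> ('a \<Rightarrow> 'e) \<Rightarrow> 'a \<Rightarrow> 'e) \<Rightarrow> bool" where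
  "torsion_free M nabla \<longleftrightarrow>
     (\<forall>S X Y. smooth_vf M S X \<longrightarrow> smooth_vf M S Y \<longrightarrow>
        (\<forall>p\<in>S. nabla X Y p - nabla Y X p = lie_bracket M X Y p))"

definition curvature ::
    "('a, 'e::euclidean_space) mfd \<Rightarrow> (('a \<Rightarrow> 'e) \<Rightarrow> ('a \<Rightarrow> 'e) \<Rightarrow> 'a \<Rightarrow> 'e) \<Rightarrow>
     ('a \<Rightarrow> 'e) \<Rightarrow> ('a \<Rightarrow> 'e) \<Rightarrow> ('a \<Rightarrow> 'e) \<Rightarrow> 'a \<Rightarrow> 'e" where
  "curvature M nabla X Y Z p =
     nabla (lie_bracket M X Y) Z p - nabla X (nabla Y Z) p + nabla Y (nabla X Z) p"

definition flat ::
    "('a, 'e::euclidean_space) mfd \<Rightarrow> (('a \<Rightarrow> 'e) \<Rightarrow> ('a \<Rightarrow> 'e) \<Rightarrow> 'a \<Rightarrow> 'e) \<Rightarrow> bool" where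
  "flat M nabla \<longleftrightarrow>
     (\<forall>S X Y Z. smooth_vf M S X \<longrightarrow> smooth_vf M S Y \<longrightarrow> smooth_vf M S Z \<longrightarrow>
        (\<forall>p\<in>S. curvature M nabla X Y Z p = 0))"

definition riemannian_metric ::
    "('a, 'e::euclidean_space) mfd \<Rightarrow> ('a \<Rightarrow> 'e \<Rightarrow> 'e \<Rightarrow> real) \<Rightarrow> bool" where
  "riemannian_metric M g \<longleftrightarrow>
     (\<forall>p\<in>points M. bilinear (g p) \<and> (\<forall>v w. g p v w = g p w v) \<and> (\<forall>v. v \<noteq> 0 \<longrightarrow> g p v v > 0)) \<and>
     (\<forall>S X Y. smooth_vf M S X \<longrightarrow> smooth_vf M S Y \<longrightarrow> smooth_fun M S (\<lambda>p. g p (X p) (Y p)))"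

definition levi_civita ::
    "('a, 'e::euclidean_space) mfd \<Rightarrow> ('a \<Rightarrow> 'e \<Rightarrow> 'e \<Rightarrow> real) \<Rightarrow>
     (('a \<Rightarrow> 'e) \<Rightarrow> ('a \<Rightarrow> 'e) \<Rightarrow> 'a \<Rightarrow> 'e) \<Rightarrow> bool" where
  "levi_civita M g D \<longleftrightarrow>
     connection M D \<and> torsion_free M D \<and>
     (\<forall>S X Y Z. smooth_vf M S X \<longrightarrow> smooth_vf M S Y \<longrightarrow> smooth_vf M S Z \<longrightarrow>
        (\<forall>p\<in>S. dir_deriv M X (\<lambda>q. g q (Y q) (Z q)) p =
           g p (D X Y p) (Z p) + g p (Y p) (D X Z p)))"

definition orthonormal_frame ::
    "('a, 'e::euclidean_space) mfd \<Rightarrow> ('a \<Rightarrow> 'e \<Rightarrow> 'e \<Rightarrow> real) \<Rightarrow> 'a set \<Rightarrow> (nat \<Rightarrow> 'a \<Rightarrow> 'e) \<Rightarrow> bool" where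
  "orthonormal_frame M g S E \<longleftrightarrow>
     (\<forall>i<DIM('e). smooth_vf M S (E i)) \<and>
     (\<forall>p\<in>S. \<forall>i<DIM('e). \<forall>j<DIM('e). g p (E i p) (E j p) = (if i = j then 1 else 0))"


section \<open>Affine-Riemann manifolds\<close>

definition affine_riemann ::
    "('a, 'e::euclidean_space) mfd \<Rightarrow> (('a \<Rightarrow> 'e) \<Rightarrow> ('a \<Rightarrow> 'e) \<Rightarrow> 'a \<Rightarrow> 'e) \<Rightarrow>
     ('a \<Rightarrow> 'e \<Rightarrow> 'e \<Rightarrow> real) \<Rightarrow> bool" where
  "affine_riemann M nabla g \<longleftrightarrow>
     smooth_manifold M \<and> connection M nabla \<and> torsion_free M nabla \<and> flat M nabla \<and>
     riemannian_metric M g"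

definition diff_tensor ::
    "(('a \<Rightarrow> 'e) \<Rightarrow> ('a \<Rightarrow> 'e) \<Rightarrow> 'a \<Rightarrow> 'e) \<Rightarrow> (('a \<Rightarrow> 'e) \<Rightarrow> ('a \<Rightarrow> 'e) \<Rightarrow> 'a \<Rightarrow> 'e::euclidean_space) \<Rightarrow>
     ('a \<Rightarrow> 'e) \<Rightarrow> ('a \<Rightarrow> 'e) \<Rightarrow> 'a \<Rightarrow> 'e" where
  "diff_tensor D nabla X Y p = D X Y p - nabla X Y p"

text \<open>The \<open>g\<close>-adjoint of \<open>T X\<close>, for a tensor field \<open>T\<close> of type (1,2).\<close>

definition adjoint_tensor ::
    "('a, 'e::euclidean_space) mfd \<Rightarrow> ('a \<Rightarrow> 'e \<Rightarrow> 'e \<Rightarrow> real) \<Rightarrow>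
     (('a \<Rightarrow> 'e) \<Rightarrow> ('a \<Rightarrow> 'e) \<Rightarrow> 'a \<Rightarrow> 'e) \<Rightarrow> ('a \<Rightarrow> 'e) \<Rightarrow> ('a \<Rightarrow> 'e) \<Rightarrow> 'a \<Rightarrow> 'e" where
  "adjoint_tensor M g T X Y p =
     (THE w. \<forall>S Z. p \<in> S \<longrightarrow> smooth_vf M S Z \<longrightarrow> g p w (Z p) = g p (Y p) (T X Z p))"

definition cov_deriv ::
    "(('a \<Rightarrow> 'e) \<Rightarrow> ('a \<Rightarrow> 'e) \<Rightarrow> 'a \<Rightarrow> 'e) \<Rightarrow> (('a \<Rightarrow> 'e) \<Rightarrow> ('a \<Rightarrow> 'e) \<Rightarrow> 'a \<Rightarrow> 'e::euclidean_space) \<Rightarrow>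
     ('a \<Rightarrow> 'e) \<Rightarrow> ('a \<Rightarrow> 'e) \<Rightarrow> ('a \<Rightarrow> 'e) \<Rightarrow> 'a \<Rightarrow> 'e" where
  "cov_deriv D T X Y Z p = D X (T Y Z) p - T (D X Y) Z p - T Y (D X Z) p"

text \<open>The trace of a (1,2)-tensor field with respect to a local orthonormal frame \<open>E\<close>.\<close>

definition frame_trace ::
    "(nat \<Rightarrow> 'a \<Rightarrow> 'e) \<Rightarrow> (('a \<Rightarrow> 'e) \<Rightarrow> ('a \<Rightarrow> 'e) \<Rightarrow> 'a \<Rightarrow> 'e::euclidean_space) \<Rightarrow> 'a \<Rightarrow> 'e" where
  "frame_trace E T p = (\<Sum>i<DIM('e). T (E i) (E i) p)"


section \<open>The tangent bundle and its canonical Hermitian structure\<close>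

definition tangent_chart ::
    "('a, 'e::euclidean_space) mfd \<Rightarrow> ('a, 'e) chart \<Rightarrow> ('a \<times> 'e, 'e \<times> 'e) chart" where
  "tangent_chart M c = (fst c \<times> UNIV, \<lambda>(p, u). (snd c p, tcoord M c p u))"

definition tangent_bundle ::
    "('a, 'e::euclidean_space) mfd \<Rightarrow> ('a \<times> 'e, 'e \<times> 'e) mfd" where
  "tangent_bundle M =
     \<lparr> points = points M \<times> UNIV,
       atlas = tangent_chart M ` atlas M,
       chart_at = (\<lambda>(p, u). tangent_chart M (chart_at M p)) \<rparr>"

text \<open>The velocity at \<open>t = 0\<close> of the curve \<open>t \<mapsto> u + t X(p)\<close> in the fibre over \<open>p\<close>.\<close>

definition vlift :: "('a, 'e::euclidean_space) mfd \<Rightarrow> ('a \<Rightarrow> 'e) \<Rightarrow> 'a \<times> 'e \<Rightarrow> 'e \<times> 'e" where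
  "vlift M X = (\<lambda>(p, u). vector_derivative
     (\<lambda>t. snd (chart_at (tangent_bundle M) (p, u)) (p, u + t *\<^sub>R X p)) (at 0))"

text \<open>
  The image of \<open>X(p)\<close> under the differential at \<open>p\<close> of any local section \<open>s\<close> of the tangent bundle
  through \<open>u\<close> that is parallel at \<open>p\<close> in the direction \<open>X(p)\<close>.
\<close>

definition hlift ::
    "('a, 'e::euclidean_space) mfd \<Rightarrow> (('a \<Rightarrow> 'e) \<Rightarrow> ('a \<Rightarrow> 'e) \<Rightarrow> 'a \<Rightarrow> 'e) \<Rightarrow>
     ('a \<Rightarrow> 'e) \<Rightarrow> 'a \<times> 'e \<Rightarrow> 'e \<times> 'e" where
  "hlift M nabla X = (\<lambda>(p, u). THE w. \<exists>S s. p \<in> S \<and> smooth_vf M S s \<and> s p = u \<and> nabla X s p = 0 \<and>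
     w = differential M (tangent_bundle M) (\<lambda>y. (y, s y)) p (X p))"

text \<open>
  \<open>J\<^sub>1\<close> and \<open>g\<^sub>1\<close> are defined on arbitrary tangent vectors at \<open>q\<close> by decomposing these as a
  horizontal lift plus a vertical lift.
\<close>

definition canonical_J ::
    "('a, 'e::euclidean_space) mfd \<Rightarrow> (('a \<Rightarrow> 'e) \<Rightarrow> ('a \<Rightarrow> 'e) \<Rightarrow> 'a \<Rightarrow> 'e) \<Rightarrow>
     'a \<times> 'e \<Rightarrow> 'e \<times> 'e \<Rightarrow> 'e \<times> 'e" where
  "canonical_J M nabla q w =
     (THE z. \<exists>S X Y. fst q \<in> S \<and> smooth_vf M S X \<and> smooth_vf M S Y \<and>
        w = hlift M nabla X q + vlift M Y q \<and>
        z = vlift M X q - hlift M nabla Y q)"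

definition canonical_g ::
    "('a, 'e::euclidean_space) mfd \<Rightarrow> (('a \<Rightarrow> 'e) \<Rightarrow> ('a \<Rightarrow> 'e) \<Rightarrow> 'a \<Rightarrow> 'e) \<Rightarrow>
     ('a \<Rightarrow> 'e \<Rightarrow> 'e \<Rightarrow> real) \<Rightarrow> 'a \<times> 'e \<Rightarrow> 'e \<times> 'e \<Rightarrow> 'e \<times> 'e \<Rightarrow> real" where
  "canonical_g M nabla g q w w' =
     (THE r. \<exists>S X Y X' Y'. fst q \<in> S \<and> smooth_vf M S X \<and> smooth_vf M S Y \<and>
        smooth_vf M S X' \<and> smooth_vf M S Y' \<and>
        w = hlift M nabla X q + vlift M Y q \<and>
        w' = hlift M nabla X' q + vlift M Y' q \<and>
        r = g (fst q) (X (fst q)) (X' (fst q)) + g (fst q) (Y (fst q)) (Y' (fst q)))"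


section \<open>The Bismut connection and its Ricci form\<close>

definition ext_deriv2 ::
    "('a, 'e::euclidean_space) mfd \<Rightarrow> ('a \<Rightarrow> 'e \<Rightarrow> 'e \<Rightarrow> real) \<Rightarrow>
     ('a \<Rightarrow> 'e) \<Rightarrow> ('a \<Rightarrow> 'e) \<Rightarrow> ('a \<Rightarrow> 'e) \<Rightarrow> 'a \<Rightarrow> real" where
  "ext_deriv2 N \<omega> X Y Z p =
     dir_deriv N X (\<lambda>q. \<omega> q (Y q) (Z q)) p +
     dir_deriv N Y (\<lambda>q. \<omega> q (Z q) (X q)) p +
     dir_deriv N Z (\<lambda>q. \<omega> q (X q) (Y q)) p -
     \<omega> p (lie_bracket N X Y p) (Z p) -
     \<omega> p (lie_bracket N Y Z p) (X p) -
     \<omega> p (lie_bracket N Z X p) (Y p)"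

definition fundamental_form ::
    "('a \<Rightarrow> 'e \<Rightarrow> 'e) \<Rightarrow> ('a \<Rightarrow> 'e \<Rightarrow> 'e \<Rightarrow> real) \<Rightarrow> 'a \<Rightarrow> 'e \<Rightarrow> 'e \<Rightarrow> real" where
  "fundamental_form J g p v w = g p (J p v) w"

definition bismut_connection ::
    "('a, 'e::euclidean_space) mfd \<Rightarrow> ('a \<Rightarrow> 'e \<Rightarrow> 'e) \<Rightarrow> ('a \<Rightarrow> 'e \<Rightarrow> 'e \<Rightarrow> real) \<Rightarrow>
     (('a \<Rightarrow> 'e) \<Rightarrow> ('a \<Rightarrow> 'e) \<Rightarrow> 'a \<Rightarrow> 'e) \<Rightarrow> bool" where
  "bismut_connection N J g B \<longleftrightarrow>
     connection N B \<and>
     (\<exists>L. levi_civita N g L \<and>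
        (\<forall>S X Y Z. smooth_vf N S X \<longrightarrow> smooth_vf N S Y \<longrightarrow> smooth_vf N S Z \<longrightarrow>
           (\<forall>p\<in>S. g p (B X Y p) (Z p) = g p (L X Y p) (Z p) +
              1/2 * ext_deriv2 N (fundamental_form J g)
                (\<lambda>q. J q (X q)) (\<lambda>q. J q (Y q)) (\<lambda>q. J q (Z q)) p)))"

text \<open>The Ricci form, computed in a local orthonormal frame \<open>E\<close>.\<close>

definition ricci_form ::
    "('a, 'e::euclidean_space) mfd \<Rightarrow> ('a \<Rightarrow> 'e \<Rightarrow> 'e) \<Rightarrow> ('a \<Rightarrow> 'e \<Rightarrow> 'e \<Rightarrow> real) \<Rightarrow>
     (('a \<Rightarrow> 'e) \<Rightarrow> ('a \<Rightarrow> 'e) \<Rightarrow> 'a \<Rightarrow> 'e) \<Rightarrow> (nat \<Rightarrow> 'a \<Rightarrow> 'e) \<Rightarrow>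
     ('a \<Rightarrow> 'e) \<Rightarrow> ('a \<Rightarrow> 'e) \<Rightarrow> 'a \<Rightarrow> real" where
  "ricci_form N J g B E X Y p =
     1/2 * (\<Sum>i<DIM('e). g p (curvature N B X Y (E i) p) (J p (E i p)))"

end

theory Submission
  imports Defs
begin

text \<open>
  In a chart of \<open>M\<close> the lifts at \<open>(x, u)\<close> are \<open>X\<^sup>h = (X, -\<Gamma>(X, u))\<close> and \<open>X\<^sup>v = (0, X)\<close>, and flatness of
  \<open>\<nabla>\<close> gives \<open>[X\<^sup>h, Y\<^sup>h] = [X, Y]\<^sup>h\<close>, \<open>[X\<^sup>h, Y\<^sup>v] = (\<nabla>\<^sub>X Y)\<^sup>v\<close>, \<open>[X\<^sup>v, Y\<^sup>v] = 0\<close>. The Koszul formula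
  and the values of \<open>d\<omega>\<close> on lifts, of which only
  \<open>d\<omega>(X\<^sup>h, Y\<^sup>h, Z\<^sup>v) = \<langle>Y, \<gamma>\<^sub>X Z\<rangle> - \<langle>X, \<gamma>\<^sub>Y Z\<rangle>\<close> is non-zero, then determine the Bismut connection:
  it maps \<open>(X\<^sup>h, Y\<^sup>h)\<close>, \<open>(X\<^sup>h, Y\<^sup>v)\<close>, \<open>(X\<^sup>v, Y\<^sup>h)\<close>, \<open>(X\<^sup>v, Y\<^sup>v)\<close> to \<open>(D\<^sub>X Y)\<^sup>h\<close>, \<open>(D\<^sub>X Y)\<^sup>v\<close>,
  \<open>(\<gamma>\<^sup>*\<^sub>Y X)\<^sup>v\<close>, \<open>-(\<gamma>\<^sup>*\<^sub>Y X)\<^sup>h\<close>. Iterating yields the curvature. Since the curvature is tensorial, the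
  Ricci form may be computed in an orthonormal basis of lifts.
\<close>

section \<open>Calculus of smooth maps\<close>

text \<open>A tangent vector at \<open>p\<close> is stored by its components in the chart chosen at
  \<open>p\<close>, so the values of a field at two points can be compared only after passing to one
  chart; the fields \<open>coord_field\<close> supply the local frames for this. Connections, lifts,
  \<open>canonical_J\<close> and adjoints are all given through fields, partly by definite
  descriptions, so much of the work is to show that they see only values at a point. For \<gamma>
  this holds because two connections share the derivative of the components and differ only in their
  Christoffel terms. The Levi-Civita connection of the bundle metric is never computed: with the
  torsion term included, the Koszul expression collapses on lifts. The composite of \<gamma> and its
  adjoint in the mixed curvature has a simple origin: brackets of a horizontal and a vertical lift
  see \<nabla>, whereas the Bismut connection in horizontal directions sees
  \<open>D\<close>.\<close>

lemma Ck_on_cong: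
  assumes "open S" "\<And>x. x \<in> S \<Longrightarrow> f x = g x" "Ck_on k S f"
  shows "Ck_on k S g"
  using assms(2,3)
proof (induction k arbitrary: f g)
  case 0
  then show ?case using continuous_on_cong by fastforce
next
  case (Suc k)
  have d: "(g has_derivative frechet_derivative f (at x)) (at x)" if "x \<in> S" for x
    by (rule has_derivative_transform_within_open[where f = f, OF _ assms(1) that])
      (use Suc.prems that in \<open>simp_all add: frechet_derivative_works\<close>)
  then have "frechet_derivative g (at x) = frechet_derivative f (at x)" if "x \<in> S" for x
    using that frechet_derivative_at by metis
  then have "Ck_on k S (\<lambda>x. frechet_derivative g (at x) v)" for v
    using Suc.IH[of "\<lambda>x. frechet_derivative f (at x) v"] Suc.prems(2) by simp
  then show ?case using d by (auto simp: differentiable_def)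
qed

text \<open>Lets a closure proof name its own derivative, so that the product and chain rules apply
  without evaluating \<open>frechet_derivative\<close>.\<close>

lemma Ck_on_SucI:
  assumes "open S" "\<And>x. x \<in> S \<Longrightarrow> (f has_derivative f' x) (at x)" "\<And>v. Ck_on k S (\<lambda>x. f' x v)"
  shows "Ck_on (Suc k) S f"
proof -
  have "frechet_derivative f (at x) = f' x" if "x \<in> S" for x
    using assms(2)[OF that] frechet_derivative_at by metis
  then have "Ck_on k S (\<lambda>x. frechet_derivative f (at x) v)" for v
    using Ck_on_cong[OF assms(1) _ assms(3)[of v]] by simp
  then show ?thesis using assms(2) by (auto simp: differentiable_def)
qed

text \<open>At positive levels \<open>Ck_on\<close> asks for differentiability and for regular
  derivatives, never for continuity, so the inclusion of C^(k+1) in C^k is an induction whose base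
  is that differentiability gives continuity.\<close>

lemma Ck_on_SucD: "Ck_on (Suc k) S f \<Longrightarrow> Ck_on k S f"
proof (induction k arbitrary: f)
  case 0
  then show ?case
    by (auto intro!: continuous_at_imp_continuous_on differentiable_imp_continuous_within)
next
  case (Suc k)
  have "Ck_on k S (\<lambda>x. frechet_derivative f (at x) v)" for v
    by (rule Suc.IH) (use iffD1[OF Ck_on.simps(2)[of "Suc k"] Suc.prems] in blast)
  then show ?case using iffD1[OF Ck_on.simps(2)[of "Suc k"] Suc.prems] by simp
qed

lemma Ck_on_derivD:
  "Ck_on (Suc k) S f \<Longrightarrow> x \<in> S \<Longrightarrow> (f has_derivative frechet_derivative f (at x)) (at x)"
  using frechet_derivative_works by auto

lemma Ck_on_const: "Ck_on k S (\<lambda>x. c)"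
  by (induction k arbitrary: c) auto

lemma Ck_on_bounded_linear:
  assumes "open S" "bounded_linear h" "Ck_on k S f"
  shows "Ck_on k S (\<lambda>x. h (f x))"
  using assms(3)
proof (induction k arbitrary: f)
  case 0
  then show ?case using bounded_linear.continuous_on[OF assms(2)] by simp
next
  case (Suc k)
  show ?case
  proof (rule Ck_on_SucI[OF assms(1)])
    show "((\<lambda>x. h (f x)) has_derivative (\<lambda>v. h (frechet_derivative f (at x) v))) (at x)" if "x \<in> S" for x
      using bounded_linear.has_derivative[OF assms(2)] Ck_on_derivD[OF Suc.prems that] .
  qed (use Suc in simp)
qed

lemma Ck_on_add:
  assumes "open S" "Ck_on k S f" "Ck_on k S g"
  shows "Ck_on k S (\<lambda>x. f x + g x)"
  using assms(2,3)
proof (induction k arbitrary: f g)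
  case 0
  then show ?case by (simp add: continuous_on_add)
next
  case (Suc k)
  show ?case
  proof (rule Ck_on_SucI[OF assms(1)])
    show "((\<lambda>x. f x + g x) has_derivative
        (\<lambda>v. frechet_derivative f (at x) v + frechet_derivative g (at x) v)) (at x)" if "x \<in> S" for x
      by (intro has_derivative_add Ck_on_derivD[OF Suc.prems(1)] Ck_on_derivD[OF Suc.prems(2)] that)
  qed (use Suc in simp)
qed

text \<open>Each summand of the product rule keeps one undifferentiated factor, which has to be
  lowered by \<open>Ck_on_SucD\<close> before the induction hypothesis applies.\<close>

lemma Ck_on_bounded_bilinear:
  assumes "open S" "bounded_bilinear h" "Ck_on k S f" "Ck_on k S g"
  shows "Ck_on k S (\<lambda>x. h (f x) (g x))"
  using assms(3,4)
proof (induction k arbitrary: f g)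
  case 0
  then show ?case using bounded_bilinear.continuous_on[OF assms(2)] by simp
next
  case (Suc k)
  show ?case
  proof (rule Ck_on_SucI[OF assms(1)])
    show "((\<lambda>x. h (f x) (g x)) has_derivative
        (\<lambda>v. h (f x) (frechet_derivative g (at x) v) + h (frechet_derivative f (at x) v) (g x))) (at x)"
      if "x \<in> S" for x
      by (intro bounded_bilinear.FDERIV[OF assms(2)] Ck_on_derivD[OF Suc.prems(1)]
          Ck_on_derivD[OF Suc.prems(2)] that)
  qed (use Suc Ck_on_SucD[OF Suc.prems(1)] Ck_on_SucD[OF Suc.prems(2)]
      in \<open>auto intro!: Ck_on_add assms(1)\<close>)
qed

lemma Ck_on_sum:
  assumes "open S" "\<And>i. i \<in> I \<Longrightarrow> Ck_on k S (f i)"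
  shows "Ck_on k S (\<lambda>x. \<Sum>i\<in>I. f i x)"
  using assms(2)
proof (induction I rule: infinite_finite_induct)
  case (insert i I)
  then show ?case by (auto intro!: Ck_on_add assms(1))
qed (auto intro: Ck_on_const)

text \<open>Trades a varying vector for finitely many scalar coefficients; many of the smoothness
  and tensoriality arguments pass through it.\<close>

lemma linear_basis_expansion:
  fixes h :: "'e::euclidean_space \<Rightarrow> 'f::real_vector"
  assumes "linear h"
  shows "h v = (\<Sum>b\<in>Basis. (v \<bullet> b) *\<^sub>R h b)"
proof -
  have "h v = h (\<Sum>b\<in>Basis. (v \<bullet> b) *\<^sub>R b)" by (simp add: euclidean_representation)
  also have "\<dots> = (\<Sum>b\<in>Basis. (v \<bullet> b) *\<^sub>R h b)"
    by (simp add: linear_sum[OF assms] linear_cmul[OF assms])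
  finally show ?thesis .
qed

lemma frechet_derivative_linear: "f differentiable at x \<Longrightarrow> linear (frechet_derivative f (at x))"
  using frechet_derivative_works has_derivative_linear by blast

text \<open>In the chain rule both the base point and the direction of the outer derivative vary,
  but \<open>Ck_on\<close> speaks only of fixed directions. Expanding the direction over the basis
  leaves products with compositions to which the induction hypothesis applies.\<close>

lemma Ck_on_compose:
  fixes f :: "'a::real_normed_vector \<Rightarrow> 'e::euclidean_space"
    and g :: "'e \<Rightarrow> 'f::real_normed_vector"
  assumes "open S" "f ` S \<subseteq> T" "Ck_on k S f" "Ck_on k T g"
  shows "Ck_on k S (\<lambda>x. g (f x))"
  using assms(3,4)
proof (induction k arbitrary: g)
  case 0
  then show ?case using assms(2) continuous_on_compose2[of T g S f] by simp
next
  case (Suc k)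
  show ?case
  proof (rule Ck_on_SucI[OF assms(1)])
    fix x assume x: "x \<in> S"
    then have fx: "f x \<in> T" using assms(2) by auto
    have "((\<lambda>x. g (f x)) has_derivative
        (\<lambda>v. frechet_derivative g (at (f x)) (frechet_derivative f (at x) v))) (at x)"
      using has_derivative_compose[OF Ck_on_derivD[OF Suc.prems(1) x] Ck_on_derivD[OF Suc.prems(2) fx]] .
    moreover have "frechet_derivative g (at (f x)) (frechet_derivative f (at x) v) =
        (\<Sum>b\<in>Basis. (frechet_derivative f (at x) v \<bullet> b) *\<^sub>R frechet_derivative g (at (f x)) b)" for v
      using Suc.prems(2) fx by (intro linear_basis_expansion frechet_derivative_linear) auto
    ultimately show "((\<lambda>x. g (f x)) has_derivative
        (\<lambda>v. \<Sum>b\<in>Basis. (frechet_derivative f (at x) v \<bullet> b) *\<^sub>R frechet_derivative g (at (f x)) b)) (at x)"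
      by (simp only:)
  next
    fix v
    have "Ck_on k S (\<lambda>x. frechet_derivative g (at (f x)) b)" for b
      using Suc.IH[of "\<lambda>y. frechet_derivative g (at y) b"] Suc.prems Ck_on_SucD by auto
    moreover have "Ck_on k S (\<lambda>x. frechet_derivative f (at x) v)" using Suc.prems by simp
    ultimately show "Ck_on k S (\<lambda>x. \<Sum>b\<in>Basis.
        (frechet_derivative f (at x) v \<bullet> b) *\<^sub>R frechet_derivative g (at (f x)) b)"
      by (intro Ck_on_sum assms(1) Ck_on_bounded_bilinear[OF _ bounded_bilinear_scaleR]
          Ck_on_bounded_linear[OF _ bounded_linear_inner_left])
  qed
qed

lemma Ck_on_subset: "Ck_on k S f \<Longrightarrow> T \<subseteq> S \<Longrightarrow> Ck_on k T f"
  by (induction k arbitrary: f) (auto intro: continuous_on_subset)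

lemma smooth_on_cong:
  "open S \<Longrightarrow> smooth_on S f \<Longrightarrow> (\<And>x. x \<in> S \<Longrightarrow> f x = g x) \<Longrightarrow> smooth_on S g"
  unfolding smooth_on_def using Ck_on_cong by blast

lemma smooth_on_const: "smooth_on S (\<lambda>x. c)"
  unfolding smooth_on_def using Ck_on_const by blast

lemma smooth_on_bounded_linear:
  "open S \<Longrightarrow> bounded_linear h \<Longrightarrow> smooth_on S f \<Longrightarrow> smooth_on S (\<lambda>x. h (f x))"
  unfolding smooth_on_def using Ck_on_bounded_linear by blast

lemma smooth_on_ident: "open S \<Longrightarrow> smooth_on S (\<lambda>x. x)"
proof -
  assume S: "open S"
  have "Ck_on k S (\<lambda>x. x)" for k
    by (cases k) (auto intro: Ck_on_const simp: continuous_on_id)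
  then show ?thesis by (simp add: smooth_on_def)
qed

lemma smooth_on_add: "open S \<Longrightarrow> smooth_on S f \<Longrightarrow> smooth_on S g \<Longrightarrow> smooth_on S (\<lambda>x. f x + g x)"
  unfolding smooth_on_def using Ck_on_add by blast

lemma smooth_on_bounded_bilinear:
  "open S \<Longrightarrow> bounded_bilinear h \<Longrightarrow> smooth_on S f \<Longrightarrow> smooth_on S g \<Longrightarrow> smooth_on S (\<lambda>x. h (f x) (g x))"
  unfolding smooth_on_def using Ck_on_bounded_bilinear by blast

lemmas smooth_on_scaleR = smooth_on_bounded_bilinear[OF _ bounded_bilinear_scaleR]

lemma smooth_on_inner_left: "open S \<Longrightarrow> smooth_on S f \<Longrightarrow> smooth_on S (\<lambda>x. f x \<bullet> b)"
  by (rule smooth_on_bounded_linear[OF _ bounded_linear_inner_left])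

lemma smooth_on_sum:
  "open S \<Longrightarrow> (\<And>i. i \<in> I \<Longrightarrow> smooth_on S (f i)) \<Longrightarrow> smooth_on S (\<lambda>x. \<Sum>i\<in>I. f i x)"
  unfolding smooth_on_def by (intro allI Ck_on_sum) auto

lemma smooth_on_diff: "open S \<Longrightarrow> smooth_on S f \<Longrightarrow> smooth_on S g \<Longrightarrow> smooth_on S (\<lambda>x. f x - g x)"
  using smooth_on_add[of S f "\<lambda>x. - g x"]
    smooth_on_bounded_linear[OF _ bounded_linear_minus[OF bounded_linear_ident], of S g] by simp

lemma smooth_on_Pair:
  assumes "open S" "smooth_on S f" "smooth_on S g"
  shows "smooth_on S (\<lambda>x. (f x, g x))"
proof -
  have "smooth_on S (\<lambda>x. (f x, 0))"
    by (rule smooth_on_bounded_linear[OF assms(1) _ assms(2)])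
      (intro bounded_linear_Pair bounded_linear_ident bounded_linear_zero)
  moreover have "smooth_on S (\<lambda>x. (0, g x))"
    by (rule smooth_on_bounded_linear[OF assms(1) _ assms(3)])
      (intro bounded_linear_Pair bounded_linear_ident bounded_linear_zero)
  ultimately have "smooth_on S (\<lambda>x. (f x, 0) + (0, g x))"
    by (rule smooth_on_add[OF assms(1)])
  then show ?thesis by simp
qed

lemma smooth_on_compose:
  fixes f :: "'a::real_normed_vector \<Rightarrow> 'e::euclidean_space"
    and g :: "'e \<Rightarrow> 'f::real_normed_vector"
  shows "open S \<Longrightarrow> f ` S \<subseteq> T \<Longrightarrow> smooth_on S f \<Longrightarrow> smooth_on T g \<Longrightarrow> smooth_on S (\<lambda>x. g (f x))"
  unfolding smooth_on_def using Ck_on_compose by blast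

lemma smooth_on_subset: "smooth_on S f \<Longrightarrow> T \<subseteq> S \<Longrightarrow> smooth_on T f"
  unfolding smooth_on_def using Ck_on_subset by blast

lemma smooth_on_differentiable: "smooth_on S f \<Longrightarrow> x \<in> S \<Longrightarrow> f differentiable at x"
  unfolding smooth_on_def using Ck_on.simps(2) by blast

lemma smooth_on_has_derivative:
  "smooth_on S f \<Longrightarrow> x \<in> S \<Longrightarrow> (f has_derivative frechet_derivative f (at x)) (at x)"
  using smooth_on_differentiable frechet_derivative_works by blast

lemma smooth_on_frechet_derivative:
  "smooth_on S f \<Longrightarrow> smooth_on S (\<lambda>x. frechet_derivative f (at x) v)"
  unfolding smooth_on_def using Ck_on.simps(2) by blast

lemma smooth_on_frechet_derivative_field:
  fixes f :: "'e::euclidean_space \<Rightarrow> 'f::real_normed_vector"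
  assumes "open S" "smooth_on S f" "smooth_on S w"
  shows "smooth_on S (\<lambda>x. frechet_derivative f (at x) (w x))"
proof (rule smooth_on_cong[OF assms(1)])
  show "smooth_on S (\<lambda>x. \<Sum>b\<in>Basis. (w x \<bullet> b) *\<^sub>R frechet_derivative f (at x) b)"
    using assms by (intro smooth_on_sum smooth_on_scaleR smooth_on_inner_left smooth_on_frechet_derivative)
qed (use assms in \<open>metis linear_basis_expansion frechet_derivative_linear smooth_on_differentiable\<close>)

text \<open>\<open>frechet_derivative\<close> is a choice from the predicate
  \<open>has_derivative\<close>, and this predicate depends only on the germ, so the chosen maps
  coincide even at points without a derivative.\<close>

lemma frechet_derivative_cong:
  assumes "open S" "x \<in> S" "\<And>y. y \<in> S \<Longrightarrow> f y = g y"
  shows "frechet_derivative f (at x) = frechet_derivative g (at x)"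
proof -
  have "(f has_derivative f') (at x) \<longleftrightarrow> (g has_derivative f') (at x)" for f'
    using assms has_derivative_transform_within_open by metis
  then show ?thesis by (simp add: frechet_derivative_def)
qed

lemma frechet_derivative_eqI: "(f has_derivative f') (at x) \<Longrightarrow> frechet_derivative f (at x) v = f' v"
  by (metis frechet_derivative_at)

lemma frechet_derivative_sum_scaleR:
  assumes "\<And>b. b \<in> I \<Longrightarrow> f b differentiable at x" "\<And>b. b \<in> I \<Longrightarrow> g b differentiable at x"
  shows "frechet_derivative (\<lambda>x. \<Sum>b\<in>I. f b x *\<^sub>R g b x) (at x) v =
    (\<Sum>b\<in>I. f b x *\<^sub>R frechet_derivative (g b) (at x) v + frechet_derivative (f b) (at x) v *\<^sub>R g b x)"
  by (rule frechet_derivative_eqI)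
    (intro has_derivative_sum has_derivative_scaleR assms[THEN iffD1[OF frechet_derivative_works]])

section \<open>Symmetry of second derivatives\<close>

text \<open>Two applications of the mean value theorem: first to the difference in direction
  \<open>w\<close> as a function of \<open>s\<close>, then to the derivative along \<open>v\<close>
  as a function of \<open>t\<close>.\<close>

lemma double_difference_mvt:
  fixes f :: "'e::euclidean_space \<Rightarrow> real"
  assumes "smooth_on S f" "0 < h"
    and S: "\<And>s t. 0 \<le> s \<Longrightarrow> s \<le> h \<Longrightarrow> 0 \<le> t \<Longrightarrow> t \<le> h \<Longrightarrow> x + s *\<^sub>R v + t *\<^sub>R w \<in> S"
  shows "\<exists>s t. 0 < s \<and> s < h \<and> 0 < t \<and> t < h \<and>
    f (x + h *\<^sub>R v + h *\<^sub>R w) - f (x + h *\<^sub>R v) - f (x + h *\<^sub>R w) + f x =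
    h * (h * frechet_derivative (\<lambda>y. frechet_derivative f (at y) v) (at (x + s *\<^sub>R v + t *\<^sub>R w)) w)"
proof -
  define P where "P s t = x + s *\<^sub>R v + t *\<^sub>R w" for s t
  have D1: "((\<lambda>s. F (P s t)) has_real_derivative frechet_derivative F (at (P s t)) v) (at s)"
    and D2: "((\<lambda>t. F (P s t)) has_real_derivative frechet_derivative F (at (P s t)) w) (at t)"
    if "smooth_on S F" "0 \<le> s" "s \<le> h" "0 \<le> t" "t \<le> h" for F s t
  proof -
    have d: "(F has_derivative frechet_derivative F (at (P s t))) (at (P s t))"
      using smooth_on_has_derivative[OF that(1)] S that by (auto simp: P_def)
    note lin = has_derivative_linear[OF d]
    have "((\<lambda>s. P s t) has_derivative (\<lambda>k. k *\<^sub>R v)) (at s)"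
      unfolding P_def by (auto intro!: derivative_eq_intros)
    from has_derivative_compose[OF this d]
    show "((\<lambda>s. F (P s t)) has_real_derivative frechet_derivative F (at (P s t)) v) (at s)"
      by (simp add: has_field_derivative_def linear_cmul[OF lin] mult_commute_abs)
    have "((\<lambda>t. P s t) has_derivative (\<lambda>k. k *\<^sub>R w)) (at t)"
      unfolding P_def by (auto intro!: derivative_eq_intros)
    from has_derivative_compose[OF this d]
    show "((\<lambda>t. F (P s t)) has_real_derivative frechet_derivative F (at (P s t)) w) (at t)"
      by (simp add: has_field_derivative_def linear_cmul[OF lin] mult_commute_abs)
  qed
  have "\<exists>s>0. s < h \<and> (f (P h h) - f (P h 0)) - (f (P 0 h) - f (P 0 0)) =
      (h - 0) * (frechet_derivative f (at (P s h)) v - frechet_derivative f (at (P s 0)) v)"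
    using assms(2) by (intro MVT2[where f = "\<lambda>s. f (P s h) - f (P s 0)"] DERIV_diff D1 assms(1)) auto
  then obtain s where s: "0 < s" "s < h" "(f (P h h) - f (P h 0)) - (f (P 0 h) - f (P 0 0)) =
      h * (frechet_derivative f (at (P s h)) v - frechet_derivative f (at (P s 0)) v)" by auto
  have "\<exists>t>0. t < h \<and> frechet_derivative f (at (P s h)) v - frechet_derivative f (at (P s 0)) v =
      (h - 0) * frechet_derivative (\<lambda>y. frechet_derivative f (at y) v) (at (P s t)) w"
    using assms(2) s
    by (intro MVT2[where f = "\<lambda>t. frechet_derivative f (at (P s t)) v"]
        D2[where F = "\<lambda>y. frechet_derivative f (at y) v"] smooth_on_frechet_derivative assms(1)) auto
  then obtain t where t: "0 < t" "t < h"
    "frechet_derivative f (at (P s h)) v - frechet_derivative f (at (P s 0)) v =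
      h * frechet_derivative (\<lambda>y. frechet_derivative f (at y) v) (at (P s t)) w" by auto
  have "f (P h h) - f (P h 0) - f (P 0 h) + f (P 0 0) =
      h * (h * frechet_derivative (\<lambda>y. frechet_derivative f (at y) v) (at (P s t)) w)"
    using s(3) t(3) by simp
  then show ?thesis using s(1,2) t(1,2) by (intro exI[of _ s] exI[of _ t]) (simp add: P_def)
qed

text \<open>Both orders of differentiation evaluate the same double difference, which is unchanged
  when \<open>v\<close> and \<open>w\<close> are exchanged. By continuity each mixed derivative,
  taken near \<open>x\<close>, is within half of the supposed gap of its value at \<open>x\<close>,
  so the gap could not exist.\<close>

lemma second_derivative_symmetric:
  fixes f :: "'e::euclidean_space \<Rightarrow> real"
  assumes "open S" "smooth_on S f" "x \<in> S"
  shows "frechet_derivative (\<lambda>y. frechet_derivative f (at y) v) (at x) w =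
    frechet_derivative (\<lambda>y. frechet_derivative f (at y) w) (at x) v"
proof (rule ccontr)
  define F where "F y = frechet_derivative (\<lambda>y. frechet_derivative f (at y) v) (at y) w" for y
  define G where "G y = frechet_derivative (\<lambda>y. frechet_derivative f (at y) w) (at y) v" for y
  assume "\<not> ?thesis"
  then have ne: "\<bar>F x - G x\<bar> / 2 > 0" by (auto simp: F_def G_def)
  have "smooth_on S F" "smooth_on S G"
    unfolding F_def G_def by (intro smooth_on_frechet_derivative assms(2))+
  then have "isCont F x" "isCont G x"
    using smooth_on_differentiable differentiable_imp_continuous_within assms(3) by blast+
  then obtain d1 d2 where d: "d1 > 0" "\<And>y. dist y x < d1 \<Longrightarrow> dist (F y) (F x) < \<bar>F x - G x\<bar> / 2"
    "d2 > 0" "\<And>y. dist y x < d2 \<Longrightarrow> dist (G y) (G x) < \<bar>F x - G x\<bar> / 2"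
    using ne unfolding continuous_at_eps_delta by metis
  obtain e where e: "e > 0" "ball x e \<subseteq> S" using assms(1,3) openE by blast
  define m where "m = min e (min d1 d2)"
  \<comment> \<open>The summand 1 keeps the denominator positive when \<open>v\<close> and
    \<open>w\<close> vanish; the factor 2 keeps the whole parallelogram within distance
    \<open>m / 2\<close> of \<open>x\<close>.\<close>
  define h where "h = m / (2 * (1 + norm v + norm w))"
  have m: "m > 0" "m \<le> e" "m \<le> d1" "m \<le> d2" using e d by (auto simp: m_def)
  have n: "1 + norm v + norm w > 0" by (simp add: add_pos_nonneg)
  have h: "h > 0" unfolding h_def using m n by simp
  have hm: "h * (norm v + norm w) < m"
  proof -
    have "h * (norm v + norm w) \<le> h * (1 + norm v + norm w)" using h by (intro mult_left_mono) auto
    also have "\<dots> = m / 2" unfolding h_def using n by (simp add: field_simps)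
    finally show ?thesis using m by simp
  qed
  \<comment> \<open>Stated for an unordered pair so that both orders of the double difference are
    covered.\<close>
  have near: "dist (x + s *\<^sub>R a + t *\<^sub>R b) x < m"
    if "0 \<le> s" "s \<le> h" "0 \<le> t" "t \<le> h" "{a, b} = {v, w}" for s t a b
  proof -
    have "norm (s *\<^sub>R a + t *\<^sub>R b) \<le> s * norm a + t * norm b"
      using that by (intro order_trans[OF norm_triangle_ineq]) auto
    also have "\<dots> \<le> h * norm a + h * norm b" using that by (intro add_mono mult_right_mono) auto
    also have "\<dots> = h * (norm v + norm w)" using that(5) by (auto simp: doubleton_eq_iff algebra_simps)
    finally show ?thesis using hm by (simp add: dist_norm algebra_simps)
  qed
  have inS: "x + s *\<^sub>R a + t *\<^sub>R b \<in> S"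
    if "0 \<le> s" "s \<le> h" "0 \<le> t" "t \<le> h" "{a, b} = {v, w}" for s t a b
    using near[OF that] m e by (auto simp: dist_commute intro!: subsetD[OF e(2)])
  obtain s t where st: "0 < s" "s < h" "0 < t" "t < h"
    "f (x + h *\<^sub>R v + h *\<^sub>R w) - f (x + h *\<^sub>R v) - f (x + h *\<^sub>R w) + f x =
      h * (h * F (x + s *\<^sub>R v + t *\<^sub>R w))"
    using double_difference_mvt[OF assms(2) h inS, of v w] unfolding F_def by auto
  obtain s' t' where st': "0 < s'" "s' < h" "0 < t'" "t' < h"
    "f (x + h *\<^sub>R w + h *\<^sub>R v) - f (x + h *\<^sub>R w) - f (x + h *\<^sub>R v) + f x =
      h * (h * G (x + s' *\<^sub>R w + t' *\<^sub>R v))"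
    using double_difference_mvt[OF assms(2) h inS, of w v] unfolding G_def by auto
  have sw: "x + h *\<^sub>R w + h *\<^sub>R v = x + h *\<^sub>R v + h *\<^sub>R w" by (simp add: algebra_simps)
  have "h * (h * F (x + s *\<^sub>R v + t *\<^sub>R w)) = h * (h * G (x + s' *\<^sub>R w + t' *\<^sub>R v))"
    using st(5) st'(5)[unfolded sw] by linarith
  then have "F (x + s *\<^sub>R v + t *\<^sub>R w) = G (x + s' *\<^sub>R w + t' *\<^sub>R v)" using h by simp
  moreover have "dist (F (x + s *\<^sub>R v + t *\<^sub>R w)) (F x) < \<bar>F x - G x\<bar> / 2"
    using near[of s t v w] st m by (intro d(2)) auto
  moreover have "dist (G (x + s' *\<^sub>R w + t' *\<^sub>R v)) (G x) < \<bar>F x - G x\<bar> / 2"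
    using near[of s' t' w v] st' m by (intro d(4)) (auto simp: insert_commute)
  ultimately show False by (simp add: dist_real_def abs_if split: if_splits)
qed

section \<open>Coordinates on a manifold\<close>

definition transition :: "('a, 'e) chart \<Rightarrow> ('a, 'e) chart \<Rightarrow> 'e \<Rightarrow> 'e" where
  "transition c d = snd d \<circ> chart_inv c"

text \<open>The field with constant components in the chart \<open>c\<close>. A constant function
  would not do, as its values at different points refer to different charts.\<close>

definition coord_field :: "('a, 'e::euclidean_space) mfd \<Rightarrow> ('a, 'e) chart \<Rightarrow> 'e \<Rightarrow> 'a \<Rightarrow> 'e" where
  "coord_field M c v p = frechet_derivative (transition c (chart_at M p)) (at (snd c p)) v"

lemma tcoord_transition:
  "tcoord M c p v = frechet_derivative (transition (chart_at M p) c) (at (snd (chart_at M p) p)) v"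
  by (simp add: tcoord_def transition_def)

locale atlas_manifold =
  fixes M :: "('a, 'e::euclidean_space) mfd"
  assumes atlas: "smooth_atlas M"
begin

lemma openin_iff: "openin (mfd_topology M) S \<longleftrightarrow> mfd_open M S"
  by (rule openin_mfd_topology[OF atlas])

lemma chart_inj: "c \<in> atlas M \<Longrightarrow> inj_on (snd c) (fst c)"
  using atlas by (auto simp: smooth_atlas_def)

lemma chart_at: "p \<in> points M \<Longrightarrow> chart_at M p \<in> atlas M" "p \<in> points M \<Longrightarrow> p \<in> fst (chart_at M p)"
  using atlas by (auto simp: smooth_atlas_def)

lemma chart_subset: "c \<in> atlas M \<Longrightarrow> p \<in> fst c \<Longrightarrow> p \<in> points M"
  using atlas by (auto simp: smooth_atlas_def)

lemma openin_points: "openin (mfd_topology M) (points M)"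
proof -
  have "fst c \<inter> points M = fst c" if "c \<in> atlas M" for c using chart_subset[OF that] by auto
  then show ?thesis using atlas by (auto simp: openin_iff mfd_open_def smooth_atlas_def)
qed

lemma openin_subset_points: "openin (mfd_topology M) S \<Longrightarrow> S \<subseteq> points M"
  by (simp add: openin_iff mfd_open_def)

lemma openin_chart: "c \<in> atlas M \<Longrightarrow> openin (mfd_topology M) (fst c)"
  using atlas by (auto simp: openin_iff mfd_open_def smooth_atlas_def)

lemma open_image: "openin (mfd_topology M) S \<Longrightarrow> c \<in> atlas M \<Longrightarrow> open (snd c ` (fst c \<inter> S))"
  by (simp add: openin_iff mfd_open_def)

lemma chart_inv_left [simp]: "c \<in> atlas M \<Longrightarrow> p \<in> fst c \<Longrightarrow> chart_inv c (snd c p) = p"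
  by (simp add: chart_inv_def chart_inj)

lemma transition_at [simp]: "c \<in> atlas M \<Longrightarrow> p \<in> fst c \<Longrightarrow> transition c d (snd c p) = snd d p"
  by (simp add: transition_def)

lemma transition_smooth:
  "c \<in> atlas M \<Longrightarrow> d \<in> atlas M \<Longrightarrow> smooth_on (snd c ` (fst c \<inter> fst d)) (transition c d)"
  using atlas by (auto simp: smooth_atlas_def transition_def)

lemma transition_has_derivative:
  assumes "c \<in> atlas M" "d \<in> atlas M" "p \<in> fst c" "p \<in> fst d"
  shows "(transition c d has_derivative frechet_derivative (transition c d) (at (snd c p))) (at (snd c p))"
  using smooth_on_has_derivative[OF transition_smooth[OF assms(1,2)]] assms(3,4) by blast

lemma transition_derivative_linear:
  assumes "c \<in> atlas M" "d \<in> atlas M" "p \<in> fst c" "p \<in> fst d"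
  shows "linear (frechet_derivative (transition c d) (at (snd c p)))"
  using has_derivative_linear[OF transition_has_derivative[OF assms]] .

text \<open>The cocycle rule for Jacobians. The composite agrees with the direct transition only
  where the middle chart is defined, hence the passage through an open neighbourhood.\<close>

lemma transition_derivative_compose:
  assumes "c \<in> atlas M" "d \<in> atlas M" "e \<in> atlas M" "p \<in> fst c" "p \<in> fst d" "p \<in> fst e"
  shows "frechet_derivative (transition d e) (at (snd d p))
      (frechet_derivative (transition c d) (at (snd c p)) v) =
    frechet_derivative (transition c e) (at (snd c p)) v"
proof -
  have d: "((\<lambda>x. transition d e (transition c d x)) has_derivative
      (\<lambda>v. frechet_derivative (transition d e) (at (snd d p))
        (frechet_derivative (transition c d) (at (snd c p)) v))) (at (snd c p))"
    using transition_has_derivative[of d e p] assms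
    by (intro has_derivative_compose[OF transition_has_derivative]) auto
  have "(transition c e has_derivative
      (\<lambda>v. frechet_derivative (transition d e) (at (snd d p))
        (frechet_derivative (transition c d) (at (snd c p)) v))) (at (snd c p))"
    by (rule has_derivative_transform_within_open[OF d open_image[OF openin_chart[OF assms(2)] assms(1)]])
      (use assms in auto)
  then show ?thesis by (rule frechet_derivative_eqI[symmetric])
qed

lemma transition_self_derivative:
  assumes "c \<in> atlas M" "p \<in> fst c"
  shows "frechet_derivative (transition c c) (at (snd c p)) v = v"
proof (rule frechet_derivative_eqI)
  show "(transition c c has_derivative (\<lambda>v. v)) (at (snd c p))"
    by (rule has_derivative_transform_within_open[OF has_derivative_ident
          open_image[OF openin_chart[OF assms(1)] assms(1)]])
      (use assms in auto)
qed

lemma tcoord_linear: "c \<in> atlas M \<Longrightarrow> p \<in> fst c \<Longrightarrow> linear (tcoord M c p)"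
  using transition_derivative_linear[of "chart_at M p" c p] chart_at chart_subset
  by (simp add: tcoord_transition[abs_def])

lemma coord_field_linear: "c \<in> atlas M \<Longrightarrow> p \<in> fst c \<Longrightarrow> linear (\<lambda>v. coord_field M c v p)"
  using transition_derivative_linear[of c "chart_at M p" p] chart_at chart_subset
  by (simp add: coord_field_def)

lemma tcoord_coord_field [simp]: "c \<in> atlas M \<Longrightarrow> p \<in> fst c \<Longrightarrow> tcoord M c p (coord_field M c v p) = v"
  by (simp add: tcoord_transition coord_field_def transition_derivative_compose chart_at
      chart_subset transition_self_derivative)

lemma coord_field_tcoord [simp]: "c \<in> atlas M \<Longrightarrow> p \<in> fst c \<Longrightarrow> coord_field M c (tcoord M c p v) p = v"
  using transition_self_derivative[of "chart_at M p" p]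
  by (simp add: tcoord_transition coord_field_def transition_derivative_compose chart_at
      chart_subset)

lemma tcoord_chart_at [simp]: "p \<in> points M \<Longrightarrow> tcoord M (chart_at M p) p v = v"
  by (simp add: tcoord_transition transition_self_derivative chart_at)

lemma coord_field_chart_at [simp]: "p \<in> points M \<Longrightarrow> coord_field M (chart_at M p) v p = v"
  by (simp add: coord_field_def transition_self_derivative chart_at)

lemma tcoord_change:
  assumes "c \<in> atlas M" "d \<in> atlas M" "p \<in> fst c" "p \<in> fst d"
  shows "tcoord M d p v = frechet_derivative (transition c d) (at (snd c p)) (tcoord M c p v)"
  using assms by (simp add: tcoord_transition transition_derivative_compose chart_at chart_subset)

lemma vf_coord_at [simp]: "c \<in> atlas M \<Longrightarrow> p \<in> fst c \<Longrightarrow> vf_coord M c X (snd c p) = tcoord M c p (X p)"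
  by (simp add: vf_coord_def)

section \<open>Smooth functions and vector fields in charts\<close>

lemma smooth_vf_openin: "smooth_vf M S X \<Longrightarrow> openin (mfd_topology M) S"
  by (simp add: smooth_vf_def)

lemma smooth_fun_openin: "smooth_fun M S f \<Longrightarrow> openin (mfd_topology M) S"
  by (simp add: smooth_fun_def)

lemma smooth_vf_coord: "smooth_vf M S X \<Longrightarrow> c \<in> atlas M \<Longrightarrow> smooth_on (snd c ` (fst c \<inter> S)) (vf_coord M c X)"
  by (simp add: smooth_vf_def)

lemma smooth_fun_coord: "smooth_fun M S f \<Longrightarrow> c \<in> atlas M \<Longrightarrow> smooth_on (snd c ` (fst c \<inter> S)) (f \<circ> chart_inv c)"
  by (simp add: smooth_fun_def)

lemma smooth_vf_subset: "smooth_vf M S X \<Longrightarrow> openin (mfd_topology M) T \<Longrightarrow> T \<subseteq> S \<Longrightarrow> smooth_vf M T X"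
  unfolding smooth_vf_def by (intro conjI ballI) (auto elim!: smooth_on_subset dest!: bspec)

lemma smooth_vf_cong:
  assumes "smooth_vf M S X" "\<And>p. p \<in> S \<Longrightarrow> X p = Y p"
  shows "smooth_vf M S Y"
  unfolding smooth_vf_def
proof (intro conjI ballI)
  show "smooth_on (snd c ` (fst c \<inter> S)) (vf_coord M c Y)" if "c \<in> atlas M" for c
    by (rule smooth_on_cong[OF open_image[OF smooth_vf_openin[OF assms(1)] that]
          smooth_vf_coord[OF assms(1) that]]) (use assms(2) that in auto)
qed (use assms smooth_vf_openin in auto)

lemma smooth_fun_cong:
  assumes "smooth_fun M S f" "\<And>p. p \<in> S \<Longrightarrow> f p = h p"
  shows "smooth_fun M S h"
  unfolding smooth_fun_def
proof (intro conjI ballI)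
  show "smooth_on (snd c ` (fst c \<inter> S)) (h \<circ> chart_inv c)" if "c \<in> atlas M" for c
    by (rule smooth_on_cong[OF open_image[OF smooth_fun_openin[OF assms(1)] that]
          smooth_fun_coord[OF assms(1) that]]) (use assms(2) that in auto)
qed (use assms smooth_fun_openin in auto)

text \<open>Components in another chart arise through the Jacobian of a transition map, so
  smoothness in a single chart covering \<open>S\<close> is enough.\<close>

lemma smooth_vf_chartI:
  assumes S: "openin (mfd_topology M) S" and c: "c \<in> atlas M" "S \<subseteq> fst c"
    and X: "smooth_on (snd c ` S) (vf_coord M c X)"
  shows "smooth_vf M S X"
  unfolding smooth_vf_def
proof (intro conjI ballI S)
  fix d assume d: "d \<in> atlas M"
  \<comment> \<open>The Jacobian is applied in the coordinates of \<open>c\<close>; the result is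
    then carried to those of \<open>d\<close> by the reverse transition.\<close>
  have "smooth_on (snd c ` (fst c \<inter> (fst d \<inter> S)))
      (\<lambda>x. frechet_derivative (transition c d) (at x) (vf_coord M c X x))"
    by (rule smooth_on_frechet_derivative_field)
      (use open_image[OF openin_Int[OF openin_chart[OF d] S] c(1)] in
        \<open>auto intro: smooth_on_subset[OF transition_smooth[OF c(1) d]] smooth_on_subset[OF X]\<close>)
  then have "smooth_on (snd d ` (fst d \<inter> S)) (\<lambda>y. frechet_derivative (transition c d)
      (at (transition d c y)) (vf_coord M c X (transition d c y)))"
    by (intro smooth_on_compose[where f = "transition d c" and
          g = "\<lambda>x. frechet_derivative (transition c d) (at x) (vf_coord M c X x)"])
      (use c d open_image[OF S d] in \<open>auto intro: smooth_on_subset[OF transition_smooth[OF d c(1)]]\<close>)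
  then show "smooth_on (snd d ` (fst d \<inter> S)) (vf_coord M d X)"
    by (rule smooth_on_cong[OF open_image[OF S d]])
      (use c d in \<open>auto simp: subset_iff tcoord_change[of c d]\<close>)
qed

lemma smooth_fun_chartI:
  assumes S: "openin (mfd_topology M) S" and c: "c \<in> atlas M" "S \<subseteq> fst c"
    and f: "smooth_on (snd c ` S) (f \<circ> chart_inv c)"
  shows "smooth_fun M S f"
  unfolding smooth_fun_def
proof (intro conjI ballI S)
  fix d assume d: "d \<in> atlas M"
  have "smooth_on (snd d ` (fst d \<inter> S)) (\<lambda>y. (f \<circ> chart_inv c) (transition d c y))"
    by (rule smooth_on_compose[OF _ _ _ f])
      (use c d open_image[OF S d] in \<open>auto intro: smooth_on_subset[OF transition_smooth[OF d c(1)]]\<close>)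
  then show "smooth_on (snd d ` (fst d \<inter> S)) (f \<circ> chart_inv d)"
    by (rule smooth_on_cong[OF open_image[OF S d]]) (use c d in \<open>auto simp: subset_iff\<close>)
qed

lemma smooth_vf_add:
  assumes "smooth_vf M S X" "smooth_vf M S Y"
  shows "smooth_vf M S (\<lambda>q. X q + Y q)"
  unfolding smooth_vf_def
proof (intro conjI ballI)
  fix c assume c: "c \<in> atlas M"
  note o = open_image[OF smooth_vf_openin[OF assms(1)] c]
  show "smooth_on (snd c ` (fst c \<inter> S)) (vf_coord M c (\<lambda>q. X q + Y q))"
    by (rule smooth_on_cong[OF o smooth_on_add[OF o smooth_vf_coord[OF assms(1) c] smooth_vf_coord[OF assms(2) c]]])
      (use c linear_add[OF tcoord_linear[OF c]] in auto)
qed (use assms smooth_vf_openin in auto)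

lemma smooth_vf_scaleR:
  assumes "smooth_fun M S f" "smooth_vf M S X"
  shows "smooth_vf M S (\<lambda>q. f q *\<^sub>R X q)"
  unfolding smooth_vf_def
proof (intro conjI ballI)
  fix c assume c: "c \<in> atlas M"
  note o = open_image[OF smooth_vf_openin[OF assms(2)] c]
  show "smooth_on (snd c ` (fst c \<inter> S)) (vf_coord M c (\<lambda>q. f q *\<^sub>R X q))"
    by (rule smooth_on_cong[OF o smooth_on_scaleR[OF o smooth_fun_coord[OF assms(1) c] smooth_vf_coord[OF assms(2) c]]])
      (use c linear_cmul[OF tcoord_linear[OF c]] in auto)
qed (use assms smooth_vf_openin in auto)

lemma smooth_fun_const: "openin (mfd_topology M) S \<Longrightarrow> smooth_fun M S (\<lambda>q. r)"
  by (simp add: smooth_fun_def comp_def smooth_on_const)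

lemma smooth_vf_scaleR_const: "smooth_vf M S X \<Longrightarrow> smooth_vf M S (\<lambda>q. r *\<^sub>R X q)"
  by (intro smooth_vf_scaleR smooth_fun_const smooth_vf_openin)

lemma smooth_vf_minus: "smooth_vf M S X \<Longrightarrow> smooth_vf M S (\<lambda>q. - X q)"
  using smooth_vf_scaleR_const[of S X "-1"] by simp

lemma smooth_vf_diff: "smooth_vf M S X \<Longrightarrow> smooth_vf M S Y \<Longrightarrow> smooth_vf M S (\<lambda>q. X q - Y q)"
  using smooth_vf_add[OF _ smooth_vf_minus] by simp

lemma smooth_vf_zero:
  assumes S: "openin (mfd_topology M) S"
  shows "smooth_vf M S (\<lambda>q. 0)"
  unfolding smooth_vf_def
proof (intro conjI ballI S)
  fix c assume c: "c \<in> atlas M"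
  show "smooth_on (snd c ` (fst c \<inter> S)) (vf_coord M c (\<lambda>q. 0))"
    by (rule smooth_on_cong[OF open_image[OF S c] smooth_on_const[of _ 0]])
      (use c linear_0[OF tcoord_linear[OF c]] in auto)
qed

lemma smooth_vf_sum:
  assumes "openin (mfd_topology M) S" "\<And>i. i \<in> I \<Longrightarrow> smooth_vf M S (X i)"
  shows "smooth_vf M S (\<lambda>q. \<Sum>i\<in>I. X i q)"
  using assms(2)
  by (induction I rule: infinite_finite_induct) (auto intro: smooth_vf_zero smooth_vf_add assms(1))

lemma smooth_vf_coord_field:
  assumes c: "c \<in> atlas M"
  shows "smooth_vf M (fst c) (coord_field M c v)"
  by (rule smooth_vf_chartI[OF openin_chart[OF c] c order_refl])
    (rule smooth_on_cong[OF _ smooth_on_const[of _ v]],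
      use c open_image[OF openin_chart[OF c] c] in auto)

lemma smooth_fun_coord_component:
  assumes X: "smooth_vf M S X" and c: "c \<in> atlas M" "S \<subseteq> fst c"
  shows "smooth_fun M S (\<lambda>q. tcoord M c q (X q) \<bullet> b)"
proof (rule smooth_fun_chartI[OF smooth_vf_openin[OF X] c])
  have e: "fst c \<inter> S = S" using c by auto
  have o: "open (snd c ` S)" using open_image[OF smooth_vf_openin[OF X] c(1)] e by simp
  have "smooth_on (snd c ` S) (\<lambda>x. vf_coord M c X x \<bullet> b)"
    using smooth_vf_coord[OF X c(1)] e by (intro smooth_on_inner_left o) simp
  then show "smooth_on (snd c ` S) ((\<lambda>q. tcoord M c q (X q) \<bullet> b) \<circ> chart_inv c)"
    by (rule smooth_on_cong[OF o]) (use c in \<open>auto simp: subset_iff\<close>)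
qed

lemma coord_expansion:
  assumes c: "c \<in> atlas M" "p \<in> fst c"
  shows "v = (\<Sum>b\<in>Basis. (tcoord M c p v \<bullet> b) *\<^sub>R coord_field M c b p)"
  using linear_basis_expansion[OF coord_field_linear[OF c], of "tcoord M c p v"] c by simp

lemma smooth_fun_diff_at:
  assumes "smooth_fun M S f" "c \<in> atlas M" "p \<in> fst c" "p \<in> S"
  shows "(f \<circ> chart_inv c has_derivative frechet_derivative (f \<circ> chart_inv c) (at (snd c p))) (at (snd c p))"
  using smooth_on_has_derivative[OF smooth_fun_coord[OF assms(1,2)]] assms(3,4) by blast

lemma smooth_vf_diff_at:
  assumes "smooth_vf M S X" "c \<in> atlas M" "p \<in> fst c" "p \<in> S"
  shows "(vf_coord M c X has_derivative frechet_derivative (vf_coord M c X) (at (snd c p))) (at (snd c p))"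
  using smooth_on_has_derivative[OF smooth_vf_coord[OF assms(1,2)]] assms(3,4) by blast

section \<open>Directional derivatives and brackets in charts\<close>

text \<open>\<open>dir_deriv\<close> uses the chart chosen at the point, which changes from point to
  point; smoothness in \<open>p\<close> becomes visible only in a fixed chart.\<close>

lemma dir_deriv_chart:
  assumes f: "smooth_fun M S f" and c: "c \<in> atlas M" "p \<in> fst c" "p \<in> S"
  shows "dir_deriv M X f p = frechet_derivative (f \<circ> chart_inv c) (at (snd c p)) (tcoord M c p (X p))"
proof -
  let ?d = "chart_at M p"
  have d: "?d \<in> atlas M" "p \<in> fst ?d" using chart_at chart_subset c by auto
  have dd: "((\<lambda>x. (f \<circ> chart_inv c) (transition ?d c x)) has_derivative
     (\<lambda>v. frechet_derivative (f \<circ> chart_inv c) (at (snd c p))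
        (frechet_derivative (transition ?d c) (at (snd ?d p)) v))) (at (snd ?d p))"
    using smooth_fun_diff_at[OF f c]
    by (intro has_derivative_compose[OF transition_has_derivative[OF d(1) c(1) d(2) c(2)]]) (simp add: d del: comp_apply)
  have "(f \<circ> chart_inv ?d has_derivative
     (\<lambda>v. frechet_derivative (f \<circ> chart_inv c) (at (snd c p))
        (frechet_derivative (transition ?d c) (at (snd ?d p)) v))) (at (snd ?d p))"
    by (rule has_derivative_transform_within_open[OF dd open_image[OF openin_chart[OF c(1)] d(1)]])
      (use c d in auto)
  then show ?thesis
    by (simp add: dir_deriv_def tcoord_transition frechet_derivative_eqI)
qed

lemma smooth_fun_dir_deriv:
  assumes f: "smooth_fun M S f" and X: "smooth_vf M S X"
  shows "smooth_fun M S (dir_deriv M X f)"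
  unfolding smooth_fun_def
proof (intro conjI ballI)
  fix c assume c: "c \<in> atlas M"
  note o = open_image[OF smooth_vf_openin[OF X] c]
  show "smooth_on (snd c ` (fst c \<inter> S)) (dir_deriv M X f \<circ> chart_inv c)"
    by (rule smooth_on_cong[OF o smooth_on_frechet_derivative_field[OF o smooth_fun_coord[OF f c]
            smooth_vf_coord[OF X c]]])
      (use c in \<open>auto simp: dir_deriv_chart[OF f]\<close>)
qed (use f smooth_fun_openin in auto)

lemma dir_deriv_cong:
  assumes "openin (mfd_topology M) S" "p \<in> S" "\<And>q. q \<in> S \<Longrightarrow> f q = h q" "X p = Y p"
  shows "dir_deriv M X f p = dir_deriv M Y h p"
proof -
  have p: "p \<in> points M" using assms(1,2) openin_subset_points by auto
  have "frechet_derivative (f \<circ> chart_inv (chart_at M p)) (at (snd (chart_at M p) p)) =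
      frechet_derivative (h \<circ> chart_inv (chart_at M p)) (at (snd (chart_at M p) p))"
    by (rule frechet_derivative_cong[OF open_image[OF assms(1) chart_at(1)[OF p]]])
      (use assms chart_at[OF p] in auto)
  then show ?thesis using assms(4) by (simp add: dir_deriv_def)
qed

lemma lie_bracket_cong:
  assumes "openin (mfd_topology M) S" "p \<in> S" "\<And>q. q \<in> S \<Longrightarrow> X q = X' q" "\<And>q. q \<in> S \<Longrightarrow> Y q = Y' q"
  shows "lie_bracket M X Y p = lie_bracket M X' Y' p"
proof -
  have p: "p \<in> points M" using assms(1,2) openin_subset_points by auto
  have "frechet_derivative (vf_coord M (chart_at M p) Z) (at (snd (chart_at M p) p)) =
      frechet_derivative (vf_coord M (chart_at M p) Z') (at (snd (chart_at M p) p))"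
    if "\<And>q. q \<in> S \<Longrightarrow> Z q = Z' q" for Z Z'
    by (rule frechet_derivative_cong[OF open_image[OF assms(1) chart_at(1)[OF p]]])
      (use assms that chart_at[OF p] in auto)
  from this[OF assms(3)] this[OF assms(4)] show ?thesis
    using assms chart_at[OF p] by (simp add: lie_bracket_def Let_def)
qed

lemma dir_deriv_const: "dir_deriv M X (\<lambda>q. r) p = 0"
  by (simp add: dir_deriv_def comp_def)

lemma dir_deriv_minus:
  assumes "smooth_fun M S f" "p \<in> S"
  shows "dir_deriv M X (\<lambda>q. - f q) p = - dir_deriv M X f p"
proof -
  have p: "p \<in> points M" using smooth_fun_openin[OF assms(1)] assms(2) openin_subset_points by auto
  note l = smooth_fun_diff_at[OF assms(1) chart_at[OF p] assms(2)]
  show ?thesis using frechet_derivative_eqI[OF has_derivative_minus[OF l]]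
    by (simp add: dir_deriv_def comp_def)
qed

text \<open>The commutator identity rests on the symmetry of second derivatives.\<close>

lemma dir_deriv_lie_bracket:
  assumes f: "smooth_fun M S f" and X: "smooth_vf M S X" and Y: "smooth_vf M S Y" and p: "p \<in> S"
  shows "dir_deriv M (lie_bracket M X Y) f p = dir_deriv M X (dir_deriv M Y f) p - dir_deriv M Y (dir_deriv M X f) p"
proof -
  define c where "c = chart_at M p"
  have pM: "p \<in> points M" using smooth_fun_openin[OF f] p openin_subset_points by auto
  have c: "c \<in> atlas M" "p \<in> fst c" using chart_at pM by (auto simp: c_def)
  define F where "F = f \<circ> chart_inv c"
  define x where "x = snd c p"
  define O' where "O' = snd c ` (fst c \<inter> S)"
  have O: "open O'" "x \<in> O'" using open_image[OF smooth_fun_openin[OF f] c(1)] p c by (auto simp: O'_def x_def)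
  have F: "smooth_on O' F" using smooth_fun_coord[OF f c(1)] by (simp add: F_def O'_def)
  have main: "dir_deriv M X (dir_deriv M Y f) p =
      frechet_derivative F (at x) (frechet_derivative (vf_coord M c Y) (at x) (X p)) +
      frechet_derivative (\<lambda>y. frechet_derivative F (at y) (Y p)) (at x) (X p)"
    if Y: "smooth_vf M S Y" for X Y
  proof -
    have Yc: "smooth_on O' (vf_coord M c Y)" using smooth_vf_coord[OF Y c(1)] by (simp add: O'_def)
    have lin: "linear (frechet_derivative F (at y))" if "y \<in> O'" for y
      using F that smooth_on_differentiable frechet_derivative_linear by blast
    have "dir_deriv M X (dir_deriv M Y f) p =
        frechet_derivative (dir_deriv M Y f \<circ> chart_inv c) (at x) (X p)"
      using dir_deriv_chart[OF smooth_fun_dir_deriv[OF f Y] c p, of X] pM by (simp add: x_def c_def)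
    also have "frechet_derivative (dir_deriv M Y f \<circ> chart_inv c) (at x) =
       frechet_derivative (\<lambda>y. \<Sum>b\<in>Basis. (vf_coord M c Y y \<bullet> b) *\<^sub>R frechet_derivative F (at y) b) (at x)"
      by (rule frechet_derivative_cong[OF O])
        (use c linear_basis_expansion[OF lin] in \<open>auto simp: O'_def dir_deriv_chart[OF f] F_def\<close>)
    also have "\<dots> (X p) = (\<Sum>b\<in>Basis. (vf_coord M c Y x \<bullet> b) *\<^sub>R
        frechet_derivative (\<lambda>y. frechet_derivative F (at y) b) (at x) (X p) +
        frechet_derivative (\<lambda>y. vf_coord M c Y y \<bullet> b) (at x) (X p) *\<^sub>R frechet_derivative F (at x) b)"
      by (rule frechet_derivative_sum_scaleR)
        (use O F Yc smooth_on_frechet_derivative[OF F] smooth_on_inner_left[OF O(1) Yc] smooth_on_differentiable in blast)+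
    \<comment> \<open>Symmetry moves \<open>b\<close> into the outer direction, where linearity is
      that of a Frechet derivative; the first sum can then be collected into a derivative along
      \<open>Y p\<close>.\<close>
    also have "\<dots> = (\<Sum>b\<in>Basis. (Y p \<bullet> b) *\<^sub>R
        frechet_derivative (\<lambda>y. frechet_derivative F (at y) (X p)) (at x) b) +
      (\<Sum>b\<in>Basis. (frechet_derivative (vf_coord M c Y) (at x) (X p) \<bullet> b) *\<^sub>R frechet_derivative F (at x) b)"
    proof -
      have "frechet_derivative (\<lambda>y. vf_coord M c Y y \<bullet> b) (at x) (X p) =
          frechet_derivative (vf_coord M c Y) (at x) (X p) \<bullet> b" for b
        by (rule frechet_derivative_eqI)
          (intro has_derivative_inner_left smooth_on_has_derivative[OF Yc] O)
      then show ?thesis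
        using second_derivative_symmetric[OF O(1) F O(2)] c pM
        by (simp add: sum.distrib x_def c_def)
    qed
    also have "(\<Sum>b\<in>Basis. (Y p \<bullet> b) *\<^sub>R
        frechet_derivative (\<lambda>y. frechet_derivative F (at y) (X p)) (at x) b) =
      frechet_derivative (\<lambda>y. frechet_derivative F (at y) (X p)) (at x) (Y p)"
      by (rule linear_basis_expansion[symmetric])
        (use O smooth_on_differentiable[OF smooth_on_frechet_derivative[OF F]] frechet_derivative_linear in blast)
    also have "\<dots> = frechet_derivative (\<lambda>y. frechet_derivative F (at y) (Y p)) (at x) (X p)"
      by (rule second_derivative_symmetric[OF O(1) F O(2)])
    also have "(\<Sum>b\<in>Basis. (frechet_derivative (vf_coord M c Y) (at x) (X p) \<bullet> b) *\<^sub>R frechet_derivative F (at x) b) =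
        frechet_derivative F (at x) (frechet_derivative (vf_coord M c Y) (at x) (X p))"
      by (rule linear_basis_expansion[OF lin[OF O(2)], symmetric])
    finally show ?thesis by simp
  qed
  have lin: "linear (frechet_derivative F (at x))"
    using F O smooth_on_differentiable frechet_derivative_linear by blast
  have "lie_bracket M X Y p = frechet_derivative (vf_coord M c Y) (at x) (X p) -
      frechet_derivative (vf_coord M c X) (at x) (Y p)"
    using c pM by (simp add: lie_bracket_def Let_def c_def x_def)
  then have "dir_deriv M (lie_bracket M X Y) f p =
      frechet_derivative F (at x) (frechet_derivative (vf_coord M c Y) (at x) (X p)) -
      frechet_derivative F (at x) (frechet_derivative (vf_coord M c X) (at x) (Y p))"
    by (simp add: dir_deriv_def F_def c_def x_def lin[unfolded F_def c_def x_def] linear_diff)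
  then show ?thesis
    using main[OF Y, of X] main[OF X, of Y] second_derivative_symmetric[OF O(1) F O(2), of "X p" "Y p"]
    by simp
qed

end

section \<open>Connections\<close>

locale connection_manifold = atlas_manifold M
  for M :: "('a, 'e::euclidean_space) mfd" +
  fixes nabla :: "('a \<Rightarrow> 'e) \<Rightarrow> ('a \<Rightarrow> 'e) \<Rightarrow> 'a \<Rightarrow> 'e"
  assumes conn: "connection M nabla"
begin

lemma conn_smooth: "smooth_vf M S X \<Longrightarrow> smooth_vf M S Y \<Longrightarrow> smooth_vf M S (nabla X Y)"
  by (fact conn[unfolded connection_def, THEN conjunct1, rule_format])

lemma conn_add_left:
  "smooth_vf M S X \<Longrightarrow> smooth_vf M S X' \<Longrightarrow> smooth_vf M S Y \<Longrightarrow> p \<in> S \<Longrightarrow>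
    nabla (\<lambda>q. X q + X' q) Y p = nabla X Y p + nabla X' Y p"
  by (fact conn[unfolded connection_def, THEN conjunct2, THEN conjunct1, rule_format])

lemma conn_scaleR_left:
  "smooth_fun M S f \<Longrightarrow> smooth_vf M S X \<Longrightarrow> smooth_vf M S Y \<Longrightarrow> p \<in> S \<Longrightarrow>
    nabla (\<lambda>q. f q *\<^sub>R X q) Y p = f p *\<^sub>R nabla X Y p"
  by (fact conn[unfolded connection_def, THEN conjunct2, THEN conjunct2, THEN conjunct1, rule_format])

lemma conn_add_right:
  "smooth_vf M S X \<Longrightarrow> smooth_vf M S Y \<Longrightarrow> smooth_vf M S Y' \<Longrightarrow> p \<in> S \<Longrightarrow>
    nabla X (\<lambda>q. Y q + Y' q) p = nabla X Y p + nabla X Y' p"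
  by (fact conn[unfolded connection_def, THEN conjunct2, THEN conjunct2, THEN conjunct2, THEN conjunct1, rule_format])

lemma conn_scaleR_right:
  "smooth_fun M S f \<Longrightarrow> smooth_vf M S X \<Longrightarrow> smooth_vf M S Y \<Longrightarrow> p \<in> S \<Longrightarrow>
    nabla X (\<lambda>q. f q *\<^sub>R Y q) p = dir_deriv M X f p *\<^sub>R Y p + f p *\<^sub>R nabla X Y p"
  by (fact conn[unfolded connection_def, THEN conjunct2, THEN conjunct2, THEN conjunct2, THEN conjunct2, rule_format])

text \<open>Locality: multiply both fields by the indicator function of \<open>S\<close>.\<close>

lemma conn_cong:
  assumes X: "smooth_vf M S X" and Y: "smooth_vf M S Y" and p: "p \<in> S"
    and XX: "\<And>q. q \<in> S \<Longrightarrow> X q = X' q" and YY: "\<And>q. q \<in> S \<Longrightarrow> Y q = Y' q"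
  shows "nabla X Y p = nabla X' Y' p"
proof -
  define f :: "'a \<Rightarrow> real" where "f = (\<lambda>q. if q \<in> S then 1 else 0)"
  note o = smooth_vf_openin[OF X]
  have f: "smooth_fun M S f" by (rule smooth_fun_cong[OF smooth_fun_const[OF o, of 1]]) (simp add: f_def)
  have df: "dir_deriv M Z f p = 0" for Z
    using dir_deriv_cong[OF o p, of f "\<lambda>q. 1" Z Z] dir_deriv_const by (simp add: f_def)
  have X': "smooth_vf M S X'" and Y': "smooth_vf M S Y'"
    using smooth_vf_cong[OF X XX] smooth_vf_cong[OF Y YY] by auto
  have "(\<lambda>q. f q *\<^sub>R X q) = (\<lambda>q. f q *\<^sub>R X' q)" "(\<lambda>q. f q *\<^sub>R Y q) = (\<lambda>q. f q *\<^sub>R Y' q)"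
    using XX YY by (auto simp: f_def)
  then show ?thesis
    using conn_scaleR_left[OF f X Y p] conn_scaleR_left[OF f X' Y p]
      conn_scaleR_right[OF f X' Y p] conn_scaleR_right[OF f X' Y' p] p
    by (simp add: df) (simp add: f_def)
qed

lemma conn_zero_left:
  assumes "smooth_vf M S Y" "p \<in> S"
  shows "nabla (\<lambda>q. 0) Y p = 0"
  using conn_scaleR_left[OF smooth_fun_const smooth_vf_zero assms(1) assms(2), of 0]
    smooth_vf_openin[OF assms(1)] by simp

lemma conn_zero_right:
  assumes "smooth_vf M S X" "p \<in> S"
  shows "nabla X (\<lambda>q. 0) p = 0"
  using conn_scaleR_right[OF smooth_fun_const assms(1) smooth_vf_zero assms(2), of 0]
    smooth_vf_openin[OF assms(1)] by simp

lemma conn_sum_left: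
  assumes "finite I" "\<And>i. i \<in> I \<Longrightarrow> smooth_vf M S (X i)" "smooth_vf M S Y" "p \<in> S"
  shows "nabla (\<lambda>q. \<Sum>i\<in>I. X i q) Y p = (\<Sum>i\<in>I. nabla (X i) Y p)"
  using assms(1,2)
proof (induction I rule: finite_induct)
  case empty
  then show ?case using conn_zero_left[OF assms(3,4)] by simp
next
  case (insert i I)
  then show ?case
    using conn_add_left[OF _ smooth_vf_sum assms(3,4), of "X i" I X] smooth_vf_openin[OF assms(3)] by simp
qed

lemma conn_sum_right:
  assumes "finite I" "\<And>i. i \<in> I \<Longrightarrow> smooth_vf M S (Y i)" "smooth_vf M S X" "p \<in> S"
  shows "nabla X (\<lambda>q. \<Sum>i\<in>I. Y i q) p = (\<Sum>i\<in>I. nabla X (Y i) p)"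
  using assms(1,2)
proof (induction I rule: finite_induct)
  case empty
  then show ?case using conn_zero_right[OF assms(3,4)] by simp
next
  case (insert i I)
  then show ?case
    using conn_add_right[OF assms(3) _ smooth_vf_sum assms(4), of "Y i" I Y] smooth_vf_openin[OF assms(3)] by simp
qed

lemma conn_minus_right:
  assumes "smooth_vf M S X" "smooth_vf M S Y" "p \<in> S"
  shows "nabla X (\<lambda>q. - Y q) p = - nabla X Y p"
  using conn_scaleR_right[OF smooth_fun_const assms(1,2,3), of "-1"] smooth_vf_openin[OF assms(1)]
    dir_deriv_const by simp

section \<open>Connections in coordinate frames\<close>

lemma smooth_vf_chart_Int:
  "smooth_vf M S X \<Longrightarrow> c \<in> atlas M \<Longrightarrow> smooth_vf M (S \<inter> fst c) X"
  "smooth_vf M S X \<Longrightarrow> c \<in> atlas M \<Longrightarrow> smooth_vf M (S \<inter> fst c) (coord_field M c v)"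
  by (auto intro: smooth_vf_subset[OF _ openin_Int[OF smooth_vf_openin openin_chart]]
      smooth_vf_subset[OF smooth_vf_coord_field openin_Int[OF smooth_vf_openin openin_chart]])

text \<open>The coordinate fields form a frame only on the chart domain, so locality first restricts
  everything to \<open>S \<inter> fst c\<close>.\<close>

lemma conn_expand_left:
  assumes X: "smooth_vf M S X" and Y: "smooth_vf M S Y" and c: "c \<in> atlas M" "p \<in> fst c" and p: "p \<in> S"
  shows "nabla X Y p = (\<Sum>b\<in>Basis. (tcoord M c p (X p) \<bullet> b) *\<^sub>R nabla (coord_field M c b) Y p)"
proof -
  let ?T = "S \<inter> fst c"
  note X' = smooth_vf_chart_Int(1)[OF X c(1)] and Y' = smooth_vf_chart_Int(1)[OF Y c(1)]
  have f: "smooth_fun M ?T (\<lambda>q. tcoord M c q (X q) \<bullet> b)" for b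
    by (rule smooth_fun_coord_component[OF X' c(1)]) auto
  have e: "smooth_vf M ?T (coord_field M c b)" for b by (rule smooth_vf_chart_Int(2)[OF X c(1)])
  have "nabla X Y p = nabla (\<lambda>q. \<Sum>b\<in>Basis. (tcoord M c q (X q) \<bullet> b) *\<^sub>R coord_field M c b q) Y p"
    by (rule conn_cong[OF X' Y']) (use p c coord_expansion in auto)
  also have "\<dots> = (\<Sum>b\<in>Basis. nabla (\<lambda>q. (tcoord M c q (X q) \<bullet> b) *\<^sub>R coord_field M c b q) Y p)"
    using p c by (intro conn_sum_left[OF _ _ Y'] smooth_vf_scaleR[OF f e]) auto
  also have "\<dots> = (\<Sum>b\<in>Basis. (tcoord M c p (X p) \<bullet> b) *\<^sub>R nabla (coord_field M c b) Y p)"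
    using p c by (intro sum.cong conn_scaleR_left[OF f e Y']) auto
  finally show ?thesis .
qed

text \<open>The expansion in a coordinate frame sees \<open>X\<close> only through its components at
  \<open>p\<close>.\<close>

lemma conn_tensorial_left:
  assumes "smooth_vf M S X" "smooth_vf M S X'" "smooth_vf M S Y" "p \<in> S" "X p = X' p"
  shows "nabla X Y p = nabla X' Y p"
proof -
  have p: "p \<in> points M" using assms(1,4) smooth_vf_openin openin_subset_points by blast
  show ?thesis
    using conn_expand_left[OF assms(1,3) chart_at[OF p] assms(4)]
      conn_expand_left[OF assms(2,3) chart_at[OF p] assms(4)] assms(5) by simp
qed

lemma conn_expand_right:
  assumes X: "smooth_vf M S X" and Y: "smooth_vf M S Y" and c: "c \<in> atlas M" "p \<in> fst c" and p: "p \<in> S"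
  shows "nabla X Y p = (\<Sum>b\<in>Basis. dir_deriv M X (\<lambda>q. tcoord M c q (Y q) \<bullet> b) p *\<^sub>R coord_field M c b p +
    (tcoord M c p (Y p) \<bullet> b) *\<^sub>R nabla X (coord_field M c b) p)"
proof -
  let ?T = "S \<inter> fst c"
  note X' = smooth_vf_chart_Int(1)[OF X c(1)] and Y' = smooth_vf_chart_Int(1)[OF Y c(1)]
  have f: "smooth_fun M ?T (\<lambda>q. tcoord M c q (Y q) \<bullet> b)" for b
    by (rule smooth_fun_coord_component[OF Y' c(1)]) auto
  have e: "smooth_vf M ?T (coord_field M c b)" for b by (rule smooth_vf_chart_Int(2)[OF X c(1)])
  have "nabla X Y p = nabla X (\<lambda>q. \<Sum>b\<in>Basis. (tcoord M c q (Y q) \<bullet> b) *\<^sub>R coord_field M c b q) p"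
    by (rule conn_cong[OF X' Y']) (use p c coord_expansion in auto)
  also have "\<dots> = (\<Sum>b\<in>Basis. nabla X (\<lambda>q. (tcoord M c q (Y q) \<bullet> b) *\<^sub>R coord_field M c b q) p)"
    using p c by (intro conn_sum_right[OF _ _ X'] smooth_vf_scaleR[OF f e]) auto
  also have "\<dots> = (\<Sum>b\<in>Basis. dir_deriv M X (\<lambda>q. tcoord M c q (Y q) \<bullet> b) p *\<^sub>R coord_field M c b p +
    (tcoord M c p (Y p) \<bullet> b) *\<^sub>R nabla X (coord_field M c b) p)"
    using p c by (intro sum.cong conn_scaleR_right[OF f X' e]) auto
  finally show ?thesis .
qed

text \<open>The components of \<open>coord_field M c u\<close> are constant, so the derivative terms
  of the Leibniz rule vanish and a term linear in \<open>u\<close> remains.\<close>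

lemma conn_coord_field:
  assumes X: "smooth_vf M S X" and c: "c \<in> atlas M" "p \<in> fst c" and p: "p \<in> S"
  shows "nabla X (coord_field M c u) p = (\<Sum>b\<in>Basis. (u \<bullet> b) *\<^sub>R nabla X (coord_field M c b) p)"
proof -
  let ?T = "S \<inter> fst c"
  note X' = smooth_vf_chart_Int(1)[OF X c(1)]
  note e = smooth_vf_chart_Int(2)[OF X c(1)]
  have pT: "p \<in> ?T" using p c by auto
  note o = smooth_vf_openin[OF X']
  have "dir_deriv M X (\<lambda>q. tcoord M c q (coord_field M c u q) \<bullet> b) p = dir_deriv M X (\<lambda>q. u \<bullet> b) p" for b
    by (rule dir_deriv_cong[OF o pT]) (use c in auto)
  then show ?thesis
    using conn_expand_right[OF X' e c pT, of u] c dir_deriv_const by simp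
qed

lemma conn_coord_field_linear:
  assumes X: "smooth_vf M S X" and c: "c \<in> atlas M" "p \<in> fst c" and p: "p \<in> S"
  shows "linear (\<lambda>u. nabla X (coord_field M c u) p)"
proof -
  have lin: "linear (\<lambda>u. \<Sum>b\<in>Basis. (u \<bullet> b) *\<^sub>R h b)" for h :: "'e \<Rightarrow> 'e"
    by (intro linearI) (simp_all add: inner_add_left scaleR_add_left sum.distrib scaleR_right.sum)
  have "(\<lambda>u. nabla X (coord_field M c u) p) = (\<lambda>u. \<Sum>b\<in>Basis. (u \<bullet> b) *\<^sub>R nabla X (coord_field M c b) p)"
    by (rule ext) (rule conn_coord_field[OF assms])
  then show ?thesis by (rule ssubst) (rule lin)
qed

text \<open>The classical local formula: the derivative of the components plus a Christoffel term.
  The latter is encoded as the covariant derivative of the field whose components are frozen at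
  their value at \<open>p\<close>.\<close>

lemma conn_coord:
  assumes X: "smooth_vf M S X" and Y: "smooth_vf M S Y" and c: "c \<in> atlas M" "p \<in> fst c" and p: "p \<in> S"
  shows "tcoord M c p (nabla X Y p) = frechet_derivative (vf_coord M c Y) (at (snd c p)) (tcoord M c p (X p)) +
    tcoord M c p (nabla X (coord_field M c (tcoord M c p (Y p))) p)"
proof -
  let ?T = "S \<inter> fst c"
  note X' = smooth_vf_chart_Int(1)[OF X c(1)] and Y' = smooth_vf_chart_Int(1)[OF Y c(1)]
  have pT: "p \<in> ?T" using p c by auto
  have f: "smooth_fun M ?T (\<lambda>q. tcoord M c q (Y q) \<bullet> b)" for b
    by (rule smooth_fun_coord_component[OF Y' c(1)]) auto
  have d: "dir_deriv M X (\<lambda>q. tcoord M c q (Y q) \<bullet> b) p =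
      frechet_derivative (vf_coord M c Y) (at (snd c p)) (tcoord M c p (X p)) \<bullet> b" for b
  proof -
    have "dir_deriv M X (\<lambda>q. tcoord M c q (Y q) \<bullet> b) p =
        frechet_derivative ((\<lambda>q. tcoord M c q (Y q) \<bullet> b) \<circ> chart_inv c) (at (snd c p)) (tcoord M c p (X p))"
      by (rule dir_deriv_chart[OF f c pT])
    also have "(\<lambda>q. tcoord M c q (Y q) \<bullet> b) \<circ> chart_inv c = (\<lambda>x. vf_coord M c Y x \<bullet> b)"
      by (auto simp: vf_coord_def)
    also have "frechet_derivative \<dots> (at (snd c p)) (tcoord M c p (X p)) =
        frechet_derivative (vf_coord M c Y) (at (snd c p)) (tcoord M c p (X p)) \<bullet> b"
      by (rule frechet_derivative_eqI) (intro has_derivative_inner_left smooth_vf_diff_at[OF Y c p])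
    finally show ?thesis .
  qed
  have "nabla X Y p = coord_field M c (frechet_derivative (vf_coord M c Y) (at (snd c p)) (tcoord M c p (X p))) p +
      nabla X (coord_field M c (tcoord M c p (Y p))) p"
    unfolding conn_expand_right[OF X Y c p] d sum.distrib conn_coord_field[OF X c p, symmetric]
      linear_basis_expansion[OF coord_field_linear[OF c], symmetric] ..
  then show ?thesis using c by (simp add: linear_add[OF tcoord_linear[OF c]])
qed

lemma conn_at:
  assumes X: "smooth_vf M S X" and Y: "smooth_vf M S Y" and p: "p \<in> S"
  shows "nabla X Y p = frechet_derivative (vf_coord M (chart_at M p) Y) (at (snd (chart_at M p) p)) (X p) +
    nabla X (coord_field M (chart_at M p) (Y p)) p"
proof -
  have "p \<in> points M" using X p smooth_vf_openin openin_subset_points by blast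
  then show ?thesis using conn_coord[OF X Y chart_at p] by simp
qed

lemma smooth_vf_lie_bracket:
  assumes "torsion_free M nabla" "smooth_vf M S X" "smooth_vf M S Y"
  shows "smooth_vf M S (lie_bracket M X Y)"
  by (rule smooth_vf_cong[OF smooth_vf_diff[OF conn_smooth[OF assms(2,3)] conn_smooth[OF assms(3,2)]]])
    (use assms in \<open>auto simp: torsion_free_def\<close>)

section \<open>Tensoriality of the curvature in its last argument\<close>

text \<open>Smoothness of the bracket is assumed separately because
  \<open>smooth_vf_lie_bracket\<close> derives it from a torsion-free connection, while the
  tensoriality of the curvature is wanted for the Bismut connection, which may have torsion.\<close>

lemma curvature_cong:
  assumes X: "smooth_vf M S X" and Y: "smooth_vf M S Y" and Z: "smooth_vf M S Z"
    and L: "smooth_vf M S (lie_bracket M X Y)" and p: "p \<in> S"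
    and e: "\<And>q. q \<in> S \<Longrightarrow> X q = X' q" "\<And>q. q \<in> S \<Longrightarrow> Y q = Y' q" "\<And>q. q \<in> S \<Longrightarrow> Z q = Z' q"
  shows "curvature M nabla X Y Z p = curvature M nabla X' Y' Z' p"
proof -
  note o = smooth_vf_openin[OF X]
  have "nabla (lie_bracket M X Y) Z p = nabla (lie_bracket M X' Y') Z' p"
    by (rule conn_cong[OF L Z p]) (use e in \<open>auto intro!: lie_bracket_cong[OF o]\<close>)
  moreover have "nabla X (nabla Y Z) p = nabla X' (nabla Y' Z') p"
    by (rule conn_cong[OF X conn_smooth[OF Y Z] p]) (use e in \<open>auto intro!: conn_cong[OF Y Z]\<close>)
  moreover have "nabla Y (nabla X Z) p = nabla Y' (nabla X' Z') p"
    by (rule conn_cong[OF Y conn_smooth[OF X Z] p]) (use e in \<open>auto intro!: conn_cong[OF X Z]\<close>)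
  ultimately show ?thesis by (simp add: curvature_def)
qed

text \<open>The commutator of second derivatives of \<open>f\<close> is matched by the bracket term,
  and the products of first derivatives cancel when the two orders are subtracted.\<close>

lemma curvature_scaleR:
  assumes f: "smooth_fun M S f" and X: "smooth_vf M S X" and Y: "smooth_vf M S Y" and Z: "smooth_vf M S Z"
    and L: "smooth_vf M S (lie_bracket M X Y)" and p: "p \<in> S"
  shows "curvature M nabla X Y (\<lambda>q. f q *\<^sub>R Z q) p = f p *\<^sub>R curvature M nabla X Y Z p"
proof -
  have second: "nabla X (nabla Y (\<lambda>q. f q *\<^sub>R Z q)) p =
      dir_deriv M X (dir_deriv M Y f) p *\<^sub>R Z p + dir_deriv M Y f p *\<^sub>R nabla X Z p +
      (dir_deriv M X f p *\<^sub>R nabla Y Z p + f p *\<^sub>R nabla X (nabla Y Z) p)"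
    if X: "smooth_vf M S X" and Y: "smooth_vf M S Y" for X Y
  proof -
    note df = smooth_fun_dir_deriv[OF f Y] and YZ = conn_smooth[OF Y Z]
    have "nabla X (nabla Y (\<lambda>q. f q *\<^sub>R Z q)) p =
        nabla X (\<lambda>q. dir_deriv M Y f q *\<^sub>R Z q + f q *\<^sub>R nabla Y Z q) p"
      by (rule conn_cong[OF X conn_smooth[OF Y smooth_vf_scaleR[OF f Z]] p])
        (use conn_scaleR_right[OF f Y Z] in auto)
    also have "\<dots> = nabla X (\<lambda>q. dir_deriv M Y f q *\<^sub>R Z q) p + nabla X (\<lambda>q. f q *\<^sub>R nabla Y Z q) p"
      by (rule conn_add_right[OF X smooth_vf_scaleR[OF df Z] smooth_vf_scaleR[OF f YZ] p])
    finally show ?thesis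
      using conn_scaleR_right[OF df X Z p] conn_scaleR_right[OF f X YZ p] by simp
  qed
  show ?thesis
    unfolding curvature_def second[OF X Y] second[OF Y X] conn_scaleR_right[OF f L Z p]
      dir_deriv_lie_bracket[OF f X Y p]
    by (simp add: algebra_simps)
qed

lemma curvature_add:
  assumes X: "smooth_vf M S X" and Y: "smooth_vf M S Y" and Z: "smooth_vf M S Z" and Z': "smooth_vf M S Z'"
    and L: "smooth_vf M S (lie_bracket M X Y)" and p: "p \<in> S"
  shows "curvature M nabla X Y (\<lambda>q. Z q + Z' q) p = curvature M nabla X Y Z p + curvature M nabla X Y Z' p"
proof -
  have second: "nabla X (nabla Y (\<lambda>q. Z q + Z' q)) p = nabla X (nabla Y Z) p + nabla X (nabla Y Z') p"
    if X: "smooth_vf M S X" and Y: "smooth_vf M S Y" for X Y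
  proof -
    have "nabla X (nabla Y (\<lambda>q. Z q + Z' q)) p = nabla X (\<lambda>q. nabla Y Z q + nabla Y Z' q) p"
      by (rule conn_cong[OF X conn_smooth[OF Y smooth_vf_add[OF Z Z']] p])
        (use conn_add_right[OF Y Z Z'] in auto)
    then show ?thesis using conn_add_right[OF X conn_smooth[OF Y Z] conn_smooth[OF Y Z'] p] by simp
  qed
  show ?thesis
    unfolding curvature_def second[OF X Y] second[OF Y X] conn_add_right[OF L Z Z' p] by simp
qed

lemma curvature_expand:
  assumes X: "smooth_vf M S X" and Y: "smooth_vf M S Y" and Z: "smooth_vf M S Z"
    and L: "smooth_vf M S (lie_bracket M X Y)" and c: "c \<in> atlas M" "p \<in> fst c" and p: "p \<in> S"
  shows "curvature M nabla X Y Z p =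
    (\<Sum>b\<in>Basis. (tcoord M c p (Z p) \<bullet> b) *\<^sub>R curvature M nabla X Y (coord_field M c b) p)"
proof -
  let ?T = "S \<inter> fst c"
  note X' = smooth_vf_chart_Int(1)[OF X c(1)] and Y' = smooth_vf_chart_Int(1)[OF Y c(1)]
    and Z' = smooth_vf_chart_Int(1)[OF Z c(1)] and L' = smooth_vf_chart_Int(1)[OF L c(1)]
  have pT: "p \<in> ?T" using p c by auto
  note o = smooth_vf_openin[OF X']
  have f: "smooth_fun M ?T (\<lambda>q. tcoord M c q (Z q) \<bullet> b)" for b
    by (rule smooth_fun_coord_component[OF Z' c(1)]) auto
  have e: "smooth_vf M ?T (coord_field M c b)" for b by (rule smooth_vf_chart_Int(2)[OF X c(1)])
  note fe = smooth_vf_scaleR[OF f e]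
  have sum: "curvature M nabla X Y (\<lambda>q. \<Sum>b\<in>I. (tcoord M c q (Z q) \<bullet> b) *\<^sub>R coord_field M c b q) p =
     (\<Sum>b\<in>I. curvature M nabla X Y (\<lambda>q. (tcoord M c q (Z q) \<bullet> b) *\<^sub>R coord_field M c b q) p)"
    if "finite I" for I
    using that
  proof (induction I rule: finite_induct)
    case empty
    then show ?case
      using curvature_scaleR[OF smooth_fun_const[OF o, of 0] X' Y' Z' L' pT] by simp
  next
    case (insert i I)
    have "smooth_vf M ?T (\<lambda>q. \<Sum>b\<in>I. (tcoord M c q (Z q) \<bullet> b) *\<^sub>R coord_field M c b q)"
      by (intro smooth_vf_sum o fe)
    from curvature_add[OF X' Y' fe this L' pT] show ?case using insert by simp
  qed
  have "curvature M nabla X Y Z p =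
      curvature M nabla X Y (\<lambda>q. \<Sum>b\<in>Basis. (tcoord M c q (Z q) \<bullet> b) *\<^sub>R coord_field M c b q) p"
    by (rule curvature_cong[OF X' Y' Z' L' pT]) (use c coord_expansion in auto)
  also have "\<dots> = (\<Sum>b\<in>Basis. (tcoord M c p (Z p) \<bullet> b) *\<^sub>R curvature M nabla X Y (coord_field M c b) p)"
    unfolding sum[OF finite_Basis] using curvature_scaleR[OF f X' Y' e L' pT] by simp
  finally show ?thesis .
qed

end

section \<open>The tangent bundle and the lifts in coordinates\<close>

lemma tangent_chart_simps [simp]:
  "fst (tangent_chart M c) = fst c \<times> UNIV"
  "snd (tangent_chart M c) (p, u) = (snd c p, tcoord M c p u)"
  by (simp_all add: tangent_chart_def)

lemma tangent_bundle_simps [simp]: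
  "points (tangent_bundle M) = points M \<times> UNIV"
  "atlas (tangent_bundle M) = tangent_chart M ` atlas M"
  "chart_at (tangent_bundle M) (p, u) = tangent_chart M (chart_at M p)"
  by (simp_all add: tangent_bundle_def)

lemma smooth_on_fst: "open S \<Longrightarrow> smooth_on S f \<Longrightarrow> smooth_on (S \<times> UNIV) (\<lambda>z. f (fst z))"
  for f :: "'e::euclidean_space \<Rightarrow> 'f::real_normed_vector"
  by (rule smooth_on_compose[where f = fst and T = S])
    (auto intro!: smooth_on_bounded_linear[OF _ bounded_linear_fst smooth_on_ident] open_Times)

text \<open>Linearity in the second variable reduces joint smoothness to finitely many functions of
  the first. In this way Jacobians of transition maps and Christoffel terms become smooth on the
  tangent bundle.\<close>

lemma smooth_on_linear_family:
  fixes h :: "'e::euclidean_space \<Rightarrow> 'g::euclidean_space \<Rightarrow> 'f::real_normed_vector"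
  assumes S: "open S" and h: "\<And>b. smooth_on S (\<lambda>x. h x b)" and lin: "\<And>x. x \<in> S \<Longrightarrow> linear (h x)"
  shows "smooth_on (S \<times> UNIV) (\<lambda>z. h (fst z) (snd z))"
proof -
  have o: "open (S \<times> (UNIV :: 'g set))" using S by (simp add: open_Times)
  have "smooth_on (S \<times> UNIV) (\<lambda>z. \<Sum>b\<in>Basis. (snd z \<bullet> b) *\<^sub>R h (fst z) b)"
    by (intro smooth_on_sum smooth_on_scaleR smooth_on_inner_left o smooth_on_fst[OF S h]
        smooth_on_bounded_linear[OF o bounded_linear_snd smooth_on_ident[OF o]])
  then show ?thesis
    by (rule smooth_on_cong[OF o]) (use linear_basis_expansion[OF lin] in \<open>auto simp: mem_Times_iff\<close>)
qed

context atlas_manifold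
begin

section \<open>The atlas of the tangent bundle\<close>

lemma tangent_chart_image:
  assumes "c \<in> atlas M"
  shows "snd (tangent_chart M c) ` ((fst c \<inter> S) \<times> UNIV) = (snd c ` (fst c \<inter> S)) \<times> UNIV"
proof -
  have "(snd c p, u) \<in> snd (tangent_chart M c) ` ((fst c \<inter> S) \<times> UNIV)" if "p \<in> fst c" "p \<in> S" for p u
    by (rule image_eqI[of _ _ "(p, coord_field M c u p)"]) (use assms that in auto)
  then show ?thesis by auto
qed

lemma tangent_chart_inj: "c \<in> atlas M \<Longrightarrow> inj_on (snd (tangent_chart M c)) (fst c \<times> UNIV)"
  by (rule inj_onI) (auto dest: inj_onD[OF chart_inj], metis coord_field_tcoord inj_onD[OF chart_inj])

lemma tangent_chart_inv:
  assumes "c \<in> atlas M" "p \<in> fst c"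
  shows "chart_inv (tangent_chart M c) (snd c p, u) = (p, coord_field M c u p)"
proof -
  have "chart_inv (tangent_chart M c) (snd (tangent_chart M c) (p, coord_field M c u p)) = (p, coord_field M c u p)"
    unfolding chart_inv_def using tangent_chart_inj[OF assms(1)] assms(2) by (intro inv_into_f_f) auto
  then show ?thesis using assms by simp
qed

lemma tangent_transition:
  assumes "c \<in> atlas M" "d \<in> atlas M" "p \<in> fst c" "p \<in> fst d"
  shows "transition (tangent_chart M c) (tangent_chart M d) (snd c p, u) =
    (transition c d (snd c p), frechet_derivative (transition c d) (at (snd c p)) u)"
  using assms by (simp add: transition_def[of "tangent_chart M c"] tangent_chart_inv tcoord_change[of c d])

lemma tangent_transition_smooth:
  assumes c: "c \<in> atlas M" and d: "d \<in> atlas M"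
  shows "smooth_on (snd c ` (fst c \<inter> fst d) \<times> UNIV) (transition (tangent_chart M c) (tangent_chart M d))"
proof -
  let ?O = "snd c ` (fst c \<inter> fst d)"
  have o: "open ?O" by (rule open_image[OF openin_chart[OF d] c])
  have oT: "open (?O \<times> (UNIV :: 'e set))" using o by (simp add: open_Times)
  have "smooth_on (?O \<times> UNIV) (\<lambda>z. (transition c d (fst z),
      frechet_derivative (transition c d) (at (fst z)) (snd z)))"
    using transition_derivative_linear[OF c d]
    by (intro smooth_on_Pair oT smooth_on_fst o transition_smooth c d
        smooth_on_linear_family smooth_on_frechet_derivative) auto
  then show ?thesis
    by (rule smooth_on_cong[OF oT]) (use tangent_transition[OF c d] in auto)
qed

lemma smooth_atlas_tangent_bundle: "smooth_atlas (tangent_bundle M)"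
proof -
  have img: "open (snd (tangent_chart M c) ` (fst c \<times> UNIV))" if "c \<in> atlas M" for c
    using tangent_chart_image[OF that, of "fst c"] open_image[OF openin_chart[OF that] that]
    by (simp add: open_Times)
  have img2: "snd (tangent_chart M c) ` (fst c \<times> UNIV \<inter> fst d \<times> UNIV) = snd c ` (fst c \<inter> fst d) \<times> UNIV"
    if "c \<in> atlas M" for c d
    using tangent_chart_image[OF that, of "fst d"] by (simp add: Times_Int_Times)
  show ?thesis
    unfolding smooth_atlas_def
  proof (intro conjI ballI)
    fix tc assume "tc \<in> atlas (tangent_bundle M)"
    then obtain c where c: "c \<in> atlas M" "tc = tangent_chart M c" by auto
    show "fst tc \<subseteq> points (tangent_bundle M)" using c chart_subset[OF c(1)] by auto
    show "inj_on (snd tc) (fst tc)" using tangent_chart_inj[OF c(1)] c(2) by simp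
    show "open (snd tc ` fst tc)" using img[OF c(1)] c(2) by simp
    fix td assume "td \<in> atlas (tangent_bundle M)"
    then obtain d where d: "d \<in> atlas M" "td = tangent_chart M d" by auto
    have e: "snd tc ` (fst tc \<inter> fst td) = snd c ` (fst c \<inter> fst d) \<times> UNIV"
      using img2[OF c(1), of d] c(2) d(2) by simp
    show "open (snd tc ` (fst tc \<inter> fst td))"
      unfolding e using open_image[OF openin_chart[OF d(1)] c(1)] by (simp add: open_Times)
    show "smooth_on (snd tc ` (fst tc \<inter> fst td)) (snd td \<circ> chart_inv tc)"
      unfolding e using tangent_transition_smooth[OF c(1) d(1)] c(2) d(2) by (simp add: transition_def)
  next
    fix q assume "q \<in> points (tangent_bundle M)"
    then obtain p u where q: "q = (p, u)" "p \<in> points M" by auto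
    show "chart_at (tangent_bundle M) q \<in> atlas (tangent_bundle M)" using q chart_at by auto
    show "q \<in> fst (chart_at (tangent_bundle M) q)" using q chart_at by auto
  qed
qed

lemma openin_tangent_bundle:
  assumes "openin (mfd_topology M) S"
  shows "openin (mfd_topology (tangent_bundle M)) (S \<times> UNIV)"
proof -
  have "snd (tangent_chart M c) ` (fst c \<times> UNIV \<inter> S \<times> UNIV) = snd c ` (fst c \<inter> S) \<times> UNIV"
    if "c \<in> atlas M" for c
    using tangent_chart_image[OF that, of S] by (simp add: Times_Int_Times)
  then show ?thesis
    using assms open_image[OF assms] openin_subset_points[OF assms]
    by (auto simp: openin_mfd_topology[OF smooth_atlas_tangent_bundle] mfd_open_def open_Times)
qed

section \<open>Tangent vectors of the bundle in its charts\<close>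

text \<open>Bundle transitions are linear along each fibre, so their derivative along a line in the
  fibre can be computed directly and compared with the chain rule.\<close>

lemma tcoord_vertical:
  assumes c: "c \<in> atlas M" "p \<in> fst c"
  shows "tcoord (tangent_bundle M) (tangent_chart M c) (p, u) (0, b) = (0, tcoord M c p b)"
proof -
  interpret T: atlas_manifold "tangent_bundle M" by unfold_locales (rule smooth_atlas_tangent_bundle)
  let ?d = "chart_at M p"
  have d: "?d \<in> atlas M" "p \<in> fst ?d" using chart_at chart_subset c by auto
  let ?F = "transition (tangent_chart M ?d) (tangent_chart M c)" and ?z = "(snd ?d p, tcoord M ?d p u)"
  have D: "(?F has_derivative frechet_derivative ?F (at ?z)) (at ?z)"
    using T.transition_has_derivative[of "tangent_chart M ?d" "tangent_chart M c" "(p, u)"] c d by simp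
  have 1: "((\<lambda>t::real. (snd ?d p, tcoord M ?d p u + t *\<^sub>R b)) has_derivative (\<lambda>t. (0, t *\<^sub>R b))) (at 0)"
    by (auto intro!: derivative_eq_intros)
  have "((\<lambda>t::real. ?F (snd ?d p, tcoord M ?d p u + t *\<^sub>R b)) has_derivative
      (\<lambda>t. frechet_derivative ?F (at ?z) (0, t *\<^sub>R b))) (at 0)"
    by (rule has_derivative_compose[OF 1]) (use D in simp)
  moreover have "((\<lambda>t::real. ?F (snd ?d p, tcoord M ?d p u + t *\<^sub>R b)) has_derivative
      (\<lambda>t. (0, t *\<^sub>R tcoord M c p b))) (at 0)"
    unfolding tangent_transition[OF d(1) c(1) d(2) c(2)]
      linear_add[OF transition_derivative_linear[OF d(1) c(1) d(2) c(2)]]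
      linear_cmul[OF transition_derivative_linear[OF d(1) c(1) d(2) c(2)]] tcoord_transition[of M c]
    by (auto intro!: derivative_eq_intros)
  ultimately have "(\<lambda>t::real. frechet_derivative ?F (at ?z) (0, t *\<^sub>R b)) = (\<lambda>t. (0, t *\<^sub>R tcoord M c p b))"
    by (rule has_derivative_unique)
  from fun_cong[OF this, of 1] show ?thesis
    by (simp add: tcoord_transition[of "tangent_bundle M"])
qed

text \<open>The bundle transition carries the graph of a section in one chart to its graph in the
  other; both descriptions are differentiated and compared. Working with sections keeps the second
  derivatives of the transition maps out of sight.\<close>

lemma tcoord_section:
  assumes s: "smooth_vf M S s" and p: "p \<in> S" and c: "c \<in> atlas M" "p \<in> fst c"
  shows "tcoord (tangent_bundle M) (tangent_chart M c) (p, s p)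
      (a, frechet_derivative (vf_coord M (chart_at M p) s) (at (snd (chart_at M p) p)) a) =
    (tcoord M c p a, frechet_derivative (vf_coord M c s) (at (snd c p)) (tcoord M c p a))"
proof -
  interpret T: atlas_manifold "tangent_bundle M" by unfold_locales (rule smooth_atlas_tangent_bundle)
  let ?d = "chart_at M p"
  have pM: "p \<in> points M" using chart_subset c by auto
  have d: "?d \<in> atlas M" "p \<in> fst ?d" using chart_at pM by auto
  let ?F = "transition (tangent_chart M ?d) (tangent_chart M c)" and ?z = "(snd ?d p, tcoord M ?d p (s p))"
  let ?h = "\<lambda>x. (x, vf_coord M ?d s x)"
  have D: "(?F has_derivative frechet_derivative ?F (at ?z)) (at ?z)"
    using T.transition_has_derivative[of "tangent_chart M ?d" "tangent_chart M c" "(p, s p)"] c d by simp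
  have h: "(?h has_derivative (\<lambda>a. (a, frechet_derivative (vf_coord M ?d s) (at (snd ?d p)) a))) (at (snd ?d p))"
    by (intro has_derivative_Pair has_derivative_ident smooth_vf_diff_at[OF s d p])
  have 1: "((\<lambda>x. ?F (?h x)) has_derivative
      (\<lambda>a. frechet_derivative ?F (at ?z) (a, frechet_derivative (vf_coord M ?d s) (at (snd ?d p)) a))) (at (snd ?d p))"
    by (rule has_derivative_compose[OF h]) (use D d in simp)
  let ?k = "\<lambda>y. (y, vf_coord M c s y)"
  have k: "(?k has_derivative (\<lambda>a. (a, frechet_derivative (vf_coord M c s) (at (snd c p)) a))) (at (snd c p))"
    by (intro has_derivative_Pair has_derivative_ident smooth_vf_diff_at[OF s c p])
  have "((\<lambda>x. ?k (transition ?d c x)) has_derivative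
      (\<lambda>a. (tcoord M c p a, frechet_derivative (vf_coord M c s) (at (snd c p)) (tcoord M c p a)))) (at (snd ?d p))"
    unfolding tcoord_transition[of M c]
    by (rule has_derivative_compose[OF transition_has_derivative[OF d(1) c(1) d(2) c(2)]]) (use k d in simp)
  then have "((\<lambda>x. ?F (?h x)) has_derivative
      (\<lambda>a. (tcoord M c p a, frechet_derivative (vf_coord M c s) (at (snd c p)) (tcoord M c p a)))) (at (snd ?d p))"
    by (rule has_derivative_transform_within_open[OF _ open_image[OF openin_chart[OF c(1)] d(1)]])
      (use c d in \<open>auto simp: tangent_transition tcoord_change[of ?d c]\<close>)
  from fun_cong[OF has_derivative_unique[OF 1 this], of a] show ?thesis
    using pM by (simp add: tcoord_transition[of "tangent_bundle M"])
qed

lemma differential_section: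
  assumes s: "smooth_vf M S s" and p: "p \<in> S"
  shows "differential M (tangent_bundle M) (\<lambda>y. (y, s y)) p a =
    (a, frechet_derivative (vf_coord M (chart_at M p) s) (at (snd (chart_at M p) p)) a)"
proof -
  let ?d = "chart_at M p"
  have pM: "p \<in> points M" using s p smooth_vf_openin openin_subset_points by blast
  note d = chart_at[OF pM]
  let ?h = "\<lambda>x. (x, vf_coord M ?d s x)"
  have h: "(?h has_derivative (\<lambda>a. (a, frechet_derivative (vf_coord M ?d s) (at (snd ?d p)) a))) (at (snd ?d p))"
    by (intro has_derivative_Pair has_derivative_ident smooth_vf_diff_at[OF s d p])
  have "(snd (tangent_chart M ?d) \<circ> (\<lambda>y. (y, s y)) \<circ> chart_inv ?d has_derivative
      (\<lambda>a. (a, frechet_derivative (vf_coord M ?d s) (at (snd ?d p)) a))) (at (snd ?d p))"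
    by (rule has_derivative_transform_within_open[OF h open_image[OF openin_chart[OF d(1)] d(1)]])
      (use d in auto)
  from frechet_derivative_eqI[OF this] show ?thesis by (simp add: differential_def)
qed

lemma vlift_at: "p \<in> points M \<Longrightarrow> vlift M X (p, u) = (0, X p)"
proof -
  assume p: "p \<in> points M"
  have "((\<lambda>t::real. (snd (chart_at M p) p, u + t *\<^sub>R X p)) has_vector_derivative (0, X p)) (at 0)"
    by (auto intro!: derivative_eq_intros simp: has_vector_derivative_def)
  then show ?thesis using p by (simp add: vlift_def vector_derivative_at)
qed

lemma smooth_vf_vlift:
  assumes X: "smooth_vf M S X"
  shows "smooth_vf (tangent_bundle M) (S \<times> UNIV) (vlift M X)"
proof -
  note o = smooth_vf_openin[OF X]
  show ?thesis
    unfolding smooth_vf_def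
  proof (intro conjI ballI openin_tangent_bundle o)
    fix tc assume "tc \<in> atlas (tangent_bundle M)"
    then obtain c where c: "c \<in> atlas M" "tc = tangent_chart M c" by auto
    have e: "snd tc ` (fst tc \<inter> S \<times> UNIV) = snd c ` (fst c \<inter> S) \<times> UNIV"
      using tangent_chart_image[OF c(1), of S] c(2) by (simp add: Times_Int_Times)
    have oc: "open (snd c ` (fst c \<inter> S))" by (rule open_image[OF o c(1)])
    have "smooth_on (snd c ` (fst c \<inter> S) \<times> UNIV) (\<lambda>z. (0 :: 'e, vf_coord M c X (fst z)))"
      using oc by (intro smooth_on_Pair smooth_on_const smooth_on_fst smooth_vf_coord[OF X c(1)])
        (simp_all add: open_Times)
    then show "smooth_on (snd tc ` (fst tc \<inter> S \<times> UNIV)) (vf_coord (tangent_bundle M) tc (vlift M X))"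
      unfolding e
      by (rule smooth_on_cong[rotated])
        (use oc c chart_subset[OF c(1)] in \<open>auto simp: open_Times vf_coord_def tangent_chart_inv vlift_at tcoord_vertical\<close>)
  qed
qed

end

section \<open>Horizontal lifts through parallel sections\<close>

context connection_manifold
begin

text \<open>
  In the chart \<open>c\<close> around \<open>p\<close>, the section is \<open>u + f k\<close> with \<open>f\<close> linear, \<open>df(X) = 1\<close> and
  \<open>k = -\<nabla>\<^sub>X u\<close>; if \<open>X p = 0\<close>, then \<open>f = 0\<close> by the convention on division by zero.
\<close>

lemma parallel_section_exists:
  assumes X: "smooth_vf M S X" and p: "p \<in> S"
  obtains s where "smooth_vf M (S \<inter> fst (chart_at M p)) s" "s p = u" "nabla X s p = 0"
proof -
  define c where "c = chart_at M p"
  have pM: "p \<in> points M" using X p smooth_vf_openin openin_subset_points by blast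
  have c: "c \<in> atlas M" "p \<in> fst c" using chart_at[OF pM] by (auto simp: c_def)
  let ?T = "S \<inter> fst c"
  have pT: "p \<in> ?T" using p c by auto
  note X' = smooth_vf_chart_Int(1)[OF X c(1)] and e = smooth_vf_chart_Int(2)[OF X c(1)]
  note o = smooth_vf_openin[OF X']
  have eT: "fst c \<inter> ?T = ?T" by auto
  have oT: "open (snd c ` ?T)" using open_image[OF o c(1)] eT by simp
  define k where "k = - nabla X (coord_field M c u) p"
  define f where "f q = ((snd c q - snd c p) \<bullet> X p) / (X p \<bullet> X p)" for q
  let ?h = "\<lambda>x. (x - snd c p) \<bullet> X p / (X p \<bullet> X p)"
  have h: "smooth_on (snd c ` ?T) ?h"
    unfolding divide_inverse
    by (intro smooth_on_bounded_linear[OF oT bounded_linear_mult_left] smooth_on_inner_left oT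
        smooth_on_diff smooth_on_const smooth_on_ident)
  have f: "smooth_fun M ?T f"
    by (rule smooth_fun_chartI[OF o c(1)])
      (auto intro!: smooth_on_cong[OF oT h] simp: f_def c)
  have "dir_deriv M X f p = frechet_derivative (f \<circ> chart_inv c) (at (snd c p)) (X p)"
    using dir_deriv_chart[OF f c pT, of X] pM by (simp add: c_def)
  also have "frechet_derivative (f \<circ> chart_inv c) (at (snd c p)) = frechet_derivative ?h (at (snd c p))"
    by (rule frechet_derivative_cong[OF oT]) (use pT c in \<open>auto simp: f_def\<close>)
  also have "\<dots> (X p) = X p \<bullet> X p / (X p \<bullet> X p)"
    by (rule frechet_derivative_eqI) (auto intro!: derivative_eq_intros simp: divide_inverse)
  finally have df: "dir_deriv M X f p = (if X p = 0 then 0 else 1)" by simp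
  have k0: "k = 0" if "X p = 0"
    using conn_tensorial_left[OF X' smooth_vf_zero[OF o] e pT] conn_zero_left[OF e pT] that
    by (simp add: k_def)
  define s where "s q = coord_field M c u q + f q *\<^sub>R coord_field M c k q" for q
  have "smooth_vf M ?T s" unfolding s_def by (intro smooth_vf_add smooth_vf_scaleR f e)
  moreover have "s p = u" using pM by (simp add: s_def f_def c_def)
  moreover have "nabla X s p = 0"
  proof -
    have "nabla X s p = nabla X (coord_field M c u) p + nabla X (\<lambda>q. f q *\<^sub>R coord_field M c k q) p"
      unfolding s_def by (intro conn_add_right[OF X' _ _ pT] smooth_vf_scaleR f e)
    also have "nabla X (\<lambda>q. f q *\<^sub>R coord_field M c k q) p = k"
      using conn_scaleR_right[OF f X' e pT, of k] df k0 pM by (simp add: f_def c_def split: if_splits)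
    finally show ?thesis by (simp add: k_def)
  qed
  ultimately show ?thesis using that unfolding c_def by blast
qed

text \<open>Makes the description in \<open>hlift\<close> unambiguous: parallelism in
  \<open>conn_coord\<close> fixes the derivative of the section in direction \<open>X p\<close> by
  the value \<open>s p\<close> alone.\<close>

lemma parallel_section_derivative:
  assumes X: "smooth_vf M S X" and s: "smooth_vf M T s" and p: "p \<in> S" "p \<in> T"
    and par: "nabla X s p = 0" and c: "c \<in> atlas M" "p \<in> fst c"
  shows "frechet_derivative (vf_coord M c s) (at (snd c p)) (tcoord M c p (X p)) =
    - tcoord M c p (nabla X (coord_field M c (tcoord M c p (s p))) p)"
proof -
  have o: "openin (mfd_topology M) (S \<inter> T)" using X s smooth_vf_openin by blast
  have "tcoord M c p (nabla X s p) = 0" using par linear_0[OF tcoord_linear[OF c]] by simp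
  then show ?thesis
    using conn_coord[OF smooth_vf_subset[OF X o] smooth_vf_subset[OF s o] c] p
    by (simp add: eq_neg_iff_add_eq_0)
qed

lemma hlift_at:
  assumes X: "smooth_vf M S X" and p: "p \<in> S"
  shows "hlift M nabla X (p, u) = (X p, - nabla X (coord_field M (chart_at M p) u) p)"
proof -
  have pM: "p \<in> points M" using X p smooth_vf_openin openin_subset_points by blast
  have val: "differential M (tangent_bundle M) (\<lambda>y. (y, s y)) p (X p) =
      (X p, - nabla X (coord_field M (chart_at M p) u) p)"
    if "p \<in> T" "smooth_vf M T s" "s p = u" "nabla X s p = 0" for T s
    using differential_section[OF that(2,1), of "X p"] pM that(3)
      parallel_section_derivative[OF X that(2) p that(1,4) chart_at[OF pM]] by simp
  obtain s where "smooth_vf M (S \<inter> fst (chart_at M p)) s" "s p = u" "nabla X s p = 0"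
    using parallel_section_exists[OF X p] .
  then have "\<exists>T s. p \<in> T \<and> smooth_vf M T s \<and> s p = u \<and> nabla X s p = 0 \<and>
      (X p, - nabla X (coord_field M (chart_at M p) u) p) = differential M (tangent_bundle M) (\<lambda>y. (y, s y)) p (X p)"
    using val p chart_at[OF pM] by (metis IntI)
  then show ?thesis
    unfolding hlift_def prod.case by (intro the_equality) (auto simp: val)
qed

text \<open>The lift is represented by the differential of a parallel section, so the change of
  chart comes from \<open>tcoord_section\<close> and the transformation law of Christoffel symbols
  is never written down.\<close>

lemma tcoord_hlift:
  assumes X: "smooth_vf M S X" and p: "p \<in> S" and c: "c \<in> atlas M" "p \<in> fst c"
  shows "tcoord (tangent_bundle M) (tangent_chart M c) (p, u) (hlift M nabla X (p, u)) =
    (tcoord M c p (X p), - tcoord M c p (nabla X (coord_field M c (tcoord M c p u)) p))"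
proof -
  have pM: "p \<in> points M" using X p smooth_vf_openin openin_subset_points by blast
  obtain s where s: "smooth_vf M (S \<inter> fst (chart_at M p)) s" "s p = u" "nabla X s p = 0"
    using parallel_section_exists[OF X p] .
  have pT: "p \<in> S \<inter> fst (chart_at M p)" using p chart_at[OF pM] by auto
  have "hlift M nabla X (p, u) =
      (X p, frechet_derivative (vf_coord M (chart_at M p) s) (at (snd (chart_at M p) p)) (X p))"
    using parallel_section_derivative[OF X s(1) p pT s(3) chart_at[OF pM]] hlift_at[OF X p] pM s(2) by simp
  then show ?thesis
    using tcoord_section[OF s(1) pT c, of "X p"] parallel_section_derivative[OF X s(1) p pT s(3) c] s(2)
    by simp
qed

lemma smooth_vf_hlift:
  assumes X: "smooth_vf M S X"
  shows "smooth_vf (tangent_bundle M) (S \<times> UNIV) (hlift M nabla X)"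
proof -
  note o = smooth_vf_openin[OF X]
  show ?thesis
    unfolding smooth_vf_def
  proof (intro conjI ballI openin_tangent_bundle o)
    fix tc assume "tc \<in> atlas (tangent_bundle M)"
    then obtain c where c: "c \<in> atlas M" "tc = tangent_chart M c" by auto
    have e: "snd tc ` (fst tc \<inter> S \<times> UNIV) = snd c ` (fst c \<inter> S) \<times> UNIV"
      using tangent_chart_image[OF c(1), of S] c(2) by (simp add: Times_Int_Times)
    let ?O = "snd c ` (fst c \<inter> S)"
    have oc: "open ?O" by (rule open_image[OF o c(1)])
    have oT: "open (?O \<times> (UNIV :: 'e set))" using oc by (simp add: open_Times)
    let ?h = "\<lambda>x u. vf_coord M c (nabla X (coord_field M c u)) x"
    have "smooth_on (?O \<times> UNIV) (\<lambda>z. ?h (fst z) (snd z))"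
    proof (rule smooth_on_linear_family[OF oc])
      fix b
      have "smooth_vf M (S \<inter> fst c) (nabla X (coord_field M c b))"
        by (rule conn_smooth[OF smooth_vf_chart_Int[OF X c(1)]])
      from smooth_vf_coord[OF this c(1)] show "smooth_on ?O (\<lambda>x. ?h x b)"
        by (simp add: Int_commute Int_left_commute)
    next
      fix x assume "x \<in> ?O"
      then obtain p where p: "p \<in> fst c" "p \<in> S" "x = snd c p" by auto
      show "linear (?h x)"
        using linear_compose[OF conn_coord_field_linear[OF X c(1) p(1,2)] tcoord_linear[OF c(1) p(1)]] p c
        by (simp add: comp_def)
    qed
    then have "smooth_on (?O \<times> UNIV) (\<lambda>z. (vf_coord M c X (fst z), 0 - ?h (fst z) (snd z)))"
      by (intro smooth_on_Pair smooth_on_diff oT smooth_on_const smooth_on_fst[OF oc] smooth_vf_coord[OF X c(1)])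
    then show "smooth_on (snd tc ` (fst tc \<inter> S \<times> UNIV)) (vf_coord (tangent_bundle M) tc (hlift M nabla X))"
      unfolding e
      by (rule smooth_on_cong[rotated])
        (use oT c in \<open>auto simp: vf_coord_def[of "tangent_bundle M"] tangent_chart_inv tcoord_hlift[OF X]\<close>)
  qed
qed

end

section \<open>Brackets of lifts, the complex structure and the metric\<close>

text \<open>The differential splits along the two axes; in the linear variable the derivative of
  \<open>h x\<close> is \<open>h x\<close> itself.\<close>

lemma frechet_derivative_linear_family:
  fixes h :: "'e::euclidean_space \<Rightarrow> 'g::euclidean_space \<Rightarrow> 'f::euclidean_space"
  assumes S: "open S" "x \<in> S" and h: "\<And>b. smooth_on S (\<lambda>x. h x b)" and lin: "\<And>x. x \<in> S \<Longrightarrow> linear (h x)"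
  shows "frechet_derivative (\<lambda>z. h (fst z) (snd z)) (at (x, u)) (a, b) =
    frechet_derivative (\<lambda>x. h x u) (at x) a + h x b"
proof -
  let ?F = "\<lambda>z. h (fst z) (snd z)"
  let ?F' = "frechet_derivative ?F (at (x, u))"
  have F: "(?F has_derivative ?F') (at (x, u))"
    using smooth_on_has_derivative[OF smooth_on_linear_family[OF S(1) h lin], of "(x, u)"] S(2) by simp
  have "((\<lambda>y. (y, u)) has_derivative (\<lambda>a. (a, 0))) (at x)"
    by (auto intro!: derivative_eq_intros)
  from has_derivative_compose[OF this F] have "((\<lambda>x. h x u) has_derivative (\<lambda>a. ?F' (a, 0))) (at x)" by simp
  then have 1: "frechet_derivative (\<lambda>x. h x u) (at x) a = ?F' (a, 0)" by (rule frechet_derivative_eqI)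
  have "((\<lambda>v. (x, v)) has_derivative (\<lambda>b. (0, b))) (at u)"
    by (auto intro!: derivative_eq_intros)
  from has_derivative_compose[OF this F] have "(h x has_derivative (\<lambda>b. ?F' (0, b))) (at u)" by simp
  moreover have "(h x has_derivative h x) (at u)"
    using lin[OF S(2)] linear_conv_bounded_linear bounded_linear_imp_has_derivative by blast
  ultimately have "(\<lambda>b. ?F' (0, b)) = h x" by (rule has_derivative_unique)
  then have 2: "h x b = ?F' (0, b)" by metis
  show ?thesis unfolding 1 2 using linear_add[OF has_derivative_linear[OF F], of "(a, 0)" "(0, b)"] by simp
qed

text \<open>
  The horizontal lift to \<open>T\<^sub>q(TM)\<close> of the single tangent vector \<open>a\<close>; the vertical lift of \<open>b\<close> is \<open>(0, b)\<close>.
\<close>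

definition hvec :: "('a, 'e::euclidean_space) mfd \<Rightarrow> (('a \<Rightarrow> 'e) \<Rightarrow> ('a \<Rightarrow> 'e) \<Rightarrow> 'a \<Rightarrow> 'e) \<Rightarrow>
    'a \<times> 'e \<Rightarrow> 'e \<Rightarrow> 'e \<times> 'e" where
  "hvec M nabla q a = hlift M nabla (coord_field M (chart_at M (fst q)) a) q"

context connection_manifold
begin

lemma vlift_derivative:
  assumes Y: "smooth_vf M S Y" and p: "p \<in> S" and c: "c \<in> atlas M" "p \<in> fst c"
  shows "frechet_derivative (vf_coord (tangent_bundle M) (tangent_chart M c) (vlift M Y)) (at (snd c p, u)) (a, b) =
    (0, frechet_derivative (vf_coord M c Y) (at (snd c p)) a)"
proof -
  have o: "open (snd c ` (fst c \<inter> S) \<times> (UNIV :: 'e set))"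
    using open_image[OF smooth_vf_openin[OF Y] c(1)] by (simp add: open_Times)
  have "(vf_coord M c Y has_derivative frechet_derivative (vf_coord M c Y) (at (snd c p))) (at (fst (snd c p, u)))"
    using smooth_vf_diff_at[OF Y c p] by simp
  from has_derivative_compose[OF has_derivative_fst[OF has_derivative_ident] this]
  have "((\<lambda>z. (0 :: 'e, vf_coord M c Y (fst z))) has_derivative
      (\<lambda>z. (0, frechet_derivative (vf_coord M c Y) (at (snd c p)) (fst z)))) (at (snd c p, u))"
    by (intro has_derivative_Pair has_derivative_const)
  then have "(vf_coord (tangent_bundle M) (tangent_chart M c) (vlift M Y) has_derivative
      (\<lambda>z. (0, frechet_derivative (vf_coord M c Y) (at (snd c p)) (fst z)))) (at (snd c p, u))"
    by (rule has_derivative_transform_within_open[OF _ o])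
      (use c p chart_subset[OF c(1)] in \<open>auto simp: vf_coord_def tangent_chart_inv vlift_at tcoord_vertical\<close>)
  from frechet_derivative_eqI[OF this, of "(a, b)"] show ?thesis by simp
qed

lemma hlift_derivative:
  assumes Y: "smooth_vf M S Y" and p: "p \<in> S" and c: "c \<in> atlas M" "p \<in> fst c"
  shows "frechet_derivative (vf_coord (tangent_bundle M) (tangent_chart M c) (hlift M nabla Y)) (at (snd c p, u)) (a, b) =
    (frechet_derivative (vf_coord M c Y) (at (snd c p)) a,
     - (frechet_derivative (vf_coord M c (nabla Y (coord_field M c u))) (at (snd c p)) a +
        tcoord M c p (nabla Y (coord_field M c b) p)))"
proof -
  let ?O = "snd c ` (fst c \<inter> S)"
  have oc: "open ?O" by (rule open_image[OF smooth_vf_openin[OF Y] c(1)])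
  have o: "open (?O \<times> (UNIV :: 'e set))" using oc by (simp add: open_Times)
  let ?h = "\<lambda>x u. vf_coord M c (nabla Y (coord_field M c u)) x"
  have sm: "smooth_on ?O (\<lambda>x. ?h x b)" for b
  proof -
    have "smooth_vf M (S \<inter> fst c) (nabla Y (coord_field M c b))"
      by (rule conn_smooth[OF smooth_vf_chart_Int[OF Y c(1)]])
    from smooth_vf_coord[OF this c(1)] show ?thesis by (simp add: Int_commute Int_left_commute)
  qed
  have lin: "linear (?h x)" if "x \<in> ?O" for x
  proof -
    from that obtain p where p: "p \<in> fst c" "p \<in> S" "x = snd c p" by auto
    show "linear (?h x)"
      using linear_compose[OF conn_coord_field_linear[OF Y c(1) p(1,2)] tcoord_linear[OF c(1) p(1)]] p c
      by (simp add: comp_def)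
  qed
  have x: "snd c p \<in> ?O" using p c by auto
  let ?F = "\<lambda>z. ?h (fst z) (snd z)"
  have F: "(?F has_derivative frechet_derivative ?F (at (snd c p, u))) (at (snd c p, u))"
    using smooth_on_has_derivative[OF smooth_on_linear_family[OF oc sm lin], of "(snd c p, u)"] x by simp
  have "(vf_coord M c Y has_derivative frechet_derivative (vf_coord M c Y) (at (snd c p))) (at (fst (snd c p, u)))"
    using smooth_vf_diff_at[OF Y c p] by simp
  from has_derivative_compose[OF has_derivative_fst[OF has_derivative_ident] this]
  have "((\<lambda>z. (vf_coord M c Y (fst z), - ?F z)) has_derivative
      (\<lambda>z. (frechet_derivative (vf_coord M c Y) (at (snd c p)) (fst z),
        - frechet_derivative ?F (at (snd c p, u)) z))) (at (snd c p, u))"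
    by (intro has_derivative_Pair has_derivative_minus F)
  then have "(vf_coord (tangent_bundle M) (tangent_chart M c) (hlift M nabla Y) has_derivative
      (\<lambda>z. (frechet_derivative (vf_coord M c Y) (at (snd c p)) (fst z),
        - frechet_derivative ?F (at (snd c p, u)) z))) (at (snd c p, u))"
    by (rule has_derivative_transform_within_open[OF _ o])
      (use c p in \<open>auto simp: vf_coord_def[of "tangent_bundle M"] tangent_chart_inv tcoord_hlift[OF Y]\<close>)
  from frechet_derivative_eqI[OF this, of "(a, b)"]
    frechet_derivative_linear_family[OF oc x sm lin, of u a b] c
  show ?thesis by simp
qed

section \<open>Horizontal and vertical components\<close>

text \<open>A connection is tensorial in its first argument, so the lift sees \<open>X\<close> only
  through \<open>X p\<close>; this justifies lifting single vectors by \<open>hvec\<close>.\<close>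

lemma hlift_eq_hvec:
  assumes X: "smooth_vf M S X" and p: "p \<in> S"
  shows "hlift M nabla X (p, u) = hvec M nabla (p, u) (X p)"
proof -
  let ?c = "chart_at M p"
  have pM: "p \<in> points M" using X p smooth_vf_openin openin_subset_points by blast
  note c = chart_at[OF pM]
  have pT: "p \<in> S \<inter> fst ?c" using c p by auto
  have "nabla X (coord_field M ?c u) p = nabla (coord_field M ?c (X p)) (coord_field M ?c u) p"
    using pM by (intro conn_tensorial_left[OF smooth_vf_chart_Int[OF X c(1)] smooth_vf_chart_Int(2)[OF X c(1)] pT]) simp
  then show ?thesis
    using hlift_at[OF X p] hlift_at[OF smooth_vf_coord_field[OF c(1)] c(2)] pM by (simp add: hvec_def)
qed

lemma hvec_eq: "p \<in> points M \<Longrightarrow> hvec M nabla (p, u) a =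
    (a, - nabla (coord_field M (chart_at M p) a) (coord_field M (chart_at M p) u) p)"
  using hlift_at[OF smooth_vf_coord_field[OF chart_at(1)] chart_at(2)] by (simp add: hvec_def)

lemma hvec_linear:
  assumes p: "p \<in> points M"
  shows "linear (hvec M nabla (p, u))"
proof -
  let ?c = "chart_at M p"
  note c = chart_at[OF p]
  note e = smooth_vf_coord_field[OF c(1)]
  have "nabla (coord_field M ?c (a + b)) (coord_field M ?c u) p =
      nabla (coord_field M ?c a) (coord_field M ?c u) p + nabla (coord_field M ?c b) (coord_field M ?c u) p" for a b
    using conn_tensorial_left[OF e smooth_vf_add[OF e e] e c(2), of "a + b" a b u]
      conn_add_left[OF e e e c(2), of a b u] p by simp
  moreover have "nabla (coord_field M ?c (r *\<^sub>R a)) (coord_field M ?c u) p =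
      r *\<^sub>R nabla (coord_field M ?c a) (coord_field M ?c u) p" for r a
    using conn_tensorial_left[OF e smooth_vf_scaleR_const[OF e] e c(2), of "r *\<^sub>R a" r a u]
      conn_scaleR_left[OF smooth_fun_const[OF openin_chart[OF c(1)]] e e c(2), of r a u] p by simp
  ultimately show ?thesis by (intro linearI) (simp_all add: hvec_eq[OF p])
qed

lemma lift_decomposition:
  assumes p: "p \<in> points M"
  obtains a b where "w = hvec M nabla (p, u) a + (0, b)"
  using that[of "fst w" "snd w - snd (hvec M nabla (p, u) (fst w))"]
  by (simp add: prod_eq_iff hvec_eq[OF p])

lemma lift_decomposition_unique:
  assumes p: "p \<in> points M" and "hvec M nabla (p, u) a + (0, b) = hvec M nabla (p, u) a' + (0, b')"
  shows "a = a'" "b = b'"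
  using assms(2) by (auto simp: hvec_eq[OF p] prod_eq_iff)

lemma coord_lift:
  assumes p: "p \<in> points M"
  shows "hvec M nabla (p, u) a + (0, b) =
    hlift M nabla (coord_field M (chart_at M p) a) (p, u) + vlift M (coord_field M (chart_at M p) b) (p, u)"
  using p by (simp add: hvec_def vlift_at)

lemma lift_fields:
  assumes "smooth_vf M S X" "smooth_vf M S Y" "p \<in> S"
  shows "hlift M nabla X (p, u) + vlift M Y (p, u) = hvec M nabla (p, u) (X p) + (0, Y p)"
proof -
  have "p \<in> points M" using assms(1,3) smooth_vf_openin openin_subset_points by blast
  then show ?thesis using assms by (simp add: hlift_eq_hvec vlift_at)
qed

text \<open>The description in \<open>canonical_J\<close> is satisfied by coordinate fields with
  values \<open>a\<close> and \<open>b\<close>, and any other fields satisfying it take these values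
  at \<open>p\<close> because the decomposition is unique.\<close>

lemma canonical_J_eq:
  assumes p: "p \<in> points M"
  shows "canonical_J M nabla (p, u) (hvec M nabla (p, u) a + (0, b)) = (0, a) - hvec M nabla (p, u) b"
  unfolding canonical_J_def
proof (rule the_equality)
  let ?c = "chart_at M p"
  note e = smooth_vf_coord_field[OF chart_at(1)[OF p]]
  show "\<exists>S X Y. fst (p, u) \<in> S \<and> smooth_vf M S X \<and> smooth_vf M S Y \<and>
      hvec M nabla (p, u) a + (0, b) = hlift M nabla X (p, u) + vlift M Y (p, u) \<and>
      (0, a) - hvec M nabla (p, u) b = vlift M X (p, u) - hlift M nabla Y (p, u)"
    by (rule exI[of _ "fst ?c"], rule exI[of _ "coord_field M ?c a"], rule exI[of _ "coord_field M ?c b"])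
      (use p e chart_at(2)[OF p] in \<open>simp add: coord_lift hvec_def vlift_at\<close>)
next
  fix z assume "\<exists>S X Y. fst (p, u) \<in> S \<and> smooth_vf M S X \<and> smooth_vf M S Y \<and>
      hvec M nabla (p, u) a + (0, b) = hlift M nabla X (p, u) + vlift M Y (p, u) \<and>
      z = vlift M X (p, u) - hlift M nabla Y (p, u)"
  then obtain S X Y where S: "p \<in> S" "smooth_vf M S X" "smooth_vf M S Y"
    "hvec M nabla (p, u) a + (0, b) = hlift M nabla X (p, u) + vlift M Y (p, u)"
    "z = vlift M X (p, u) - hlift M nabla Y (p, u)" by auto
  then have "a = X p" "b = Y p" using lift_decomposition_unique[OF p] lift_fields by metis+
  then show "z = (0, a) - hvec M nabla (p, u) b" using S p by (simp add: vlift_at hlift_eq_hvec)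
qed

lemma canonical_g_eq:
  assumes p: "p \<in> points M"
  shows "canonical_g M nabla g (p, u) (hvec M nabla (p, u) a + (0, b)) (hvec M nabla (p, u) a' + (0, b')) =
    g p a a' + g p b b'"
  unfolding canonical_g_def
proof (rule the_equality)
  let ?c = "chart_at M p"
  note e = smooth_vf_coord_field[OF chart_at(1)[OF p]]
  show "\<exists>S X Y X' Y'. fst (p, u) \<in> S \<and> smooth_vf M S X \<and> smooth_vf M S Y \<and> smooth_vf M S X' \<and> smooth_vf M S Y' \<and>
      hvec M nabla (p, u) a + (0, b) = hlift M nabla X (p, u) + vlift M Y (p, u) \<and>
      hvec M nabla (p, u) a' + (0, b') = hlift M nabla X' (p, u) + vlift M Y' (p, u) \<and>
      g p a a' + g p b b' = g (fst (p, u)) (X (fst (p, u))) (X' (fst (p, u))) +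
        g (fst (p, u)) (Y (fst (p, u))) (Y' (fst (p, u)))"
    by (rule exI[of _ "fst ?c"], rule exI[of _ "coord_field M ?c a"], rule exI[of _ "coord_field M ?c b"],
        rule exI[of _ "coord_field M ?c a'"], rule exI[of _ "coord_field M ?c b'"])
      (use p e chart_at(2)[OF p] in \<open>simp add: coord_lift hvec_def vlift_at\<close>)
next
  fix r assume "\<exists>S X Y X' Y'. fst (p, u) \<in> S \<and> smooth_vf M S X \<and> smooth_vf M S Y \<and> smooth_vf M S X' \<and> smooth_vf M S Y' \<and>
      hvec M nabla (p, u) a + (0, b) = hlift M nabla X (p, u) + vlift M Y (p, u) \<and>
      hvec M nabla (p, u) a' + (0, b') = hlift M nabla X' (p, u) + vlift M Y' (p, u) \<and>
      r = g (fst (p, u)) (X (fst (p, u))) (X' (fst (p, u))) + g (fst (p, u)) (Y (fst (p, u))) (Y' (fst (p, u)))"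
  then obtain S X Y X' Y' where S: "p \<in> S" "smooth_vf M S X" "smooth_vf M S Y" "smooth_vf M S X'" "smooth_vf M S Y'"
    "hvec M nabla (p, u) a + (0, b) = hlift M nabla X (p, u) + vlift M Y (p, u)"
    "hvec M nabla (p, u) a' + (0, b') = hlift M nabla X' (p, u) + vlift M Y' (p, u)"
    "r = g p (X p) (X' p) + g p (Y p) (Y' p)" by auto
  have "a = X p" "b = Y p" using lift_decomposition_unique[OF p] lift_fields[OF S(2,3,1)] S(6) by metis+
  moreover have "a' = X' p" "b' = Y' p"
    using lift_decomposition_unique[OF p] lift_fields[OF S(4,5,1)] S(7) by metis+
  ultimately show "r = g p a a' + g p b b'" using S(8) by simp
qed

end

section \<open>Brackets of lifts\<close>

locale flat_manifold = connection_manifold M nabla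
  for M :: "('a, 'e::euclidean_space) mfd" and nabla +
  assumes torsion_free: "torsion_free M nabla" and flat: "flat M nabla"
begin

sublocale TM: atlas_manifold "tangent_bundle M"
  by unfold_locales (rule smooth_atlas_tangent_bundle)

lemma bracket_smooth: "smooth_vf M S X \<Longrightarrow> smooth_vf M S Y \<Longrightarrow> smooth_vf M S (lie_bracket M X Y)"
  by (rule smooth_vf_lie_bracket[OF torsion_free])

lemma bracket_eq: "smooth_vf M S X \<Longrightarrow> smooth_vf M S Y \<Longrightarrow> p \<in> S \<Longrightarrow>
    lie_bracket M X Y p = nabla X Y p - nabla Y X p"
  using torsion_free[unfolded torsion_free_def, rule_format] by metis

lemma TM_bracket_at:
  assumes "p \<in> points M"
  shows "lie_bracket (tangent_bundle M) A C (p, u) =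
    frechet_derivative (vf_coord (tangent_bundle M) (tangent_chart M (chart_at M p)) C)
      (at (snd (chart_at M p) p, u)) (A (p, u)) -
    frechet_derivative (vf_coord (tangent_bundle M) (tangent_chart M (chart_at M p)) A)
      (at (snd (chart_at M p) p, u)) (C (p, u))"
proof -
  let ?d = "tangent_chart M (chart_at M p)"
  have d: "?d \<in> atlas (tangent_bundle M)" "(p, u) \<in> fst ?d" using chart_at[OF assms] by auto
  have v: "vf_coord (tangent_bundle M) ?d A (snd (chart_at M p) p, u) = A (p, u)" for A
    using TM.vf_coord_at[OF d, of A] TM.tcoord_chart_at[of "(p, u)" "A (p, u)"] assms by simp
  show ?thesis using assms by (simp add: lie_bracket_def Let_def v)
qed

lemma bracket_vlift_vlift:
  assumes X: "smooth_vf M S X" and Y: "smooth_vf M S Y" and p: "p \<in> S"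
  shows "lie_bracket (tangent_bundle M) (vlift M X) (vlift M Y) (p, u) = 0"
proof -
  have pM: "p \<in> points M" using X p smooth_vf_openin openin_subset_points by blast
  note c = chart_at[OF pM]
  have l: "linear (frechet_derivative (vf_coord M (chart_at M p) Z) (at (snd (chart_at M p) p)))"
    if "smooth_vf M S Z" for Z
    using has_derivative_linear[OF smooth_vf_diff_at[OF that c p]] .
  show ?thesis
    by (simp add: TM_bracket_at[OF pM] vlift_at[OF pM] vlift_derivative[OF X p c] vlift_derivative[OF Y p c]
        linear_0[OF l[OF X]] linear_0[OF l[OF Y]] zero_prod_def)
qed

text \<open>The horizontal part of the first lift differentiates the components of \<open>Y\<close>,
  and the linear dependence of the horizontal lift on the fibre variable contributes the Christoffel
  term; \<open>conn_at\<close> adds the two.\<close>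

lemma bracket_hlift_vlift:
  assumes X: "smooth_vf M S X" and Y: "smooth_vf M S Y" and p: "p \<in> S"
  shows "lie_bracket (tangent_bundle M) (hlift M nabla X) (vlift M Y) (p, u) = vlift M (nabla X Y) (p, u)"
proof -
  have pM: "p \<in> points M" using X p smooth_vf_openin openin_subset_points by blast
  note c = chart_at[OF pM]
  have pT: "p \<in> S \<inter> fst (chart_at M p)" using c p by auto
  have l: "linear (frechet_derivative (vf_coord M (chart_at M p) Z) (at (snd (chart_at M p) p)))"
    if "smooth_vf M T Z" "p \<in> T" for Z T
    using has_derivative_linear[OF smooth_vf_diff_at[OF that(1) c that(2)]] .
  have n: "smooth_vf M (S \<inter> fst (chart_at M p)) (nabla X (coord_field M (chart_at M p) u))"
    by (rule conn_smooth[OF smooth_vf_chart_Int[OF X c(1)]])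
  show ?thesis
    using conn_at[OF X Y p] pM
    by (simp add: TM_bracket_at[OF pM] vlift_at[OF pM] hlift_at[OF X p] vlift_derivative[OF Y p c]
        hlift_derivative[OF X p c] linear_0[OF l[OF X p]] linear_0[OF l[OF n pT]])
qed

text \<open>The vertical component of the bracket is minus the commutator of the covariant
  derivatives along \<open>X\<close> and \<open>Y\<close>, applied to the field with constant
  components \<open>u\<close>; flatness turns it into the vertical component of the lift of the
  bracket. This is the one use of flatness.\<close>

lemma bracket_hlift_hlift:
  assumes X: "smooth_vf M S X" and Y: "smooth_vf M S Y" and p: "p \<in> S"
  shows "lie_bracket (tangent_bundle M) (hlift M nabla X) (hlift M nabla Y) (p, u) =
    hlift M nabla (lie_bracket M X Y) (p, u)"
proof -
  have pM: "p \<in> points M" using X p smooth_vf_openin openin_subset_points by blast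
  let ?c = "chart_at M p"
  note c = chart_at[OF pM]
  let ?T = "S \<inter> fst ?c" and ?e = "coord_field M ?c u"
  have pT: "p \<in> ?T" using c p by auto
  note X' = smooth_vf_chart_Int(1)[OF X c(1)] and Y' = smooth_vf_chart_Int(1)[OF Y c(1)]
    and e = smooth_vf_chart_Int(2)[OF X c(1)]
  have fl: "nabla (lie_bracket M X Y) ?e p = nabla X (nabla Y ?e) p - nabla Y (nabla X ?e) p"
    using flat[unfolded flat_def, rule_format, OF X' Y' e pT, of u] by (simp add: curvature_def algebra_simps)
  \<comment> \<open>Vertical parts of the lifts are negative Christoffel terms, and they re-enter
    here as constant components of a coordinate field.\<close>
  have m: "nabla Z (coord_field M ?c (- k)) p = - nabla Z (coord_field M ?c k) p"
    if "smooth_vf M S Z" for Z k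
    using linear_neg[OF conn_coord_field_linear[OF that c p]] .
  have "fst (hlift M nabla (lie_bracket M X Y) (p, u)) =
      frechet_derivative (vf_coord M ?c Y) (at (snd ?c p)) (X p) - frechet_derivative (vf_coord M ?c X) (at (snd ?c p)) (Y p)"
    using hlift_at[OF bracket_smooth[OF X Y] p] c pM by (simp add: lie_bracket_def Let_def)
  moreover have "snd (hlift M nabla (lie_bracket M X Y) (p, u)) =
     nabla Y (nabla X ?e) p - nabla X (nabla Y ?e) p"
    using hlift_at[OF bracket_smooth[OF X Y] p] fl by simp
  ultimately show ?thesis
    using conn_at[OF X' conn_smooth[OF Y' e] pT, of u] conn_at[OF Y' conn_smooth[OF X' e] pT, of u] pM
    by (simp add: TM_bracket_at[OF pM] hlift_at[OF X p] hlift_at[OF Y p] hlift_derivative[OF X p c]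
        hlift_derivative[OF Y p c] m[OF X] m[OF Y] prod_eq_iff)
qed

end

section \<open>The difference tensor and its adjoint\<close>

locale affine_riemann_manifold = flat_manifold M nabla
  for M :: "('a, 'e::euclidean_space) mfd" and nabla +
  fixes g :: "'a \<Rightarrow> 'e \<Rightarrow> 'e \<Rightarrow> real"
    and D :: "('a \<Rightarrow> 'e) \<Rightarrow> ('a \<Rightarrow> 'e) \<Rightarrow> 'a \<Rightarrow> 'e"
  assumes metric: "riemannian_metric M g" and lc: "levi_civita M g D"
begin

sublocale D: connection_manifold M D
  by unfold_locales (use lc in \<open>simp add: levi_civita_def\<close>)

section \<open>Linear algebra of the metric\<close>

lemma g_bilinear: "p \<in> points M \<Longrightarrow> bilinear (g p)"
  and g_sym: "p \<in> points M \<Longrightarrow> g p v w = g p w v"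
  and g_pos: "p \<in> points M \<Longrightarrow> v \<noteq> 0 \<Longrightarrow> g p v v > 0"
  using metric by (auto simp: riemannian_metric_def)

lemmas g_add_left = bilinear_ladd[OF g_bilinear]
lemmas g_add_right = bilinear_radd[OF g_bilinear]
lemmas g_diff_left = bilinear_lsub[OF g_bilinear]
lemmas g_diff_right = bilinear_rsub[OF g_bilinear]
lemmas g_minus_left = bilinear_lneg[OF g_bilinear]
lemmas g_minus_right = bilinear_rneg[OF g_bilinear]
lemmas g_scale_left = bilinear_lmul[OF g_bilinear]
lemmas g_scale_right = bilinear_rmul[OF g_bilinear]
lemmas g_zero_left = bilinear_lzero[OF g_bilinear]
lemmas g_zero_right = bilinear_rzero[OF g_bilinear]

lemmas g_simps = g_add_left g_add_right g_diff_left g_diff_right g_minus_left g_minus_right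
  g_scale_left g_scale_right g_zero_left g_zero_right

lemma g_eqI:
  assumes p: "p \<in> points M" and "\<And>z. g p v z = g p w z"
  shows "v = w"
proof (rule ccontr)
  assume "v \<noteq> w"
  then have "g p (v - w) (v - w) > 0" using g_pos[OF p] by simp
  then show False using assms(2)[of "v - w"] by (simp add: g_diff_left[OF p])
qed

text \<open>The map \<open>T\<close> represents \<open>g p w\<close> through the Euclidean inner
  product. Positivity makes it injective, hence surjective in finite dimension, so no inverse matrix
  has to be formed.\<close>

lemma g_riesz:
  assumes p: "p \<in> points M" and l: "linear l"
  shows "\<exists>w. \<forall>z. g p w z = l z"
proof -
  define T where "T w = (\<Sum>b\<in>Basis. g p w b *\<^sub>R b)" for w
  have T: "T w \<bullet> b = g p w b" if "b \<in> Basis" for w b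
    using that by (simp add: T_def inner_sum_left inner_Basis if_distrib cong: if_cong)
  have lin: "linear T"
    unfolding T_def
    by (intro linearI) (simp_all add: g_simps[OF p] scaleR_add_left sum.distrib scaleR_right.sum)
  have expand: "g p w z = (\<Sum>b\<in>Basis. (z \<bullet> b) * g p w b)" for w z
    using linear_basis_expansion[of "g p w" z] g_bilinear[OF p] by (simp add: bilinear_def)
  have "inj T"
  proof (rule injI)
    fix v w assume "T v = T w"
    then have "g p v b = g p w b" if "b \<in> Basis" for b using T[OF that] by metis
    then have "g p v z = g p w z" for z by (subst expand[of v], subst expand[of w]) simp
    then show "v = w" by (rule g_eqI[OF p])
  qed
  then have "surj T" using linear_injective_imp_surjective[OF lin] by simp
  then obtain w where w: "T w = (\<Sum>b\<in>Basis. l b *\<^sub>R b)" by (metis surjD)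
  have "g p w b = l b" if "b \<in> Basis" for b
    using T[OF that, of w] that by (simp add: w inner_sum_left inner_Basis if_distrib cong: if_cong)
  then have "g p w z = l z" for z
    by (subst expand, subst linear_basis_expansion[OF l, of z]) simp
  then show ?thesis by blast
qed

lemma g_smooth: "smooth_vf M S X \<Longrightarrow> smooth_vf M S Y \<Longrightarrow> smooth_fun M S (\<lambda>p. g p (X p) (Y p))"
  using metric[unfolded riemannian_metric_def, THEN conjunct2, rule_format] .

lemma D_bracket: "smooth_vf M S X \<Longrightarrow> smooth_vf M S Y \<Longrightarrow> p \<in> S \<Longrightarrow>
    D X Y p - D Y X p = lie_bracket M X Y p"
  using lc[unfolded levi_civita_def torsion_free_def, THEN conjunct2, THEN conjunct1, rule_format] .

lemma D_metric: "smooth_vf M S X \<Longrightarrow> smooth_vf M S Y \<Longrightarrow> smooth_vf M S Z \<Longrightarrow> p \<in> S \<Longrightarrow>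
    dir_deriv M X (\<lambda>q. g q (Y q) (Z q)) p = g p (D X Y p) (Z p) + g p (Y p) (D X Z p)"
  using lc[unfolded levi_civita_def, THEN conjunct2, THEN conjunct2, rule_format] .

text \<open>
  \<open>gam p\<close> and \<open>gs p\<close> are the bilinear maps induced by \<open>\<gamma>\<close> and \<open>\<gamma>\<^sup>*\<close> on the tangent space at \<open>p\<close>.
\<close>

definition gam :: "'a \<Rightarrow> 'e \<Rightarrow> 'e \<Rightarrow> 'e" where
  "gam p a b = diff_tensor D nabla (coord_field M (chart_at M p) a) (coord_field M (chart_at M p) b) p"

text \<open>Both connections contain the same derivative of components in \<open>conn_at\<close>,
  which cancels in the difference; the remaining Christoffel terms see only \<open>X p\<close> and
  \<open>Y p\<close>.\<close>

lemma diff_tensor_eq: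
  assumes X: "smooth_vf M S X" and Y: "smooth_vf M S Y" and p: "p \<in> S"
  shows "diff_tensor D nabla X Y p = gam p (X p) (Y p)"
proof -
  let ?c = "chart_at M p"
  have pM: "p \<in> points M" using X p smooth_vf_openin openin_subset_points by blast
  note c = chart_at[OF pM]
  have pT: "p \<in> S \<inter> fst ?c" using c p by auto
  note X' = smooth_vf_chart_Int(1)[OF X c(1)] and e = smooth_vf_chart_Int(2)[OF X c(1)]
  have "D X (coord_field M ?c (Y p)) p = D (coord_field M ?c (X p)) (coord_field M ?c (Y p)) p"
    using pM by (intro D.conn_tensorial_left[OF X' e e pT]) simp
  moreover have "nabla X (coord_field M ?c (Y p)) p = nabla (coord_field M ?c (X p)) (coord_field M ?c (Y p)) p"
    using pM by (intro conn_tensorial_left[OF X' e e pT]) simp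
  ultimately show ?thesis
    using conn_at[OF X Y p] D.conn_at[OF X Y p] by (simp add: diff_tensor_def gam_def)
qed

lemma nabla_eq:
  "smooth_vf M S X \<Longrightarrow> smooth_vf M S Y \<Longrightarrow> p \<in> S \<Longrightarrow> nabla X Y p = D X Y p - gam p (X p) (Y p)"
  using diff_tensor_eq[of S X Y p] by (simp add: diff_tensor_def algebra_simps)

text \<open>Both connections are torsion-free, so their antisymmetric parts are the same
  bracket.\<close>

lemma gam_sym:
  assumes p: "p \<in> points M"
  shows "gam p a b = gam p b a"
proof -
  let ?c = "chart_at M p"
  note c = chart_at[OF p]
  note e = smooth_vf_coord_field[OF c(1)]
  show ?thesis
    using D_bracket[OF e e c(2), of a b] bracket_eq[OF e e c(2), of a b]
    by (simp add: gam_def diff_tensor_def algebra_simps)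
qed

lemma gam_linear_right:
  assumes p: "p \<in> points M"
  shows "linear (gam p a)"
  unfolding gam_def[abs_def] diff_tensor_def
  using chart_at[OF p] smooth_vf_coord_field[OF chart_at(1)[OF p]]
  by (intro linear_compose_sub conn_coord_field_linear D.conn_coord_field_linear)

lemma gam_bilinear: "p \<in> points M \<Longrightarrow> bilinear (gam p)"
  using gam_linear_right[of p] gam_sym[of p] unfolding bilinear_def
  by (metis (no_types, lifting) ext)

definition gs :: "'a \<Rightarrow> 'e \<Rightarrow> 'e \<Rightarrow> 'e" where
  "gs p a b = (THE w. \<forall>z. g p w z = g p b (gam p a z))"

lemma gs:
  assumes p: "p \<in> points M"
  shows "g p (gs p a b) z = g p b (gam p a z)"
proof -
  have "linear (\<lambda>z. g p b (gam p a z))"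
    using linear_compose[OF gam_linear_right[OF p, of a], of "g p b"] g_bilinear[OF p]
    by (simp add: bilinear_def comp_def)
  then obtain w where w: "\<forall>z. g p w z = g p b (gam p a z)" using g_riesz[OF p] by blast
  have "\<forall>z. g p (gs p a b) z = g p b (gam p a z)"
    unfolding gs_def by (rule theI[of _ w]) (use w g_eqI[OF p] in auto)
  then show ?thesis by blast
qed

lemma gs_eqI: "p \<in> points M \<Longrightarrow> (\<And>z. g p w z = g p b (gam p a z)) \<Longrightarrow> gs p a b = w"
  using gs g_eqI by metis

lemma gs_bilinear:
  assumes p: "p \<in> points M"
  shows "bilinear (gs p)"
  unfolding bilinear_def
proof (intro conjI allI linearI)
  note s = gs[OF p] g_simps[OF p] bilinear_ladd[OF gam_bilinear[OF p]] bilinear_lmul[OF gam_bilinear[OF p]]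
  show "gs p a (b + b') = gs p a b + gs p a b'" for a b b' by (rule gs_eqI[OF p]) (simp add: s)
  show "gs p a (r *\<^sub>R b) = r *\<^sub>R gs p a b" for a b r by (rule gs_eqI[OF p]) (simp add: s)
  show "gs p (a + a') b = gs p a b + gs p a' b" for a a' b by (rule gs_eqI[OF p]) (simp add: s)
  show "gs p (r *\<^sub>R a) b = r *\<^sub>R gs p a b" for a b r by (rule gs_eqI[OF p]) (simp add: s)
qed

text \<open>Every tangent vector is the value of a local field and \<gamma> is pointwise, so the
  description by fields and the description by vectors have the same solutions.\<close>

lemma adjoint_tensor_eq:
  assumes X: "smooth_vf M S X" and p: "p \<in> S"
  shows "adjoint_tensor M g (diff_tensor D nabla) X Y p = gs p (X p) (Y p)"
proof -
  have pM: "p \<in> points M" using X p smooth_vf_openin openin_subset_points by blast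
  have T: "diff_tensor D nabla X Z p = gam p (X p) (Z p)" if "p \<in> T" "smooth_vf M T Z" for T Z
  proof -
    have o: "openin (mfd_topology M) (S \<inter> T)" using X that smooth_vf_openin by blast
    show ?thesis
      by (rule diff_tensor_eq[OF smooth_vf_subset[OF X o] smooth_vf_subset[OF that(2) o]]) (use p that in auto)
  qed
  have "(\<forall>T Z. p \<in> T \<longrightarrow> smooth_vf M T Z \<longrightarrow> g p w (Z p) = g p (Y p) (diff_tensor D nabla X Z p)) \<longleftrightarrow>
      (\<forall>z. g p w z = g p (Y p) (gam p (X p) z))" (is "?L \<longleftrightarrow> ?R") for w
  proof
    assume ?L
    then show ?R
      using smooth_vf_coord_field[OF chart_at(1)[OF pM]] chart_at(2)[OF pM] T coord_field_chart_at[OF pM]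
      by metis
  qed (use T in auto)
  then show ?thesis by (simp add: adjoint_tensor_def gs_def)
qed

section \<open>The bundle metric and complex structure on single vectors\<close>

lemma g1_lift:
  assumes p: "p \<in> points M"
  shows "canonical_g M nabla g (p, u) (hvec M nabla (p, u) a) (hvec M nabla (p, u) a') = g p a a'"
    "canonical_g M nabla g (p, u) (hvec M nabla (p, u) a) (0, b') = 0"
    "canonical_g M nabla g (p, u) (0, b) (hvec M nabla (p, u) a') = 0"
    "canonical_g M nabla g (p, u) (0, b) (0, b') = g p b b'"
  using canonical_g_eq[OF p, of g u a 0 a' 0] canonical_g_eq[OF p, of g u a 0 0 b']
    canonical_g_eq[OF p, of g u 0 b a' 0] canonical_g_eq[OF p, of g u 0 b 0 b']
    linear_0[OF hvec_linear[OF p]] by (simp_all add: g_simps[OF p] flip: zero_prod_def)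

lemma J1_lift:
  assumes p: "p \<in> points M"
  shows "canonical_J M nabla (p, u) (hvec M nabla (p, u) a) = (0, a)"
    "canonical_J M nabla (p, u) (0, b) = hvec M nabla (p, u) (- b)"
  using canonical_J_eq[OF p, of u a 0] canonical_J_eq[OF p, of u 0 b]
    linear_0[OF hvec_linear[OF p]] linear_neg[OF hvec_linear[OF p]] by (simp_all flip: zero_prod_def)

lemma g1_bilinear:
  assumes p: "p \<in> points M"
  shows "bilinear (canonical_g M nabla g (p, u))"
proof -
  let ?h = "hvec M nabla (p, u)" and ?g = "canonical_g M nabla g (p, u)"
  have add: "?h a + (0, b) + (?h a' + (0, b')) = ?h (a + a') + (0, b + b')"
    and scale: "r *\<^sub>R (?h a + (0, b)) = ?h (r *\<^sub>R a) + (0, r *\<^sub>R b)" for a b a' b' r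
    by (simp_all add: linear_add[OF hvec_linear[OF p]] linear_cmul[OF hvec_linear[OF p]] scaleR_add_right
        scaleR_Pair prod_eq_iff)
  show ?thesis
    unfolding bilinear_def
  proof (intro conjI allI linearI)
    fix w w' w'' r
    obtain a b a' b' a'' b'' where w: "w = ?h a + (0, b)" "w' = ?h a' + (0, b')" "w'' = ?h a'' + (0, b'')"
      using lift_decomposition[OF p] by metis
    show "?g w (w' + w'') = ?g w w' + ?g w w''" "?g (w + w') w'' = ?g w w'' + ?g w' w''"
      "?g w (r *\<^sub>R w') = r *\<^sub>R ?g w w'" "?g (r *\<^sub>R w) w' = r *\<^sub>R ?g w w'"
      unfolding w add scale canonical_g_eq[OF p] by (simp_all add: g_simps[OF p] algebra_simps)
  qed
qed

lemma g1_sym: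
  assumes p: "p \<in> points M"
  shows "canonical_g M nabla g (p, u) w w' = canonical_g M nabla g (p, u) w' w"
proof -
  obtain a b a' b' where w: "w = hvec M nabla (p, u) a + (0, b)" "w' = hvec M nabla (p, u) a' + (0, b')"
    using lift_decomposition[OF p] by metis
  show ?thesis unfolding w canonical_g_eq[OF p] using g_sym[OF p] by metis
qed

text \<open>Reads off both components of a vector from its products with lifts; in this way the
  values of the Bismut connection are recovered from the Koszul formula.\<close>

lemma g1_eqI:
  assumes p: "p \<in> points M"
    and "\<And>z. canonical_g M nabla g (p, u) w (hvec M nabla (p, u) z) = g p a z"
    and "\<And>z. canonical_g M nabla g (p, u) w (0, z) = g p b z"
  shows "w = hvec M nabla (p, u) a + (0, b)"
proof -
  obtain a' b' where w: "w = hvec M nabla (p, u) a' + (0, b')" using lift_decomposition[OF p] .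
  note g1 = bilinear_ladd[OF g1_bilinear[OF p]]
  have "a' = a" by (rule g_eqI[OF p]) (use assms(2) in \<open>simp add: w g1 g1_lift[OF p]\<close>)
  moreover have "b' = b" by (rule g_eqI[OF p]) (use assms(3) in \<open>simp add: w g1 g1_lift[OF p]\<close>)
  ultimately show ?thesis using w by simp
qed

text \<open>The first component is the image under the differential of the projection, hence it
  transforms like a tangent vector of \<open>M\<close>.\<close>

lemma fst_tcoord_TM:
  assumes c: "c \<in> atlas M" "p \<in> fst c"
  shows "fst (tcoord (tangent_bundle M) (tangent_chart M c) (p, u) w) = tcoord M c p (fst w)"
proof -
  have p: "p \<in> points M" using chart_subset c by auto
  obtain a b where w: "w = hvec M nabla (p, u) a + (0, b)" using lift_decomposition[OF p] .
  have tc: "tangent_chart M c \<in> atlas (tangent_bundle M)" "(p, u) \<in> fst (tangent_chart M c)" using c by auto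
  note e = smooth_vf_coord_field[OF chart_at(1)[OF p], of a]
  show ?thesis
    unfolding w linear_add[OF TM.tcoord_linear[OF tc]] tcoord_vertical[OF c]
    using tcoord_hlift[OF e chart_at(2)[OF p] c] arg_cong[OF hvec_eq[OF p, of u a], of fst] p
    by (simp add: hvec_def)
qed

text \<open>Restricts a field to the zero section and projects it to the base; this brings
  smoothness from the bundle back to \<open>M\<close>.\<close>

lemma smooth_vf_fst:
  assumes W: "smooth_vf (tangent_bundle M) (S \<times> UNIV) W" and S: "openin (mfd_topology M) S"
  shows "smooth_vf M S (\<lambda>p. fst (W (p, 0)))"
  unfolding smooth_vf_def
proof (intro conjI ballI S)
  fix c assume c: "c \<in> atlas M"
  let ?O = "snd c ` (fst c \<inter> S)"
  have o: "open ?O" by (rule open_image[OF S c])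
  have e: "snd (tangent_chart M c) ` (fst (tangent_chart M c) \<inter> S \<times> UNIV) = ?O \<times> UNIV"
    using tangent_chart_image[OF c, of S] by (simp add: Times_Int_Times)
  have tc: "tangent_chart M c \<in> atlas (tangent_bundle M)" using c by simp
  have "smooth_on (?O \<times> UNIV) (vf_coord (tangent_bundle M) (tangent_chart M c) W)"
    using TM.smooth_vf_coord[OF W tc] unfolding e .
  then have "smooth_on ?O (\<lambda>x. vf_coord (tangent_bundle M) (tangent_chart M c) W (x, 0))"
    by (rule smooth_on_compose[OF o _ smooth_on_Pair[OF o smooth_on_ident[OF o] smooth_on_const], rotated]) auto
  then have "smooth_on ?O (\<lambda>x. fst (vf_coord (tangent_bundle M) (tangent_chart M c) W (x, 0)))"
    by (rule smooth_on_bounded_linear[OF o bounded_linear_fst])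
  then show "smooth_on ?O (vf_coord M c (\<lambda>p. fst (W (p, 0))))"
    by (rule smooth_on_cong[OF o])
      (use c in \<open>auto simp: vf_coord_def tangent_chart_inv fst_tcoord_TM linear_0[OF coord_field_linear[OF c]]\<close>)
qed

lemma dir_deriv_pullback:
  assumes f: "smooth_fun M S f" and p: "p \<in> S"
  shows "dir_deriv (tangent_bundle M) A (\<lambda>q. f (fst q)) (p, u) =
    frechet_derivative (f \<circ> chart_inv (chart_at M p)) (at (snd (chart_at M p) p)) (fst (A (p, u)))"
proof -
  let ?c = "chart_at M p"
  have pM: "p \<in> points M" using f p smooth_fun_openin openin_subset_points by blast
  note c = chart_at[OF pM]
  have o: "open (snd ?c ` (fst ?c \<inter> S) \<times> (UNIV :: 'e set))"
    using open_image[OF smooth_fun_openin[OF f] c(1)] by (simp add: open_Times)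
  have "(f \<circ> chart_inv ?c has_derivative frechet_derivative (f \<circ> chart_inv ?c) (at (snd ?c p))) (at (fst (snd ?c p, u)))"
    using smooth_fun_diff_at[OF f c p] by simp
  from has_derivative_compose[OF has_derivative_fst[OF has_derivative_ident] this]
  have "((\<lambda>z. (f \<circ> chart_inv ?c) (fst z)) has_derivative
      (\<lambda>z. frechet_derivative (f \<circ> chart_inv ?c) (at (snd ?c p)) (fst z))) (at (snd ?c p, u))" .
  then have "((\<lambda>q. f (fst q)) \<circ> chart_inv (tangent_chart M ?c) has_derivative
      (\<lambda>z. frechet_derivative (f \<circ> chart_inv ?c) (at (snd ?c p)) (fst z))) (at (snd ?c p, u))"
    by (rule has_derivative_transform_within_open[OF _ o])
      (use c p in \<open>auto simp: tangent_chart_inv\<close>)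
  from frechet_derivative_eqI[OF this] show ?thesis using pM by (simp add: dir_deriv_def)
qed

end

section \<open>The Bismut connection on lifts\<close>

lemma lie_bracket_antisym: "lie_bracket M X Y p = - lie_bracket M Y X p"
  by (simp add: lie_bracket_def Let_def)

lemma levi_civita_koszul:
  assumes lc: "levi_civita N h L" and b: "bilinear (h q)" and s: "\<And>v w. h q v w = h q w v"
    and A: "smooth_vf N U A" and C: "smooth_vf N U C" and E: "smooth_vf N U E" and q: "q \<in> U"
  shows "2 * h q (L A C q) (E q) =
    dir_deriv N A (\<lambda>q. h q (C q) (E q)) q + dir_deriv N C (\<lambda>q. h q (A q) (E q)) q -
    dir_deriv N E (\<lambda>q. h q (A q) (C q)) q + h q (lie_bracket N A C q) (E q) -
    h q (lie_bracket N A E q) (C q) - h q (lie_bracket N C E q) (A q)"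
proof -
  note m = lc[unfolded levi_civita_def, THEN conjunct2, THEN conjunct2, rule_format]
  note t = lc[unfolded levi_civita_def torsion_free_def, THEN conjunct2, THEN conjunct1, rule_format]
  show ?thesis
    unfolding m[OF A C E q] m[OF C A E q] m[OF E A C q]
      t[OF A C q, symmetric] t[OF A E q, symmetric] t[OF C E q, symmetric] bilinear_lsub[OF b]
    using s[of "L A E q" "C q"] s[of "L C E q" "A q"] s[of "L E A q" "C q"] s[of "L E C q" "A q"] by simp
qed

text \<open>Cyclic invariance leaves only the number of vertical arguments to distinguish, so four
  patterns of lifts cover all eight.\<close>

lemma ext_deriv2_cyclic: "ext_deriv2 N \<omega> X Y Z p = ext_deriv2 N \<omega> Y Z X p"
  by (simp add: ext_deriv2_def)

text \<open>Applying \<open>J\<close> to a lift gives a lift again only over the open set where the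
  base field is smooth, while \<open>ext_deriv2\<close> takes total functions.\<close>

lemma (in atlas_manifold) ext_deriv2_cong:
  assumes U: "openin (mfd_topology M) U" "q \<in> U"
    and e: "\<And>q. q \<in> U \<Longrightarrow> A q = A' q" "\<And>q. q \<in> U \<Longrightarrow> C q = C' q" "\<And>q. q \<in> U \<Longrightarrow> E q = E' q"
  shows "ext_deriv2 M \<omega> A C E q = ext_deriv2 M \<omega> A' C' E' q"
proof -
  have "dir_deriv M A (\<lambda>q. \<omega> q (C q) (E q)) q = dir_deriv M A' (\<lambda>q. \<omega> q (C' q) (E' q)) q"
    "dir_deriv M C (\<lambda>q. \<omega> q (E q) (A q)) q = dir_deriv M C' (\<lambda>q. \<omega> q (E' q) (A' q)) q"
    "dir_deriv M E (\<lambda>q. \<omega> q (A q) (C q)) q = dir_deriv M E' (\<lambda>q. \<omega> q (A' q) (C' q)) q"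
    by (rule dir_deriv_cong[OF U]; simp add: e U(2))+
  moreover have "lie_bracket M A C q = lie_bracket M A' C' q" "lie_bracket M C E q = lie_bracket M C' E' q"
    "lie_bracket M E A q = lie_bracket M E' A' q"
    by (rule lie_bracket_cong[OF U]; simp add: e)+
  ultimately show ?thesis by (simp add: ext_deriv2_def e U(2))
qed

locale bismut_manifold = affine_riemann_manifold M nabla g D
  for M :: "('a, 'e::euclidean_space) mfd" and nabla g D +
  fixes B :: "('a \<times> 'e \<Rightarrow> 'e \<times> 'e) \<Rightarrow> ('a \<times> 'e \<Rightarrow> 'e \<times> 'e) \<Rightarrow> 'a \<times> 'e \<Rightarrow> 'e \<times> 'e"
  assumes bismut: "bismut_connection (tangent_bundle M) (canonical_J M nabla) (canonical_g M nabla g) B"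
begin

sublocale B: connection_manifold "tangent_bundle M" B
  by unfold_locales (use bismut in \<open>simp add: bismut_connection_def\<close>)

abbreviation "H \<equiv> hlift M nabla"
abbreviation "V \<equiv> vlift M"
abbreviation "TB \<equiv> tangent_bundle M"
abbreviation "G \<equiv> canonical_g M nabla g"
abbreviation "J \<equiv> canonical_J M nabla"
abbreviation "\<omega> \<equiv> fundamental_form (canonical_J M nabla) (canonical_g M nabla g)"
abbreviation "hv \<equiv> hvec M nabla"

lemma in_points: "smooth_vf M S X \<Longrightarrow> p \<in> S \<Longrightarrow> p \<in> points M"
  using smooth_vf_openin openin_subset_points by blast

lemma hv_simps:
  assumes "p \<in> points M"
  shows "hv (p, u) (a + b) = hv (p, u) a + hv (p, u) b" "hv (p, u) (a - b) = hv (p, u) a - hv (p, u) b"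
    "hv (p, u) (- a) = - hv (p, u) a" "hv (p, u) 0 = 0"
  using hvec_linear[OF assms] by (simp_all add: linear_add linear_diff linear_neg linear_0)

text \<open>On lifts, \<open>G\<close> and \<open>\<omega>\<close> are pulled back from the base, so
  horizontal lifts differentiate them as the base fields do and vertical lifts annihilate
  them.\<close>

lemma dir_deriv_lift:
  assumes f: "smooth_fun M S f" and X: "smooth_vf M S X" and p: "p \<in> S" and F: "\<And>p u. p \<in> S \<Longrightarrow> F (p, u) = f p"
  shows "dir_deriv TB (H X) F (p, u) = dir_deriv M X f p" "dir_deriv TB (V X) F (p, u) = 0"
proof -
  have o: "openin (mfd_topology TB) (S \<times> UNIV)" by (rule openin_tangent_bundle[OF smooth_vf_openin[OF X]])
  have e: "dir_deriv TB A F (p, u) =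
      frechet_derivative (f \<circ> chart_inv (chart_at M p)) (at (snd (chart_at M p) p)) (fst (A (p, u)))" for A
    using TM.dir_deriv_cong[OF o, of "(p, u)" F "\<lambda>q. f (fst q)" A A] F p dir_deriv_pullback[OF f p] by auto
  have l: "linear (frechet_derivative (f \<circ> chart_inv (chart_at M p)) (at (snd (chart_at M p) p)))"
    using has_derivative_linear[OF smooth_fun_diff_at[OF f chart_at p]] in_points[OF X p] by simp
  show "dir_deriv TB (H X) F (p, u) = dir_deriv M X f p" "dir_deriv TB (V X) F (p, u) = 0"
    using in_points[OF X p] by (simp_all add: e hlift_at[OF X p] vlift_at dir_deriv_def[of M] linear_0[OF l])
qed

lemma J1_fields:
  assumes "smooth_vf M S X" "p \<in> S"
  shows "J (p, u) (H X (p, u)) = V X (p, u)" "J (p, u) (V X (p, u)) = H (\<lambda>p. - X p) (p, u)"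
  using in_points[OF assms] assms hlift_eq_hvec[OF smooth_vf_minus[OF assms(1)] assms(2)]
  by (simp_all add: hlift_eq_hvec vlift_at J1_lift)

lemma lift_values:
  assumes "smooth_vf M S X" "p \<in> S"
  shows "H X (p, u) = hv (p, u) (X p)" "V X (p, u) = (0, X p)"
  using in_points[OF assms] assms by (simp_all add: hlift_eq_hvec vlift_at)

lemma omega_lift:
  assumes "p \<in> points M"
  shows "\<omega> (p, u) (hv (p, u) a) (hv (p, u) b) = 0" "\<omega> (p, u) (hv (p, u) a) (0, b) = g p a b"
    "\<omega> (p, u) (0, a) (hv (p, u) b) = - g p a b" "\<omega> (p, u) (0, a) (0, b) = 0"
  using assms by (simp_all add: fundamental_form_def J1_lift g1_lift g_simps)

context
  fixes S X Y p and u :: 'e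
  assumes X: "smooth_vf M S X" and Y: "smooth_vf M S Y" and p: "p \<in> S"
begin

lemma bracket_lifts:
  "lie_bracket TB (H X) (H Y) (p, u) = hv (p, u) (D X Y p - D Y X p)"
  "lie_bracket TB (H X) (V Y) (p, u) = (0, D X Y p - gam p (X p) (Y p))"
  "lie_bracket TB (V X) (H Y) (p, u) = (0, gam p (Y p) (X p) - D Y X p)"
  "lie_bracket TB (V X) (V Y) (p, u) = (0, 0)"
proof -
  have pM: "p \<in> points M" using in_points[OF X p] .
  show "lie_bracket TB (H X) (H Y) (p, u) = hv (p, u) (D X Y p - D Y X p)"
    using bracket_hlift_hlift[OF X Y p] hlift_eq_hvec[OF bracket_smooth[OF X Y] p] D_bracket[OF X Y p] by simp
  show "lie_bracket TB (H X) (V Y) (p, u) = (0, D X Y p - gam p (X p) (Y p))"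
    using bracket_hlift_vlift[OF X Y p] nabla_eq[OF X Y p] pM by (simp add: vlift_at)
  show "lie_bracket TB (V X) (H Y) (p, u) = (0, gam p (Y p) (X p) - D Y X p)"
    using bracket_hlift_vlift[OF Y X p] nabla_eq[OF Y X p] pM lie_bracket_antisym[of TB "V X" "H Y"]
    by (simp add: vlift_at)
  show "lie_bracket TB (V X) (V Y) (p, u) = (0, 0)"
    using bracket_vlift_vlift[OF X Y p] by (simp add: zero_prod_def)
qed

end

context
  fixes S X Y Z p and u :: 'e
  assumes X: "smooth_vf M S X" and Y: "smooth_vf M S Y" and Z: "smooth_vf M S Z" and p: "p \<in> S"
begin

lemma dir_deriv_g1:
  "dir_deriv TB (H X) (\<lambda>q. G q (H Y q) (H Z q)) (p, u) = g p (D X Y p) (Z p) + g p (Y p) (D X Z p)"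
  "dir_deriv TB (H X) (\<lambda>q. G q (H Y q) (V Z q)) (p, u) = 0"
  "dir_deriv TB (H X) (\<lambda>q. G q (V Y q) (H Z q)) (p, u) = 0"
  "dir_deriv TB (H X) (\<lambda>q. G q (V Y q) (V Z q)) (p, u) = g p (D X Y p) (Z p) + g p (Y p) (D X Z p)"
  "dir_deriv TB (V X) (\<lambda>q. G q (H Y q) (H Z q)) (p, u) = 0"
  "dir_deriv TB (V X) (\<lambda>q. G q (H Y q) (V Z q)) (p, u) = 0"
  "dir_deriv TB (V X) (\<lambda>q. G q (V Y q) (H Z q)) (p, u) = 0"
  "dir_deriv TB (V X) (\<lambda>q. G q (V Y q) (V Z q)) (p, u) = 0"
proof -
  note f = g_smooth[OF Y Z] and z = smooth_fun_const[OF smooth_vf_openin[OF X], of 0]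
  have v: "G (p, u) (H Y (p, u)) (H Z (p, u)) = g p (Y p) (Z p)" "G (p, u) (H Y (p, u)) (V Z (p, u)) = 0"
    "G (p, u) (V Y (p, u)) (H Z (p, u)) = 0" "G (p, u) (V Y (p, u)) (V Z (p, u)) = g p (Y p) (Z p)"
    if "p \<in> S" for p u
    using in_points[OF X that] by (simp_all add: lift_values[OF Y that] lift_values[OF Z that] g1_lift)
  show "dir_deriv TB (H X) (\<lambda>q. G q (H Y q) (H Z q)) (p, u) = g p (D X Y p) (Z p) + g p (Y p) (D X Z p)"
    "dir_deriv TB (H X) (\<lambda>q. G q (V Y q) (V Z q)) (p, u) = g p (D X Y p) (Z p) + g p (Y p) (D X Z p)"
    using dir_deriv_lift(1)[OF f X p] v D_metric[OF X Y Z p] by auto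
  show "dir_deriv TB (H X) (\<lambda>q. G q (H Y q) (V Z q)) (p, u) = 0"
    "dir_deriv TB (H X) (\<lambda>q. G q (V Y q) (H Z q)) (p, u) = 0"
    using dir_deriv_lift(1)[OF z X p] v dir_deriv_const by auto
  show "dir_deriv TB (V X) (\<lambda>q. G q (H Y q) (H Z q)) (p, u) = 0"
    "dir_deriv TB (V X) (\<lambda>q. G q (V Y q) (V Z q)) (p, u) = 0"
    using dir_deriv_lift(2)[OF f X p] v by auto
  show "dir_deriv TB (V X) (\<lambda>q. G q (H Y q) (V Z q)) (p, u) = 0"
    "dir_deriv TB (V X) (\<lambda>q. G q (V Y q) (H Z q)) (p, u) = 0"
    using dir_deriv_lift(2)[OF z X p] v by auto
qed

lemma dir_deriv_omega:
  "dir_deriv TB (H X) (\<lambda>q. \<omega> q (H Y q) (H Z q)) (p, u) = 0"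
  "dir_deriv TB (H X) (\<lambda>q. \<omega> q (H Y q) (V Z q)) (p, u) = g p (D X Y p) (Z p) + g p (Y p) (D X Z p)"
  "dir_deriv TB (H X) (\<lambda>q. \<omega> q (V Y q) (H Z q)) (p, u) = - g p (D X Y p) (Z p) - g p (Y p) (D X Z p)"
  "dir_deriv TB (H X) (\<lambda>q. \<omega> q (V Y q) (V Z q)) (p, u) = 0"
  "dir_deriv TB (V X) (\<lambda>q. \<omega> q (H Y q) (H Z q)) (p, u) = 0"
  "dir_deriv TB (V X) (\<lambda>q. \<omega> q (H Y q) (V Z q)) (p, u) = 0"
  "dir_deriv TB (V X) (\<lambda>q. \<omega> q (V Y q) (H Z q)) (p, u) = 0"
  "dir_deriv TB (V X) (\<lambda>q. \<omega> q (V Y q) (V Z q)) (p, u) = 0"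
proof -
  note f = g_smooth[OF Y Z] and z = smooth_fun_const[OF smooth_vf_openin[OF X], of 0]
  have m: "smooth_fun M S (\<lambda>p. - g p (Y p) (Z p))"
    by (rule smooth_fun_cong[OF g_smooth[OF smooth_vf_minus[OF Y] Z]])
      (use in_points[OF X] in \<open>auto simp: g_simps\<close>)
  have v: "\<omega> (p, u) (H Y (p, u)) (H Z (p, u)) = 0" "\<omega> (p, u) (H Y (p, u)) (V Z (p, u)) = g p (Y p) (Z p)"
    "\<omega> (p, u) (V Y (p, u)) (H Z (p, u)) = - g p (Y p) (Z p)" "\<omega> (p, u) (V Y (p, u)) (V Z (p, u)) = 0"
    if "p \<in> S" for p u
    using in_points[OF X that] by (simp_all add: lift_values[OF Y that] lift_values[OF Z that] omega_lift)
  show "dir_deriv TB (H X) (\<lambda>q. \<omega> q (H Y q) (V Z q)) (p, u) = g p (D X Y p) (Z p) + g p (Y p) (D X Z p)"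
    using dir_deriv_lift(1)[OF f X p] v D_metric[OF X Y Z p] by auto
  show "dir_deriv TB (H X) (\<lambda>q. \<omega> q (V Y q) (H Z q)) (p, u) = - g p (D X Y p) (Z p) - g p (Y p) (D X Z p)"
    using dir_deriv_lift(1)[OF m X p] v D_metric[OF X Y Z p] dir_deriv_minus[OF f p, of X] by auto
  show "dir_deriv TB (H X) (\<lambda>q. \<omega> q (H Y q) (H Z q)) (p, u) = 0"
    "dir_deriv TB (H X) (\<lambda>q. \<omega> q (V Y q) (V Z q)) (p, u) = 0"
    using dir_deriv_lift(1)[OF z X p] v dir_deriv_const by auto
  show "dir_deriv TB (V X) (\<lambda>q. \<omega> q (H Y q) (H Z q)) (p, u) = 0"
    "dir_deriv TB (V X) (\<lambda>q. \<omega> q (V Y q) (V Z q)) (p, u) = 0"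
    using dir_deriv_lift(2)[OF z X p] v by auto
  show "dir_deriv TB (V X) (\<lambda>q. \<omega> q (H Y q) (V Z q)) (p, u) = 0"
    using dir_deriv_lift(2)[OF f X p] v by auto
  show "dir_deriv TB (V X) (\<lambda>q. \<omega> q (V Y q) (H Z q)) (p, u) = 0"
    using dir_deriv_lift(2)[OF m X p] v by auto
qed

end

text \<open>The form pairs only horizontal with vertical vectors; brackets of two horizontal lifts
  are horizontal and all other brackets are vertical, so three of the patterns vanish term by term.
  In the remaining one the \<open>D\<close>-terms cancel, and \<gamma> survives because the bracket
  of a horizontal with a vertical lift contains \<nabla> instead of \<open>D\<close>.\<close>

lemma ext_deriv2_lifts:
  assumes X: "smooth_vf M S X" and Y: "smooth_vf M S Y" and Z: "smooth_vf M S Z" and p: "p \<in> S"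
  shows "ext_deriv2 TB \<omega> (H X) (H Y) (H Z) (p, u) = 0"
    "ext_deriv2 TB \<omega> (H X) (H Y) (V Z) (p, u) = g p (Y p) (gam p (X p) (Z p)) - g p (X p) (gam p (Y p) (Z p))"
    "ext_deriv2 TB \<omega> (H X) (V Y) (V Z) (p, u) = 0"
    "ext_deriv2 TB \<omega> (V X) (V Y) (V Z) (p, u) = 0"
proof -
  have pM: "p \<in> points M" using in_points[OF X p] .
  note dd = dir_deriv_omega[OF X Y Z p] dir_deriv_omega[OF Y Z X p] dir_deriv_omega[OF Z X Y p]
    bracket_lifts[OF X Y p] bracket_lifts[OF Y Z p] bracket_lifts[OF Z X p]
    lift_values[OF X p] lift_values[OF Y p] lift_values[OF Z p] omega_lift[OF pM]
  show "ext_deriv2 TB \<omega> (H X) (H Y) (H Z) (p, u) = 0"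
    "ext_deriv2 TB \<omega> (V X) (V Y) (V Z) (p, u) = 0"
    "ext_deriv2 TB \<omega> (H X) (V Y) (V Z) (p, u) = 0"
    unfolding ext_deriv2_def dd by (simp_all add: g_simps[OF pM])
  show "ext_deriv2 TB \<omega> (H X) (H Y) (V Z) (p, u) = g p (Y p) (gam p (X p) (Z p)) - g p (X p) (gam p (Y p) (Z p))"
    unfolding ext_deriv2_def dd
    using g_sym[OF pM, of "gam p (X p) (Z p)" "Y p"] g_sym[OF pM, of "gam p (Y p) (Z p)" "X p"]
      g_sym[OF pM, of "D X Z p" "Y p"] g_sym[OF pM, of "D Y Z p" "X p"] g_sym[OF pM, of "D Y X p" "Z p"]
      g_sym[OF pM, of "D X Y p" "Z p"]
    by (simp add: g_simps[OF pM])
qed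

section \<open>The Koszul formula for the Bismut connection\<close>

text \<open>Eliminates the Levi-Civita connection of \<open>G\<close>, which is known only to exist;
  the factor 2 absorbs the 1/2 in front of the torsion term.\<close>

lemma bismut_koszul:
  assumes A: "smooth_vf TB U A" and C: "smooth_vf TB U C" and E: "smooth_vf TB U E" and q: "(p, u) \<in> U"
  shows "2 * G (p, u) (B A C (p, u)) (E (p, u)) =
    dir_deriv TB A (\<lambda>q. G q (C q) (E q)) (p, u) + dir_deriv TB C (\<lambda>q. G q (A q) (E q)) (p, u) -
    dir_deriv TB E (\<lambda>q. G q (A q) (C q)) (p, u) + G (p, u) (lie_bracket TB A C (p, u)) (E (p, u)) -
    G (p, u) (lie_bracket TB A E (p, u)) (C (p, u)) - G (p, u) (lie_bracket TB C E (p, u)) (A (p, u)) +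
    ext_deriv2 TB \<omega> (\<lambda>q. J q (A q)) (\<lambda>q. J q (C q)) (\<lambda>q. J q (E q)) (p, u)"
proof -
  obtain L where L: "levi_civita TB G L" and BL:
    "\<forall>S X Y Z. smooth_vf TB S X \<longrightarrow> smooth_vf TB S Y \<longrightarrow> smooth_vf TB S Z \<longrightarrow>
       (\<forall>p\<in>S. G p (B X Y p) (Z p) = G p (L X Y p) (Z p) +
         1/2 * ext_deriv2 TB \<omega> (\<lambda>q. J q (X q)) (\<lambda>q. J q (Y q)) (\<lambda>q. J q (Z q)) p)"
    using bismut unfolding bismut_connection_def by blast
  have pM: "p \<in> points M" using TM.openin_subset_points[OF TM.smooth_vf_openin[OF A]] q by auto
  show ?thesis
    using BL[rule_format, OF A C E q] levi_civita_koszul[OF L g1_bilinear[OF pM] g1_sym[OF pM] A C E q] by simp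
qed

text \<open>\<open>J\<close> exchanges the two kinds of lifts, so the torsion term can be non-zero
  only when two of the three arguments are vertical, and the two signs from \<open>J\<close> on
  vertical lifts then cancel. If \<open>X\<close> is lifted horizontally, it removes both
  \<gamma>-terms of the Koszul expression; if vertically, it cancels one and doubles the
  other.\<close>

lemma bismut_lift_products:
  assumes X: "smooth_vf M S X" and Y: "smooth_vf M S Y" and Z: "smooth_vf M S Z" and p: "p \<in> S"
  shows "G (p, u) (B (H X) (H Y) (p, u)) (H Z (p, u)) = g p (D X Y p) (Z p)"
    "G (p, u) (B (H X) (H Y) (p, u)) (V Z (p, u)) = 0"
    "G (p, u) (B (H X) (V Y) (p, u)) (H Z (p, u)) = 0"
    "G (p, u) (B (H X) (V Y) (p, u)) (V Z (p, u)) = g p (D X Y p) (Z p)"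
    "G (p, u) (B (V X) (H Y) (p, u)) (H Z (p, u)) = 0"
    "G (p, u) (B (V X) (H Y) (p, u)) (V Z (p, u)) = g p (X p) (gam p (Y p) (Z p))"
    "G (p, u) (B (V X) (V Y) (p, u)) (H Z (p, u)) = - g p (X p) (gam p (Y p) (Z p))"
    "G (p, u) (B (V X) (V Y) (p, u)) (V Z (p, u)) = 0"
proof -
  have pM: "p \<in> points M" using in_points[OF X p] .
  let ?U = "S \<times> (UNIV :: 'e set)"
  have q: "(p, u) \<in> ?U" using p by simp
  note o = openin_tangent_bundle[OF smooth_vf_openin[OF X]]
  note HX = smooth_vf_hlift[OF X] and HY = smooth_vf_hlift[OF Y] and HZ = smooth_vf_hlift[OF Z]
    and VX = smooth_vf_vlift[OF X] and VY = smooth_vf_vlift[OF Y] and VZ = smooth_vf_vlift[OF Z]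
  note X' = smooth_vf_minus[OF X] and Y' = smooth_vf_minus[OF Y] and Z' = smooth_vf_minus[OF Z]
  have JH: "J q (H W q) = V W q" and JV: "J q (V W q) = H (\<lambda>p. - W p) q"
    if "smooth_vf M S W" "q \<in> ?U" for W q
    using that J1_fields[OF that(1)] by auto
  note J = JH[OF X] JH[OF Y] JH[OF Z] JV[OF X] JV[OF Y] JV[OF Z]
  note gb = bilinear_lneg[OF gam_bilinear[OF pM]] bilinear_rneg[OF gam_bilinear[OF pM]]
  have d1: "ext_deriv2 TB \<omega> (\<lambda>q. J q (H X q)) (\<lambda>q. J q (H Y q)) (\<lambda>q. J q (H Z q)) (p, u) = 0"
    by (rule trans[OF TM.ext_deriv2_cong[OF o q J(1-3)] ext_deriv2_lifts(4)[OF X Y Z p]])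
  have d2: "ext_deriv2 TB \<omega> (\<lambda>q. J q (H X q)) (\<lambda>q. J q (H Y q)) (\<lambda>q. J q (V Z q)) (p, u) = 0"
    using TM.ext_deriv2_cong[OF o q J(1,2,6), where \<omega> = \<omega>] ext_deriv2_lifts(3)[OF Z' X Y p]
      ext_deriv2_cyclic[of TB \<omega> "H (\<lambda>p. - Z p)"] by simp
  have d3: "ext_deriv2 TB \<omega> (\<lambda>q. J q (H X q)) (\<lambda>q. J q (V Y q)) (\<lambda>q. J q (H Z q)) (p, u) = 0"
    using TM.ext_deriv2_cong[OF o q J(1,5,3), where \<omega> = \<omega>] ext_deriv2_lifts(3)[OF Y' Z X p]
      ext_deriv2_cyclic[of TB \<omega> "V X"] by simp
  have d4: "ext_deriv2 TB \<omega> (\<lambda>q. J q (H X q)) (\<lambda>q. J q (V Y q)) (\<lambda>q. J q (V Z q)) (p, u) =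
      g p (Z p) (gam p (Y p) (X p)) - g p (Y p) (gam p (Z p) (X p))"
    using TM.ext_deriv2_cong[OF o q J(1,5,6), where \<omega> = \<omega>] ext_deriv2_lifts(2)[OF Y' Z' X p]
      ext_deriv2_cyclic[of TB \<omega> "V X"] by (simp add: gb g_simps[OF pM])
  have d5: "ext_deriv2 TB \<omega> (\<lambda>q. J q (V X q)) (\<lambda>q. J q (H Y q)) (\<lambda>q. J q (H Z q)) (p, u) = 0"
    using TM.ext_deriv2_cong[OF o q J(4,2,3), where \<omega> = \<omega>] ext_deriv2_lifts(3)[OF X' Y Z p] by simp
  have d6: "ext_deriv2 TB \<omega> (\<lambda>q. J q (V X q)) (\<lambda>q. J q (H Y q)) (\<lambda>q. J q (V Z q)) (p, u) =
      g p (X p) (gam p (Z p) (Y p)) - g p (Z p) (gam p (X p) (Y p))"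
    using TM.ext_deriv2_cong[OF o q J(4,2,6), where \<omega> = \<omega>] ext_deriv2_lifts(2)[OF Z' X' Y p]
      ext_deriv2_cyclic[of TB \<omega> "H (\<lambda>p. - Z p)"] by (simp add: gb g_simps[OF pM])
  have d7: "ext_deriv2 TB \<omega> (\<lambda>q. J q (V X q)) (\<lambda>q. J q (V Y q)) (\<lambda>q. J q (H Z q)) (p, u) =
      g p (Y p) (gam p (X p) (Z p)) - g p (X p) (gam p (Y p) (Z p))"
    using TM.ext_deriv2_cong[OF o q J(4,5,3), where \<omega> = \<omega>] ext_deriv2_lifts(2)[OF X' Y' Z p]
    by (simp add: gb g_simps[OF pM])
  have d8: "ext_deriv2 TB \<omega> (\<lambda>q. J q (V X q)) (\<lambda>q. J q (V Y q)) (\<lambda>q. J q (V Z q)) (p, u) = 0"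
    by (rule trans[OF TM.ext_deriv2_cong[OF o q J(4-6)] ext_deriv2_lifts(1)[OF X' Y' Z' p]])
  note dd = dir_deriv_g1[OF X Y Z p] dir_deriv_g1[OF Y X Z p] dir_deriv_g1[OF Z X Y p]
    bracket_lifts[OF X Y p] bracket_lifts[OF Y Z p] bracket_lifts[OF X Z p]
    d1 d2 d3 d4 d5 d6 d7 d8
  note vals = lift_values[OF X p] lift_values[OF Y p] lift_values[OF Z p] g1_lift[OF pM] g_simps[OF pM]
  note sy = g_sym[OF pM, of "D X Y p" "Z p"] g_sym[OF pM, of "D Y X p" "Z p"] g_sym[OF pM, of "D X Z p" "Y p"]
    g_sym[OF pM, of "D Z X p" "Y p"] g_sym[OF pM, of "D Y Z p" "X p"] g_sym[OF pM, of "D Z Y p" "X p"]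
    g_sym[OF pM, of "gam p (X p) (Y p)" "Z p"] g_sym[OF pM, of "gam p (X p) (Z p)" "Y p"]
    g_sym[OF pM, of "gam p (Y p) (Z p)" "X p"]
    gam_sym[OF pM, of "Y p" "X p"] gam_sym[OF pM, of "Z p" "X p"] gam_sym[OF pM, of "Z p" "Y p"]
  show "G (p, u) (B (H X) (H Y) (p, u)) (H Z (p, u)) = g p (D X Y p) (Z p)"
    using bismut_koszul[OF HX HY HZ q, unfolded dd] by (simp add: vals sy)
  show "G (p, u) (B (H X) (H Y) (p, u)) (V Z (p, u)) = 0"
    using bismut_koszul[OF HX HY VZ q, unfolded dd] by (simp add: vals sy)
  show "G (p, u) (B (H X) (V Y) (p, u)) (H Z (p, u)) = 0"
    using bismut_koszul[OF HX VY HZ q, unfolded dd] by (simp add: vals sy)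
  show "G (p, u) (B (H X) (V Y) (p, u)) (V Z (p, u)) = g p (D X Y p) (Z p)"
    using bismut_koszul[OF HX VY VZ q, unfolded dd] by (simp add: vals sy)
  show "G (p, u) (B (V X) (H Y) (p, u)) (H Z (p, u)) = 0"
    using bismut_koszul[OF VX HY HZ q, unfolded dd] by (simp add: vals sy)
  show "G (p, u) (B (V X) (H Y) (p, u)) (V Z (p, u)) = g p (X p) (gam p (Y p) (Z p))"
    using bismut_koszul[OF VX HY VZ q, unfolded dd] by (simp add: vals sy)
  show "G (p, u) (B (V X) (V Y) (p, u)) (H Z (p, u)) = - g p (X p) (gam p (Y p) (Z p))"
    using bismut_koszul[OF VX VY HZ q, unfolded dd] by (simp add: vals sy)
  show "G (p, u) (B (V X) (V Y) (p, u)) (V Z (p, u)) = 0"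
    using bismut_koszul[OF VX VY VZ q, unfolded dd] by (simp add: vals sy)
qed

text \<open>Lifts of coordinate fields through every \<open>z\<close> serve as test vectors, so the
  eight products determine the four values.\<close>

lemma bismut_lifts:
  assumes X: "smooth_vf M S X" and Y: "smooth_vf M S Y" and p: "p \<in> S"
  shows "B (H X) (H Y) (p, u) = hv (p, u) (D X Y p)"
    "B (H X) (V Y) (p, u) = (0, D X Y p)"
    "B (V X) (H Y) (p, u) = (0, gs p (Y p) (X p))"
    "B (V X) (V Y) (p, u) = - hv (p, u) (gs p (Y p) (X p))"
proof -
  let ?c = "chart_at M p"
  have pM: "p \<in> points M" using in_points[OF X p] .
  note c = chart_at[OF pM]
  have pT: "p \<in> S \<inter> fst ?c" using c p by auto
  note X' = smooth_vf_chart_Int(1)[OF X c(1)] and Y' = smooth_vf_chart_Int(1)[OF Y c(1)]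
    and e = smooth_vf_chart_Int(2)[OF X c(1)]
  have v: "H (coord_field M ?c z) (p, u) = hv (p, u) z" "V (coord_field M ?c z) (p, u) = (0, z)" for z
    using lift_values[OF e pT] pM by simp_all
  note k = bismut_lift_products[OF X' Y' e pT, where u = u, unfolded v coord_field_chart_at[OF pM]]
  have "B (H X) (H Y) (p, u) = hv (p, u) (D X Y p) + (0, 0)"
    by (rule g1_eqI[OF pM]) (simp_all add: k g_simps[OF pM])
  moreover have "B (H X) (V Y) (p, u) = hv (p, u) 0 + (0, D X Y p)"
    by (rule g1_eqI[OF pM]) (simp_all add: k g_simps[OF pM])
  moreover have "B (V X) (H Y) (p, u) = hv (p, u) 0 + (0, gs p (Y p) (X p))"
    by (rule g1_eqI[OF pM]) (simp_all add: k g_simps[OF pM] gs[OF pM])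
  moreover have "B (V X) (V Y) (p, u) = hv (p, u) (- gs p (Y p) (X p)) + (0, 0)"
    by (rule g1_eqI[OF pM]) (simp_all add: k g_simps[OF pM] gs[OF pM])
  ultimately show "B (H X) (H Y) (p, u) = hv (p, u) (D X Y p)" "B (H X) (V Y) (p, u) = (0, D X Y p)"
    "B (V X) (H Y) (p, u) = (0, gs p (Y p) (X p))" "B (V X) (V Y) (p, u) = - hv (p, u) (gs p (Y p) (X p))"
    by (simp_all add: hv_simps[OF pM] flip: zero_prod_def)
qed

end

section \<open>Curvature of the Bismut connection\<close>

context bismut_manifold
begin

text \<open>
  The smoothness of \<open>\<gamma>\<^sup>*\<close> is inherited from that of \<open>\<nabla>\<^sup>B\<close>, because \<open>\<gamma>\<^sup>*\<^sub>Y X\<close> is minus the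
  horizontal part of \<open>\<nabla>\<^sup>B\<close> on vertical lifts; this avoids inverting the metric.
\<close>

lemma gs_smooth:
  assumes X: "smooth_vf M S X" and Y: "smooth_vf M S Y"
  shows "smooth_vf M S (\<lambda>p. gs p (Y p) (X p))"
proof -
  have "smooth_vf TB (S \<times> UNIV) (B (V X) (V Y))"
    by (intro B.conn_smooth smooth_vf_vlift X Y)
  from smooth_vf_minus[OF smooth_vf_fst[OF this smooth_vf_openin[OF X]]] show ?thesis
    by (rule smooth_vf_cong) (use in_points[OF X] in \<open>simp add: bismut_lifts[OF X Y] hvec_eq\<close>)
qed

text \<open>Iterating the connection requires its inner value to be a smooth lift again, as an
  identity of fields over \<open>S \<times> UNIV\<close> and not only at one point.\<close>

lemma bismut_lift_fields:
  assumes X: "smooth_vf M S X" and Y: "smooth_vf M S Y" and q: "q \<in> S \<times> UNIV"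
  shows "H (D X Y) q = B (H X) (H Y) q" "V (D X Y) q = B (H X) (V Y) q"
    "V (\<lambda>p. gs p (Y p) (X p)) q = B (V X) (H Y) q" "H (\<lambda>p. - gs p (Y p) (X p)) q = B (V X) (V Y) q"
  using q in_points[OF X] bismut_lifts[OF X Y]
    lift_values[OF D.conn_smooth[OF X Y]] lift_values[OF gs_smooth[OF X Y]]
    lift_values[OF smooth_vf_minus[OF gs_smooth[OF X Y]]] hv_simps
  by auto

lemma bismut_bracket_fields:
  assumes X: "smooth_vf M S X" and Y: "smooth_vf M S Y" and q: "q \<in> S \<times> UNIV"
  shows "H (lie_bracket M X Y) q = lie_bracket TB (H X) (H Y) q"
    "V (nabla X Y) q = lie_bracket TB (H X) (V Y) q"
    "0 = lie_bracket TB (V X) (V Y) q"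
  using q bracket_hlift_hlift[OF X Y] bracket_hlift_vlift[OF X Y] bracket_vlift_vlift[OF X Y] by auto

text \<open>By locality the inner derivatives and the brackets may be replaced by the lifts with
  which they agree. The mixed cases still contain \<nabla> from the bracket next to \<open>D\<close>
  from the connection; they are brought into tensorial form only when \<nabla> is replaced by
  \<open>D\<close> minus \<gamma>.\<close>

lemma bismut_curvature_lifts:
  assumes X: "smooth_vf M S X" and Y: "smooth_vf M S Y" and Z: "smooth_vf M S Z" and p: "p \<in> S"
  shows "curvature TB B (H X) (H Y) (H Z) (p, u) = hv (p, u) (curvature M D X Y Z p)"
    "curvature TB B (H X) (H Y) (V Z) (p, u) = (0, curvature M D X Y Z p)"
    "curvature TB B (V X) (V Y) (V Z) (p, u) =
      (0, gs p (gs p (Z p) (Y p)) (X p) - gs p (gs p (Z p) (X p)) (Y p))"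
    "curvature TB B (V X) (V Y) (H Z) (p, u) =
      hv (p, u) (gs p (gs p (Z p) (Y p)) (X p) - gs p (gs p (Z p) (X p)) (Y p))"
    "curvature TB B (H X) (V Y) (V Z) (p, u) =
      hv (p, u) (D X (\<lambda>p. gs p (Z p) (Y p)) p - gs p (D X Z p) (Y p) - gs p (Z p) (nabla X Y p))"
    "curvature TB B (H X) (V Y) (H Z) (p, u) =
      (0, - (D X (\<lambda>p. gs p (Z p) (Y p)) p - gs p (D X Z p) (Y p) - gs p (Z p) (nabla X Y p)))"
proof -
  have pM: "p \<in> points M" using in_points[OF X p] .
  let ?U = "S \<times> (UNIV :: 'e set)"
  have q: "(p, u) \<in> ?U" using p by simp
  note sm = smooth_vf_hlift smooth_vf_vlift
  note oU = openin_tangent_bundle[OF smooth_vf_openin[OF X]]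
  have right: "B A C (p, u) = B A C' (p, u)"
    if "smooth_vf TB ?U A" "smooth_vf TB ?U C'" "\<And>q. q \<in> ?U \<Longrightarrow> C' q = C q" for A C C'
    using B.conn_cong[OF that(1,2) q, of A C] that(3) by simp
  have left: "B A C (p, u) = B A' C (p, u)"
    if "smooth_vf TB ?U A'" "smooth_vf TB ?U C" "\<And>q. q \<in> ?U \<Longrightarrow> A' q = A q" for A A' C
    using B.conn_cong[OF that(1,2) q, of A C] that(3) by simp
  have zero: "B (lie_bracket TB (V X) (V Y)) C (p, u) = 0" if "smooth_vf TB ?U C" for C
    using left[OF TM.smooth_vf_zero[OF oU] that bismut_bracket_fields(3)[OF X Y]] B.conn_zero_left[OF that q] by simp
  have gb: "gs p (- a) b = - gs p a b" for a b using bilinear_lneg[OF gs_bilinear[OF pM]] .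
  note L = bracket_smooth[OF X Y] and N = conn_smooth[OF X Y]
  note XZ = D.conn_smooth[OF X Z] and YZ = D.conn_smooth[OF Y Z]
  note gXZ = gs_smooth[OF X Z] and gYZ = gs_smooth[OF Y Z]
  note mXZ = smooth_vf_minus[OF gXZ] and mYZ = smooth_vf_minus[OF gYZ]
  show "curvature TB B (H X) (H Y) (H Z) (p, u) = hv (p, u) (curvature M D X Y Z p)"
    unfolding curvature_def
    by (simp add:
      left[OF sm(1)[OF L] sm(1)[OF Z] bismut_bracket_fields(1)[OF X Y]]
      right[OF sm(1)[OF X] sm(1)[OF YZ] bismut_lift_fields(1)[OF Y Z]]
      right[OF sm(1)[OF Y] sm(1)[OF XZ] bismut_lift_fields(1)[OF X Z]]
      bismut_lifts(1)[OF L Z p] bismut_lifts(1)[OF X YZ p] bismut_lifts(1)[OF Y XZ p] hv_simps[OF pM])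
  show "curvature TB B (H X) (H Y) (V Z) (p, u) = (0, curvature M D X Y Z p)"
    unfolding curvature_def
    by (simp add:
      left[OF sm(1)[OF L] sm(2)[OF Z] bismut_bracket_fields(1)[OF X Y]]
      right[OF sm(1)[OF X] sm(2)[OF YZ] bismut_lift_fields(2)[OF Y Z]]
      right[OF sm(1)[OF Y] sm(2)[OF XZ] bismut_lift_fields(2)[OF X Z]]
      bismut_lifts(2)[OF L Z p] bismut_lifts(2)[OF X YZ p] bismut_lifts(2)[OF Y XZ p])
  show "curvature TB B (V X) (V Y) (V Z) (p, u) =
      (0, gs p (gs p (Z p) (Y p)) (X p) - gs p (gs p (Z p) (X p)) (Y p))"
    unfolding curvature_def
    by (simp add: zero[OF sm(2)[OF Z]]
      right[OF sm(2)[OF X] sm(1)[OF mYZ] bismut_lift_fields(4)[OF Y Z]]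
      right[OF sm(2)[OF Y] sm(1)[OF mXZ] bismut_lift_fields(4)[OF X Z]]
      bismut_lifts(3)[OF X mYZ p] bismut_lifts(3)[OF Y mXZ p] gb)
  show "curvature TB B (V X) (V Y) (H Z) (p, u) =
      hv (p, u) (gs p (gs p (Z p) (Y p)) (X p) - gs p (gs p (Z p) (X p)) (Y p))"
    unfolding curvature_def
    by (simp add: zero[OF sm(1)[OF Z]]
      right[OF sm(2)[OF X] sm(2)[OF gYZ] bismut_lift_fields(3)[OF Y Z]]
      right[OF sm(2)[OF Y] sm(2)[OF gXZ] bismut_lift_fields(3)[OF X Z]]
      bismut_lifts(4)[OF X gYZ p] bismut_lifts(4)[OF Y gXZ p] hv_simps[OF pM])
  show "curvature TB B (H X) (V Y) (V Z) (p, u) =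
      hv (p, u) (D X (\<lambda>p. gs p (Z p) (Y p)) p - gs p (D X Z p) (Y p) - gs p (Z p) (nabla X Y p))"
    unfolding curvature_def
    by (simp add:
      left[OF sm(2)[OF N] sm(2)[OF Z] bismut_bracket_fields(2)[OF X Y]]
      right[OF sm(1)[OF X] sm(1)[OF mYZ] bismut_lift_fields(4)[OF Y Z]]
      right[OF sm(2)[OF Y] sm(2)[OF XZ] bismut_lift_fields(2)[OF X Z]]
      bismut_lifts(4)[OF N Z p] bismut_lifts(1)[OF X mYZ p] bismut_lifts(4)[OF Y XZ p]
      D.conn_minus_right[OF X gYZ p] hv_simps[OF pM])
  show "curvature TB B (H X) (V Y) (H Z) (p, u) =
      (0, - (D X (\<lambda>p. gs p (Z p) (Y p)) p - gs p (D X Z p) (Y p) - gs p (Z p) (nabla X Y p)))"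
    unfolding curvature_def
    by (simp add:
      left[OF sm(2)[OF N] sm(1)[OF Z] bismut_bracket_fields(2)[OF X Y]]
      right[OF sm(1)[OF X] sm(2)[OF gYZ] bismut_lift_fields(3)[OF Y Z]]
      right[OF sm(2)[OF Y] sm(1)[OF XZ] bismut_lift_fields(1)[OF X Z]]
      bismut_lifts(3)[OF N Z p] bismut_lifts(2)[OF X gYZ p] bismut_lifts(3)[OF Y XZ p])
qed

end

section \<open>The Ricci form\<close>

text \<open>Orthonormality makes the vectors independent, hence spanning by their number. What the
  expansion misses is orthogonal to the span, thus to itself, and vanishes by positivity.\<close>

lemma orthonormal_expansion:
  fixes h :: "'f::euclidean_space \<Rightarrow> 'f \<Rightarrow> real" and e :: "nat \<Rightarrow> 'f"
  assumes b: "bilinear h" and pos: "\<And>v. v \<noteq> 0 \<Longrightarrow> h v v > 0"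
    and on: "\<And>i j. i < DIM('f) \<Longrightarrow> j < DIM('f) \<Longrightarrow> h (e i) (e j) = (if i = j then 1 else 0)"
  shows "w = (\<Sum>i<DIM('f). h w (e i) *\<^sub>R e i)"
proof -
  let ?n = "DIM('f)" and ?S = "e ` {..<DIM('f)}"
  have lin: "linear (\<lambda>v. h v z)" "linear (h v)" for v z using b by (auto simp: bilinear_def)
  have inj: "inj_on e {..<?n}"
    by (rule inj_onI) (metis on lessThan_iff zero_neq_one)
  have comb: "h (\<Sum>i<?n. c i *\<^sub>R e i) (e j) = c j" if "j < ?n" for c j
    using that by (simp add: linear_sum[OF lin(1)] linear_cmul[OF lin(1)] on if_distrib cong: if_cong)
  have ind: "independent ?S"
  proof
    assume "dependent ?S"
    then obtain c v where c: "v \<in> ?S" "c v \<noteq> 0" "(\<Sum>v\<in>?S. c v *\<^sub>R v) = 0"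
      using dependent_finite[of ?S] by auto
    obtain j where j: "j < ?n" "v = e j" using c(1) by auto
    have "(\<Sum>i<?n. c (e i) *\<^sub>R e i) = 0" using c(3) by (simp add: sum.reindex[OF inj])
    then show False using comb[OF j(1), of "\<lambda>i. c (e i)"] j c(2) linear_0[OF lin(1)] by simp
  qed
  have "card ?S = ?n" using inj by (simp add: card_image)
  then have span: "UNIV \<subseteq> span ?S"
    using card_ge_dim_independent[of ?S UNIV] ind by simp
  let ?w = "w - (\<Sum>i<?n. h w (e i) *\<^sub>R e i)"
  have "h ?w z = 0" if "z \<in> span ?S" for z
    using that
  proof (induction rule: span_induct_alt)
    case base
    then show ?case using linear_0[OF lin(2)] by simp
  next
    case (step c x y)
    then obtain j where "j < ?n" "x = e j" by auto
    then have "h ?w x = 0" using comb[of j "\<lambda>i. h w (e i)"] by (simp add: linear_diff[OF lin(1)])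
    then show ?case using step by (simp add: linear_add[OF lin(2)] linear_cmul[OF lin(2)])
  qed
  then have "h ?w ?w = 0" using span by auto
  then have "?w = 0" using pos[of ?w] by fastforce
  then show ?thesis by simp
qed

text \<open>Expanding the first slot over \<open>f\<close> in one trace and the second slot over
  \<open>e\<close> in the other gives the same double sum.\<close>

lemma trace_orthonormal_invariant:
  fixes h \<beta> :: "'f::euclidean_space \<Rightarrow> 'f \<Rightarrow> real" and e f :: "nat \<Rightarrow> 'f"
  assumes h: "bilinear h" and pos: "\<And>v. v \<noteq> 0 \<Longrightarrow> h v v > 0" and sym: "\<And>v w. h v w = h w v"
    and e: "\<And>i j. i < DIM('f) \<Longrightarrow> j < DIM('f) \<Longrightarrow> h (e i) (e j) = (if i = j then 1 else 0)"
    and f: "\<And>i j. i < DIM('f) \<Longrightarrow> j < DIM('f) \<Longrightarrow> h (f i) (f j) = (if i = j then 1 else 0)"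
    and \<beta>: "bilinear \<beta>"
  shows "(\<Sum>i<DIM('f). \<beta> (e i) (e i)) = (\<Sum>i<DIM('f). \<beta> (f i) (f i))"
proof -
  let ?n = "DIM('f)"
  have lin: "linear (\<lambda>v. \<beta> v z)" "linear (\<beta> v)" for v z using \<beta> by (auto simp: bilinear_def)
  have 1: "\<beta> (e i) (e i) = (\<Sum>j<?n. h (e i) (f j) * \<beta> (f j) (e i))" for i
  proof -
    have "\<beta> (e i) (e i) = \<beta> (\<Sum>j<?n. h (e i) (f j) *\<^sub>R f j) (e i)"
      using orthonormal_expansion[OF h pos f, of "e i"] by simp
    then show ?thesis by (simp add: linear_sum[OF lin(1)] linear_cmul[OF lin(1)])
  qed
  have 2: "\<beta> (f j) (f j) = (\<Sum>i<?n. h (e i) (f j) * \<beta> (f j) (e i))" for j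
  proof -
    have "\<beta> (f j) (f j) = \<beta> (f j) (\<Sum>i<?n. h (f j) (e i) *\<^sub>R e i)"
      using orthonormal_expansion[OF h pos e, of "f j"] by simp
    then show ?thesis by (simp add: linear_sum[OF lin(2)] linear_cmul[OF lin(2)] sym[of "f j"])
  qed
  show ?thesis unfolding 1 2 by (rule sum.swap)
qed

section \<open>The Ricci form as a trace in one tangent space\<close>

context bismut_manifold
begin

lemma g1_pos:
  assumes p: "p \<in> points M" and w: "w \<noteq> 0"
  shows "G (p, u) w w > 0"
proof -
  obtain a b where ab: "w = hv (p, u) a + (0, b)" using lift_decomposition[OF p] .
  have "a \<noteq> 0 \<or> b \<noteq> 0" using w ab hv_simps[OF p] by (auto simp: zero_prod_def)
  moreover have "g p v v \<ge> 0" for v using g_pos[OF p, of v] g_simps[OF p] by (cases "v = 0") auto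
  ultimately show ?thesis
    unfolding ab canonical_g_eq[OF p] using g_pos[OF p] by (metis add_nonneg_pos add_pos_nonneg)
qed

lemma J1_linear:
  assumes p: "p \<in> points M"
  shows "linear (J (p, u))"
proof -
  have add: "hv (p, u) a + (0, b) + (hv (p, u) a' + (0, b')) = hv (p, u) (a + a') + (0, b + b')"
    and scale: "r *\<^sub>R (hv (p, u) a + (0, b)) = hv (p, u) (r *\<^sub>R a) + (0, r *\<^sub>R b)" for a b a' b' r
    by (simp_all add: linear_add[OF hvec_linear[OF p]] linear_cmul[OF hvec_linear[OF p]] scaleR_add_right
        scaleR_Pair prod_eq_iff)
  show ?thesis
  proof (rule linearI)
    fix w w' r
    obtain a b a' b' where w: "w = hv (p, u) a + (0, b)" "w' = hv (p, u) a' + (0, b')"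
      using lift_decomposition[OF p] by metis
    show "J (p, u) (w + w') = J (p, u) w + J (p, u) w'" "J (p, u) (r *\<^sub>R w) = r *\<^sub>R J (p, u) w"
      unfolding w add scale canonical_J_eq[OF p]
      by (simp_all add: linear_add[OF hvec_linear[OF p]] linear_cmul[OF hvec_linear[OF p]] scaleR_diff_right
          scaleR_Pair prod_eq_iff)
  qed
qed

text \<open>One linear map serves the fields over all open sets \<open>U\<close>, so a frame given
  over one domain can be compared with lifts defined over another.\<close>

lemma curvature_endomorphism:
  assumes A: "smooth_vf TB (points TB) A" and C: "smooth_vf TB (points TB) C"
    and L: "smooth_vf TB (points TB) (lie_bracket TB A C)" and p: "p \<in> points M"
  shows "\<exists>T. linear T \<and> (\<forall>U W. (p, u) \<in> U \<longrightarrow> smooth_vf TB U W \<longrightarrow>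
    curvature TB B A C W (p, u) = T (W (p, u)))"
proof (intro exI conjI allI impI)
  let ?c = "chart_at TB (p, u)"
  let ?T = "\<lambda>w. \<Sum>b\<in>Basis. (w \<bullet> b) *\<^sub>R curvature TB B A C (coord_field TB ?c b) (p, u)"
  have q: "(p, u) \<in> points TB" using p by simp
  note c = TM.chart_at[OF q]
  show "linear ?T"
    by (intro linearI) (simp_all add: inner_add_left scaleR_add_left sum.distrib scaleR_right.sum)
  fix U W assume U: "(p, u) \<in> U" and W: "smooth_vf TB U W"
  note o = TM.smooth_vf_openin[OF W]
  note sub = TM.smooth_vf_subset[OF _ o TM.openin_subset_points[OF o]]
  show "curvature TB B A C W (p, u) = ?T (W (p, u))"
    using B.curvature_expand[OF sub[OF A] sub[OF C] W sub[OF L] c U] TM.tcoord_chart_at[OF q] by simp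
qed

text \<open>Trades the frame \<open>E\<close> for orthonormal vectors \<open>f\<close> of a single
  tangent space, which can then be adapted to the splitting into horizontal and vertical
  vectors.\<close>

lemma ricci_form_trace:
  assumes E: "orthonormal_frame TB G U E" and q: "(p, u) \<in> U"
    and T: "linear T" "\<And>U W. (p, u) \<in> U \<Longrightarrow> smooth_vf TB U W \<Longrightarrow> curvature TB B A C W (p, u) = T (W (p, u))"
    and f: "\<And>i j. i < DIM('e \<times> 'e) \<Longrightarrow> j < DIM('e \<times> 'e) \<Longrightarrow> G (p, u) (f i) (f j) = (if i = j then 1 else 0)"
  shows "ricci_form TB J G B E A C (p, u) =
    1/2 * (\<Sum>i<DIM('e \<times> 'e). G (p, u) (T (f i)) (J (p, u) (f i)))"
proof -
  have sm: "smooth_vf TB U (E i)" if "i < DIM('e \<times> 'e)" for i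
    using E that unfolding orthonormal_frame_def by blast
  have pM: "p \<in> points M"
    using TM.openin_subset_points[OF TM.smooth_vf_openin[OF sm[OF DIM_positive]]] q by auto
  have on: "G (p, u) (E i (p, u)) (E j (p, u)) = (if i = j then 1 else 0)"
    if "i < DIM('e \<times> 'e)" "j < DIM('e \<times> 'e)" for i j
    using E that q unfolding orthonormal_frame_def by blast
  have gb: "linear (G (p, u) v)" "linear (\<lambda>v. G (p, u) v z)" for v z
    using g1_bilinear[OF pM, of u] unfolding bilinear_def by blast+
  have "bilinear (\<lambda>v w. G (p, u) (T v) (J (p, u) w))"
    unfolding bilinear_def
    using linear_compose[OF J1_linear[OF pM, of u] gb(1)] linear_compose[OF T(1) gb(2)] by (simp add: comp_def)
  from trace_orthonormal_invariant[OF g1_bilinear[OF pM] g1_pos[OF pM] g1_sym[OF pM] on f this]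
  have "(\<Sum>i<DIM('e \<times> 'e). G (p, u) (T (E i (p, u))) (J (p, u) (E i (p, u)))) =
      (\<Sum>i<DIM('e \<times> 'e). G (p, u) (T (f i)) (J (p, u) (f i)))" .
  moreover have "(\<Sum>i<DIM('e \<times> 'e). G (p, u) (curvature TB B A C (E i) (p, u)) (J (p, u) (E i (p, u)))) =
      (\<Sum>i<DIM('e \<times> 'e). G (p, u) (T (E i (p, u))) (J (p, u) (E i (p, u))))"
    using T(2)[OF q sm] by (intro sum.cong) auto
  ultimately show ?thesis by (simp only: ricci_form_def)
qed

text \<open>
  The reflection fixing horizontal and negating vertical vectors is an isometry which commutes with
  the curvature endomorphism and anticommutes with \<open>J\<close>, so the trace equals its negative.
\<close>

lemma ricci_form_zero:
  assumes E: "orthonormal_frame TB G U E" and q: "(p, u) \<in> U" and p: "p \<in> points M"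
    and T: "linear T" "\<And>U W. (p, u) \<in> U \<Longrightarrow> smooth_vf TB U W \<Longrightarrow> curvature TB B A C W (p, u) = T (W (p, u))"
    and hor: "\<And>a. T (hv (p, u) a) = hv (p, u) (k a)" and ver: "\<And>b. T (0, b) = (0, k' b)"
  shows "ricci_form TB J G B E A C (p, u) = 0"
proof -
  \<comment> \<open>\<open>hv (p, u) (fst w)\<close> is the horizontal part of \<open>w\<close>, so
    subtracting \<open>w\<close> from its double reverses the vertical part.\<close>
  define P where "P w = 2 *\<^sub>R hv (p, u) (fst w) - w" for w
  have P: "P (hv (p, u) a + (0, b)) = hv (p, u) a + (0, - b)" for a b
    by (simp add: P_def hvec_eq[OF p] prod_eq_iff scaleR_2)
  have iso: "G (p, u) (P v) (P w) = G (p, u) v w" for v w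
  proof -
    obtain a b a' b' where w: "v = hv (p, u) a + (0, b)" "w = hv (p, u) a' + (0, b')"
      using lift_decomposition[OF p] by metis
    show ?thesis unfolding w P canonical_g_eq[OF p] by (simp add: g_simps[OF p])
  qed
  have anti: "G (p, u) (T (P w)) (J (p, u) (P w)) = - G (p, u) (T w) (J (p, u) w)" for w
  proof -
    obtain a b where w: "w = hv (p, u) a + (0, b)" using lift_decomposition[OF p] .
    have t: "T (hv (p, u) a + (0, b)) = hv (p, u) (k a) + (0, k' b)" for b
      by (simp add: linear_add[OF T(1)] hor ver)
    \<comment> \<open>Only \<open>T\<close> is known to be linear; the oddness of \<open>k'\<close>
      is inherited from it.\<close>
    have k': "k' (- b) = - k' b"
      using ver[of "- b"] ver[of b] linear_neg[OF T(1), of "(0, b)"] by simp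
    have j: "(0, a) - hv (p, u) b = hv (p, u) (- b) + (0, a)" for b by (simp add: hv_simps[OF p])
    show ?thesis
      unfolding w P t canonical_J_eq[OF p] j canonical_g_eq[OF p] by (simp add: k' g_simps[OF p])
  qed
  have on: "G (p, u) (E i (p, u)) (E j (p, u)) = (if i = j then 1 else 0)"
    if "i < DIM('e \<times> 'e)" "j < DIM('e \<times> 'e)" for i j
    using E that q unfolding orthonormal_frame_def by blast
  have "ricci_form TB J G B E A C (p, u) =
      1/2 * (\<Sum>i<DIM('e \<times> 'e). G (p, u) (T (P (E i (p, u)))) (J (p, u) (P (E i (p, u)))))"
    by (rule ricci_form_trace[OF E q T]) (simp_all only: iso on)
  moreover have "ricci_form TB J G B E A C (p, u) =
      1/2 * (\<Sum>i<DIM('e \<times> 'e). G (p, u) (T (E i (p, u))) (J (p, u) (E i (p, u))))"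
    by (rule ricci_form_trace[OF E q T]) (simp_all only: on)
  ultimately show ?thesis by (simp add: anti sum_negf)
qed

lemma coord_lift_fields:
  assumes p: "p \<in> points M"
  shows "H (coord_field M (chart_at M p) a) (p, u) = hv (p, u) a"
    "V (coord_field M (chart_at M p) a) (p, u) = (0, a)"
    "smooth_vf TB (fst (chart_at M p) \<times> UNIV) (H (coord_field M (chart_at M p) a))"
    "smooth_vf TB (fst (chart_at M p) \<times> UNIV) (V (coord_field M (chart_at M p) a))"
    "(p, u) \<in> fst (chart_at M p) \<times> UNIV"
  using chart_at[OF p] lift_values[OF smooth_vf_coord_field[OF chart_at(1)[OF p]] chart_at(2)[OF p]] p
    smooth_vf_hlift[OF smooth_vf_coord_field[OF chart_at(1)[OF p]]]
    smooth_vf_vlift[OF smooth_vf_coord_field[OF chart_at(1)[OF p]]] by auto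

context
  fixes X Y
  assumes X: "smooth_vf M (points M) X" and Y: "smooth_vf M (points M) Y"
begin

text \<open>The brackets are lifts or zero, which gives the smoothness that
  \<open>curvature_endomorphism\<close> asks for.\<close>

lemma bracket_lifts_smooth:
  "smooth_vf TB (points TB) (lie_bracket TB (H X) (H Y))"
  "smooth_vf TB (points TB) (lie_bracket TB (H X) (V Y))"
  "smooth_vf TB (points TB) (lie_bracket TB (V X) (V Y))"
proof -
  show "smooth_vf TB (points TB) (lie_bracket TB (H X) (H Y))"
    using TM.smooth_vf_cong[OF smooth_vf_hlift[OF bracket_smooth[OF X Y]] bismut_bracket_fields(1)[OF X Y]] by simp
  show "smooth_vf TB (points TB) (lie_bracket TB (H X) (V Y))"
    using TM.smooth_vf_cong[OF smooth_vf_vlift[OF conn_smooth[OF X Y]] bismut_bracket_fields(2)[OF X Y]] by simp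
  show "smooth_vf TB (points TB) (lie_bracket TB (V X) (V Y))"
    using TM.smooth_vf_cong[OF TM.smooth_vf_zero[OF openin_tangent_bundle[OF openin_points]]
        bismut_bracket_fields(3)[OF X Y]] by simp
qed

lemma lifts_smooth: "smooth_vf TB (points TB) (H X)" "smooth_vf TB (points TB) (V X)"
  "smooth_vf TB (points TB) (V Y)" "smooth_vf TB (points TB) (H Y)"
  using smooth_vf_hlift[OF X] smooth_vf_vlift[OF X] smooth_vf_vlift[OF Y] smooth_vf_hlift[OF Y] by simp_all

text \<open>In both cases the curvature preserves the horizontal and the vertical subspace, as
  \<open>ricci_form_zero\<close> requires; its action on them is read off from lifts of coordinate
  fields.\<close>

lemma ricci_form_lifts_zero:
  assumes E: "orthonormal_frame TB G U E" and q: "(p, u) \<in> U" and p: "p \<in> points M"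
  shows "ricci_form TB J G B E (H X) (H Y) (p, u) = 0" "ricci_form TB J G B E (V X) (V Y) (p, u) = 0"
proof -
  let ?c = "chart_at M p"
  note c = chart_at[OF p]
  have sub: "smooth_vf M (fst ?c) W" if "smooth_vf M (points M) W" for W
    using smooth_vf_subset[OF that openin_chart[OF c(1)]] chart_subset[OF c(1)] by auto
  note e = smooth_vf_coord_field[OF c(1)]
  note lf = coord_lift_fields[OF p]
  obtain T where "linear T \<and> (\<forall>U W. (p, u) \<in> U \<longrightarrow> smooth_vf TB U W \<longrightarrow>
      curvature TB B (H X) (H Y) W (p, u) = T (W (p, u)))"
    using curvature_endomorphism[OF lifts_smooth(1,4) bracket_lifts_smooth(1) p] ..
  note T = conjunct1[OF this] conjunct2[OF this, rule_format]
  show "ricci_form TB J G B E (H X) (H Y) (p, u) = 0"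
  proof (rule ricci_form_zero[OF E q p T])
    show "T (hv (p, u) a) = hv (p, u) (curvature M D X Y (coord_field M ?c a) p)" for a
      using T(2)[OF lf(5,3), of a] lf(1) bismut_curvature_lifts(1)[OF sub[OF X] sub[OF Y] e c(2)] by simp
    show "T (0, b) = (0, curvature M D X Y (coord_field M ?c b) p)" for b
      using T(2)[OF lf(5,4), of b] lf(2) bismut_curvature_lifts(2)[OF sub[OF X] sub[OF Y] e c(2)] by simp
  qed
  obtain T where "linear T \<and> (\<forall>U W. (p, u) \<in> U \<longrightarrow> smooth_vf TB U W \<longrightarrow>
      curvature TB B (V X) (V Y) W (p, u) = T (W (p, u)))"
    using curvature_endomorphism[OF lifts_smooth(2,3) bracket_lifts_smooth(3) p] ..
  note T = conjunct1[OF this] conjunct2[OF this, rule_format]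
  show "ricci_form TB J G B E (V X) (V Y) (p, u) = 0"
  proof (rule ricci_form_zero[OF E q p T])
    show "T (hv (p, u) a) = hv (p, u) (gs p (gs p a (Y p)) (X p) - gs p (gs p a (X p)) (Y p))" for a
      using T(2)[OF lf(5,3), of a] lf(1) bismut_curvature_lifts(4)[OF sub[OF X] sub[OF Y] e c(2)] p by simp
    show "T (0, b) = (0, gs p (gs p b (Y p)) (X p) - gs p (gs p b (X p)) (Y p))" for b
      using T(2)[OF lf(5,4), of b] lf(2) bismut_curvature_lifts(3)[OF sub[OF X] sub[OF Y] e c(2)] p by simp
  qed
qed

section \<open>The mixed component of the Ricci form\<close>

text \<open>Differentiate
  \<open>g q (gs q (Z q) (Y q)) (Z q) = g q (Y q) (gam q (Z q) (Z q))\<close> along \<open>X\<close>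
  and use that \<open>D\<close> is metric. The first summand on the right comes from rewriting
  \<nabla> as \<open>D\<close> minus \<gamma>.\<close>

lemma adjoint_cov_deriv_trace:
  assumes Z: "smooth_vf M S Z" and p: "p \<in> S"
  shows "g p (D X (\<lambda>p. gs p (Z p) (Y p)) p - gs p (D X Z p) (Y p) - gs p (Z p) (nabla X Y p)) (Z p) =
    g p (diff_tensor D nabla X Y p) (diff_tensor D nabla Z Z p) +
    g p (cov_deriv D (diff_tensor D nabla) X Z Z p) (Y p)"
proof -
  have pM: "p \<in> points M" using in_points[OF Z p] .
  note sub = smooth_vf_subset[OF _ smooth_vf_openin[OF Z] openin_subset_points[OF smooth_vf_openin[OF Z]]]
  note X' = sub[OF X] and Y' = sub[OF Y]
  note G' = gs_smooth[OF Y' Z] and XZ = D.conn_smooth[OF X' Z]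
  have t: "smooth_vf M S (diff_tensor D nabla Z Z)"
    by (rule smooth_vf_cong[OF smooth_vf_diff[OF D.conn_smooth[OF Z Z] conn_smooth[OF Z Z]]])
      (simp add: diff_tensor_def)
  have "dir_deriv M X (\<lambda>q. g q (gs q (Z q) (Y q)) (Z q)) p =
      dir_deriv M X (\<lambda>q. g q (Y q) (diff_tensor D nabla Z Z q)) p"
    by (rule dir_deriv_cong[OF smooth_vf_openin[OF Z] p])
      (use in_points[OF Z] diff_tensor_eq[OF Z Z] in \<open>simp_all add: gs\<close>)
  then have "g p (D X (\<lambda>p. gs p (Z p) (Y p)) p) (Z p) + g p (gs p (Z p) (Y p)) (D X Z p) =
      g p (D X Y p) (gam p (Z p) (Z p)) + g p (Y p) (D X (diff_tensor D nabla Z Z) p)"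
    using D_metric[OF X' G' Z p] D_metric[OF X' Y' t p] diff_tensor_eq[OF Z Z p] by simp
  then show ?thesis
    using g_sym[OF pM, of "D X (diff_tensor D nabla Z Z) p" "Y p"]
      g_sym[OF pM, of "gam p (Z p) (D X Z p)" "Y p"] g_sym[OF pM, of "gam p (D X Z p) (Z p)" "Y p"]
    by (simp add: cov_deriv_def diff_tensor_eq[OF Z Z p] diff_tensor_eq[OF XZ Z p] diff_tensor_eq[OF Z XZ p]
        diff_tensor_eq[OF X' Y' p] nabla_eq[OF X' Y' p] g_simps[OF pM] gs[OF pM])
qed

lemma ricci_form_hlift_vlift:
  assumes E: "orthonormal_frame TB G U E" and q: "(p, u) \<in> U"
    and F: "orthonormal_frame M g W F" and p: "p \<in> W"
  shows "ricci_form TB J G B E (H X) (V Y) (p, u) =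
    - g p (diff_tensor D nabla X Y p) (frame_trace F (diff_tensor D nabla) p)
    - g p (frame_trace F (cov_deriv D (diff_tensor D nabla) X) p) (Y p)"
proof -
  let ?n = "DIM('e)"
  have sm: "smooth_vf M W (F i)" if "i < ?n" for i using F that unfolding orthonormal_frame_def by blast
  have on: "g p (F i p) (F j p) = (if i = j then 1 else 0)" if "i < ?n" "j < ?n" for i j
    using F that p unfolding orthonormal_frame_def by blast
  \<comment> \<open>Smoothness of any one frame field makes \<open>W\<close> open, and there is one
    because the dimension is positive.\<close>
  have oW: "openin (mfd_topology M) W" using smooth_vf_openin[OF sm[OF DIM_positive]] .
  have pM: "p \<in> points M" using openin_subset_points[OF oW] p by auto
  note X' = smooth_vf_subset[OF X oW openin_subset_points[OF oW]]
    and Y' = smooth_vf_subset[OF Y oW openin_subset_points[OF oW]]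
  obtain T where "linear T \<and> (\<forall>U W. (p, u) \<in> U \<longrightarrow> smooth_vf TB U W \<longrightarrow>
      curvature TB B (H X) (V Y) W (p, u) = T (W (p, u)))"
    using curvature_endomorphism[OF lifts_smooth(1,3) bracket_lifts_smooth(2) pM] ..
  note T = conjunct1[OF this] conjunct2[OF this, rule_format]
  have lin: "linear (g p v)" "linear (\<lambda>v. g p v z)" for v z
    using g_bilinear[OF pM] by (auto simp: bilinear_def)
  define k where "k i = D X (\<lambda>p. gs p (F i p) (Y p)) p - gs p (D X (F i) p) (Y p) - gs p (F i p) (nabla X Y p)" for i
  have T_h: "T (hv (p, u) (F i p)) = (0, - k i)" and T_v: "T (0, F i p) = hv (p, u) (k i)" if "i < ?n" for i
  proof -
    have q: "(p, u) \<in> W \<times> UNIV" using p by simp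
    show "T (hv (p, u) (F i p)) = (0, - k i)"
      using T(2)[OF q smooth_vf_hlift[OF sm[OF that]]] lift_values[OF sm[OF that] p]
        bismut_curvature_lifts(6)[OF X' Y' sm[OF that] p] by (simp add: k_def)
    show "T (0, F i p) = hv (p, u) (k i)"
      using T(2)[OF q smooth_vf_vlift[OF sm[OF that]]] lift_values[OF sm[OF that] p]
        bismut_curvature_lifts(5)[OF X' Y' sm[OF that] p] by (simp add: k_def)
  qed
  \<comment> \<open>Adapted basis: the horizontal lifts of the frame \<open>F\<close>, followed from
    index \<open>?n\<close> on by its vertical lifts.\<close>
  define f where "f i = (if i < ?n then hv (p, u) (F i p) else (0, F (i - ?n) p))" for i
  have "ricci_form TB J G B E (H X) (V Y) (p, u) =
      1/2 * (\<Sum>i<DIM('e \<times> 'e). G (p, u) (T (f i)) (J (p, u) (f i)))"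
    by (rule ricci_form_trace[OF E q T]) (auto simp: f_def on g1_lift[OF pM])
  also have "(\<Sum>i<DIM('e \<times> 'e). G (p, u) (T (f i)) (J (p, u) (f i))) =
      (\<Sum>i<?n. G (p, u) (T (f i)) (J (p, u) (f i))) + (\<Sum>i<?n. G (p, u) (T (f (i + ?n))) (J (p, u) (f (i + ?n))))"
    by (simp add: lessThan_atLeast0 sum.atLeastLessThan_concat[of 0 ?n "?n + ?n", symmetric]
        sum.shift_bounds_nat_ivl[of _ 0 ?n ?n, simplified])
  \<comment> \<open>The curvature and \<open>J\<close> both exchange horizontal and vertical
    vectors, each with a sign in one of the two directions. These signs fall in different halves, so
    both halves agree and the factor 1/2 disappears.\<close>
  also have "\<dots> = (\<Sum>i<?n. - g p (k i) (F i p)) + (\<Sum>i<?n. - g p (k i) (F i p))"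
    by (intro arg_cong2[where f = "(+)"] sum.cong refl)
      (auto simp: f_def T_h T_v J1_lift[OF pM] g1_lift[OF pM] g_simps[OF pM])
  also have "1/2 * \<dots> = - (\<Sum>i<?n. g p (k i) (F i p))" by (simp add: sum_negf)
  also have "(\<Sum>i<?n. g p (k i) (F i p)) =
      (\<Sum>i<?n. g p (diff_tensor D nabla X Y p) (diff_tensor D nabla (F i) (F i) p) +
        g p (cov_deriv D (diff_tensor D nabla) X (F i) (F i) p) (Y p))"
    unfolding k_def using adjoint_cov_deriv_trace[OF sm p] by (intro sum.cong) auto
  also have "\<dots> = g p (diff_tensor D nabla X Y p) (frame_trace F (diff_tensor D nabla) p) +
      g p (frame_trace F (cov_deriv D (diff_tensor D nabla) X) p) (Y p)"
    by (simp add: frame_trace_def sum.distrib linear_sum[OF lin(1)] linear_sum[OF lin(2)])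
  finally show ?thesis by simp
qed

end

section \<open>Smoothness and pointwise values of the tensors in the curvature formulas\<close>

lemma adjoint_smooth:
  assumes "smooth_vf M S X" "smooth_vf M S Y"
  shows "smooth_vf M S (adjoint_tensor M g (diff_tensor D nabla) X Y)"
  by (rule smooth_vf_cong[OF gs_smooth[OF assms(2,1)]]) (use adjoint_tensor_eq[OF assms(1)] in simp)

lemma curvature_smooth:
  assumes X: "smooth_vf M S X" and Y: "smooth_vf M S Y" and Z: "smooth_vf M S Z"
  shows "smooth_vf M S (curvature M D X Y Z)"
  unfolding curvature_def[abs_def]
  by (intro smooth_vf_add smooth_vf_diff D.conn_smooth bracket_smooth assms)

lemma cov_deriv_adjoint:
  assumes X: "smooth_vf M S X" and Y: "smooth_vf M S Y" and Z: "smooth_vf M S Z"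
  defines "\<gamma>s \<equiv> adjoint_tensor M g (diff_tensor D nabla)"
  shows "smooth_vf M S (cov_deriv D \<gamma>s X Z Y)"
    "p \<in> S \<Longrightarrow> cov_deriv D \<gamma>s X Z Y p =
      D X (\<lambda>p. gs p (Z p) (Y p)) p - gs p (D X Z p) (Y p) - gs p (Z p) (D X Y p)"
proof -
  note XZ = D.conn_smooth[OF X Z] and XY = D.conn_smooth[OF X Y]
  show "smooth_vf M S (cov_deriv D \<gamma>s X Z Y)"
    unfolding cov_deriv_def[abs_def] \<gamma>s_def
    by (intro smooth_vf_diff D.conn_smooth adjoint_smooth assms XZ XY)
  assume p: "p \<in> S"
  have "D X (\<gamma>s Z Y) p = D X (\<lambda>p. gs p (Z p) (Y p)) p"
    unfolding \<gamma>s_def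
    by (rule D.conn_cong[OF X adjoint_smooth[OF Z Y] p]) (simp_all add: adjoint_tensor_eq[OF Z])
  then show "cov_deriv D \<gamma>s X Z Y p =
      D X (\<lambda>p. gs p (Z p) (Y p)) p - gs p (D X Z p) (Y p) - gs p (Z p) (D X Y p)"
    using adjoint_tensor_eq[OF Z p] adjoint_tensor_eq[OF XZ p] by (simp add: cov_deriv_def \<gamma>s_def)
qed

end

theorem proposition5p2:
  fixes M :: "('a, 'e::euclidean_space) mfd"
    and nabla D :: "('a \<Rightarrow> 'e) \<Rightarrow> ('a \<Rightarrow> 'e) \<Rightarrow> 'a \<Rightarrow> 'e"
    and g :: "'a \<Rightarrow> 'e \<Rightarrow> 'e \<Rightarrow> real"
    and B :: "('a \<times> 'e \<Rightarrow> 'e \<times> 'e) \<Rightarrow> ('a \<times> 'e \<Rightarrow> 'e \<times> 'e) \<Rightarrow> 'a \<times> 'e \<Rightarrow> 'e \<times> 'e"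
    and X Y Z :: "'a \<Rightarrow> 'e"
  defines "TM \<equiv> tangent_bundle M"
    and "J1 \<equiv> canonical_J M nabla"
    and "g1 \<equiv> canonical_g M nabla g"
    and "H \<equiv> hlift M nabla"
    and "V \<equiv> vlift M"
    and "\<gamma> \<equiv> diff_tensor D nabla"
    and "\<gamma>s \<equiv> adjoint_tensor M g (diff_tensor D nabla)"
    and "RB \<equiv> curvature (tangent_bundle M) B"
    and "K \<equiv> curvature M D"
    and "\<rho>B \<equiv> ricci_form (tangent_bundle M) (canonical_J M nabla) (canonical_g M nabla g) B"
  assumes "affine_riemann M nabla g"
    and "levi_civita M g D"
    and "bismut_connection TM J1 g1 B"
    and "smooth_vf M (points M) X"
    and "smooth_vf M (points M) Y"
    and "smooth_vf M (points M) Z"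
  shows "(\<forall>q\<in>points TM.
            RB (H X) (H Y) (H Z) q = H (K X Y Z) q \<and>
            RB (H X) (H Y) (V Z) q = V (K X Y Z) q \<and>
            RB (V X) (V Y) (V Z) q = V (\<gamma>s (\<gamma>s Z Y) X) q - V (\<gamma>s (\<gamma>s Z X) Y) q \<and>
            RB (V X) (V Y) (H Z) q = H (\<gamma>s (\<gamma>s Z Y) X) q - H (\<gamma>s (\<gamma>s Z X) Y) q \<and>
            RB (H X) (V Y) (V Z) q = H (\<gamma>s Z (\<gamma> X Y)) q + H (cov_deriv D \<gamma>s X Z Y) q \<and>
            RB (H X) (V Y) (H Z) q = - V (\<gamma>s Z (\<gamma> X Y)) q - V (cov_deriv D \<gamma>s X Z Y) q) \<and>
         (\<forall>U E. orthonormal_frame TM g1 U E \<longrightarrow> (\<forall>q\<in>U.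
            \<rho>B E (H X) (H Y) q = 0 \<and>
            \<rho>B E (V X) (V Y) q = 0 \<and>
            (\<forall>W F. orthonormal_frame M g W F \<longrightarrow> fst q \<in> W \<longrightarrow>
               \<rho>B E (H X) (V Y) q =
                 - g (fst q) (\<gamma> X Y (fst q)) (frame_trace F \<gamma> (fst q))
                 - g (fst q) (frame_trace F (cov_deriv D \<gamma> X) (fst q)) (Y (fst q)))))"
proof -
  interpret bismut_manifold M nabla g D B
    using assms(11-13) unfolding TM_def J1_def g1_def affine_riemann_def smooth_manifold_def
    by unfold_locales auto
  note X = assms(14) and Y = assms(15) and Z = assms(16)
  note defs = TM_def J1_def g1_def H_def V_def \<gamma>_def \<gamma>s_def RB_def K_def \<rho>B_def
  have part1: "RB (H X) (H Y) (H Z) q = H (K X Y Z) q \<and>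
      RB (H X) (H Y) (V Z) q = V (K X Y Z) q \<and>
      RB (V X) (V Y) (V Z) q = V (\<gamma>s (\<gamma>s Z Y) X) q - V (\<gamma>s (\<gamma>s Z X) Y) q \<and>
      RB (V X) (V Y) (H Z) q = H (\<gamma>s (\<gamma>s Z Y) X) q - H (\<gamma>s (\<gamma>s Z X) Y) q \<and>
      RB (H X) (V Y) (V Z) q = H (\<gamma>s Z (\<gamma> X Y)) q + H (cov_deriv D \<gamma>s X Z Y) q \<and>
      RB (H X) (V Y) (H Z) q = - V (\<gamma>s Z (\<gamma> X Y)) q - V (cov_deriv D \<gamma>s X Z Y) q"
    if "q \<in> points TM" for q
  proof -
    obtain p u where q: "q = (p, u)" "p \<in> points M" using \<open>q \<in> points TM\<close> by (auto simp: TM_def)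
    note p = q(2)
    have \<gamma>XY: "smooth_vf M (points M) (diff_tensor D nabla X Y)"
      by (rule smooth_vf_cong[OF smooth_vf_diff[OF D.conn_smooth[OF X Y] conn_smooth[OF X Y]]])
        (simp add: diff_tensor_def)
    note sm = adjoint_smooth[OF adjoint_smooth[OF Z Y] X] adjoint_smooth[OF adjoint_smooth[OF Z X] Y]
      adjoint_smooth[OF Z \<gamma>XY] cov_deriv_adjoint(1)[OF X Y Z] curvature_smooth[OF X Y Z]
    note vals = lift_values[OF sm(1) p] lift_values[OF sm(2) p] lift_values[OF sm(3) p]
      lift_values[OF sm(4) p] lift_values[OF sm(5) p]
      adjoint_tensor_eq[OF adjoint_smooth[OF Z Y] p] adjoint_tensor_eq[OF adjoint_smooth[OF Z X] p]
      adjoint_tensor_eq[OF Z p] cov_deriv_adjoint(2)[OF X Y Z p] diff_tensor_eq[OF X Y p]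
    \<comment> \<open>The \<nabla> left by the bracket of lifts splits here: the
      \<open>D\<close>-part completes the covariant derivative of the adjoint, and the \<gamma>-part
      gives the composite term.\<close>
    have gs_nabla: "gs p (Z p) (nabla X Y p) = gs p (Z p) (D X Y p) - gs p (Z p) (gam p (X p) (Y p))"
      using bilinear_rsub[OF gs_bilinear[OF p]] nabla_eq[OF X Y p] by simp
    show ?thesis
      unfolding defs q vals
      by (simp add: bismut_curvature_lifts[OF X Y Z p] hv_simps[OF p] gs_nabla vals)
  qed
  have part2: "\<rho>B E (H X) (H Y) q = 0 \<and> \<rho>B E (V X) (V Y) q = 0 \<and>
      (\<forall>W F. orthonormal_frame M g W F \<longrightarrow> fst q \<in> W \<longrightarrow>
         \<rho>B E (H X) (V Y) q =
           - g (fst q) (\<gamma> X Y (fst q)) (frame_trace F \<gamma> (fst q))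
           - g (fst q) (frame_trace F (cov_deriv D \<gamma> X) (fst q)) (Y (fst q)))"
    if E: "orthonormal_frame TM g1 U E" and q: "q \<in> U" for U E q
  proof -
    note E' = E[unfolded TM_def g1_def]
    obtain p u where pu: "q = (p, u)" by (cases q)
    \<comment> \<open>Smoothness of one frame field makes \<open>U\<close> open, hence a subset of
      the bundle; index 0 exists since the dimension is positive.\<close>
    have "smooth_vf (tangent_bundle M) U (E 0)"
      using E' DIM_positive[where 'a = "'e \<times> 'e"] unfolding orthonormal_frame_def by blast
    then have p: "p \<in> points M"
      using TM.openin_subset_points[OF TM.smooth_vf_openin] q pu by fastforce
    note q' = q[unfolded pu]
    show ?thesis
      unfolding defs pu
      using ricci_form_lifts_zero[OF X Y E' q' p] ricci_form_hlift_vlift[OF X Y E' q'] by simp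
  qed
  show ?thesis using part1 part2 by blast
qed

end
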